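(* Let $R$ and $C$ be disjoint finite or countable sets, $V=C\amalg R$, $I\subseteq R\times C$, and let $p=2k$ be a positive even integer. The following assertions are equivalent. (a) $I$ is a complex completely $1$-unconditional basic sequence in $S^p$. (b) $I$ is a complex $1$-unconditional basic sequence in $S^p$. (c) For every finite subset $F\subseteq I$ there is an operator $x\in S^p$, whose support $S$ contains $F$, such that $\bigl\|\sum_{q\in S}\epsilon_qx_q\mathrm e_q\bigr\|_p$ does not depend on the complex choice of signs $\epsilon\in\mathbb T^S$. (d) $I$ is a real $1$-unconditional basic sequence in $S^p$. (e) For every finite subset $F\subseteq I$ there is an operator $x\in S^p$ with real matrix coefficients, whose support $S$ contains $F$, such that $\bigl\|\sum_{q\in S}\epsilon_qx_q\mathrm e_q\bigr\|_p$ does not depend on the real choice of signs $\epsilon\in\{-1,1\}^S$. (f) Every closed walk $P\sim(\alpha,\beta)$ of length $2s\le2k$ in $I$ satisfies $\alpha=\beta$. (g) $I$ does not contain any cycle of length $2s\le2k$ as a subgraph. (h) For each $v,w\in V$ there is at most one path in $I$ of length $l\le k$ that joins $v$ to $w$.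
   Context: $\mathbb T=\{z\in\mathbb C:|z|=1\}$. $\mathrm e_{rc}$ is the elementary matrix, i.e. the operator from $\ell^2_C$ to $\ell^2_R$ mapping $\mathrm e_c$ to $\mathrm e_r$ and all other basis vectors to $0$. $S^p$ is the Schatten-von-Neumann class of compact operators $x\colon\ell^2_C\to\ell^2_R$ with $\|x\|_p^p=\operatorname{tr}(x^*x)^{p/2}<\infty$. The matrix coefficients of $x$ are $x_q=\operatorname{tr}(\mathrm e_q^*x)$, $q\in R\times C$, and its support is $\{q:x_q\ne0\}$. $I$ is a complex (resp. real) $1$-unconditional basic sequence in $S^p$ if $\|\sum_{q\in I}\epsilon_qa_q\mathrm e_q\|_p=\|\sum_{q\in I}a_q\mathrm e_q\|_p$ for every choice of $\epsilon_q\in\mathbb T$ (resp. $\epsilon_q\in\{-1,1\}$) and every finitely supported family of complex coefficients $(a_q)_{q\in I}$. It is complex completely $1$-unconditional if the same equality holds (with $\epsilon_q\in\mathbb T$) for all finitely supported families of operator coefficients $a_q\in S^p$ (Schatten class on $\ell_2$), where $\sum a_q\mathrm e_q$ then means $\sum a_q\otimes\mathrm e_q$, an operator from $\ell_2\otimes_2\ell^2_C$ to $\ell_2\otimes_2\ell^2_R$, and the norm is the corresponding Schatten $p$-norm. $I$ is identified with the bipartite graph on $V$ with edges $\{r,c\}$, $(r,c)\in I$. A closed walk of length $2s$ in $I$ is a sequence $P=(c_1,r_1,c_2,r_2,\dots,c_s,r_s)$ with $c_i\in C$, $r_i\in R$ and $(r_i,c_i),(r_i,c_{i+1})\in I$ for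 $1\le i\le s$, where $c_{s+1}=c_1$. One writes $P\sim(\alpha,\beta)$ for $\alpha,\beta\in\mathbb N^I$ given by $\alpha_q=\#\{i:(r_i,c_i)=q\}$ and $\beta_q=\#\{i:(r_i,c_{i+1})=q\}$. A cycle is a closed walk of length at least $4$ with pairwise distinct vertices. A path of length $l$ joining $v$ to $w$ is a sequence $(v_0,\dots,v_l)$ of pairwise distinct vertices with $v_0=v$, $v_l=w$ and consecutive vertices adjacent; (h) says that the set of all paths of length at most $k$ from $v$ to $w$ has at most one element. *)

theory Defs
  imports "HOL-Analysis.Analysis"
begin

section \<open>The Hilbert space of square-summable families\<close>

typedef 'a ell2 = "{f :: 'a \<Rightarrow> complex. (\<lambda>a. (cmod (f a))\<^sup>2) summable_on UNIV}"
  morphisms coord Abs_ell2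
  by (rule exI[of _ "\<lambda>_. 0"]) simp

setup_lifting type_definition_ell2

lemma coord_summable: "(\<lambda>a. (cmod (coord f a))\<^sup>2) summable_on UNIV"
  using coord[of f] by simp

lemma square_summable_add:
  fixes f g :: "'a \<Rightarrow> complex"
  assumes "(\<lambda>a. (cmod (f a))\<^sup>2) summable_on A" "(\<lambda>a. (cmod (g a))\<^sup>2) summable_on A"
  shows "(\<lambda>a. (cmod (f a + g a))\<^sup>2) summable_on A"
proof (rule summable_on_comparison_test)
  show "(\<lambda>a. 2 * (cmod (f a))\<^sup>2 + 2 * (cmod (g a))\<^sup>2) summable_on A"
    using assms by (intro summable_on_add summable_on_cmult_right) auto
  fix a
  have "(cmod (f a + g a))\<^sup>2 \<le> (cmod (f a) + cmod (g a))\<^sup>2"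
    by (intro power_mono norm_triangle_ineq) auto
  also have "\<dots> \<le> 2 * (cmod (f a))\<^sup>2 + 2 * (cmod (g a))\<^sup>2"
    using sum_squares_bound[of "cmod (f a)" "cmod (g a)"] by (simp add: power2_sum)
  finally show "(cmod (f a + g a))\<^sup>2 \<le> 2 * (cmod (f a))\<^sup>2 + 2 * (cmod (g a))\<^sup>2" .
qed auto

lemma square_summable_mult:
  fixes f g :: "'a \<Rightarrow> complex"
  assumes "(\<lambda>a. (cmod (f a))\<^sup>2) summable_on A" "(\<lambda>a. (cmod (g a))\<^sup>2) summable_on A"
  shows "(\<lambda>a. cmod (f a * g a)) summable_on A"
proof (rule Infinite_Sum.abs_summable_on_comparison_test')
  show "(\<lambda>a. (cmod (f a))\<^sup>2 + (cmod (g a))\<^sup>2) summable_on A"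
    using assms by (intro summable_on_add) auto
  show "cmod (f a * g a) \<le> (cmod (f a))\<^sup>2 + (cmod (g a))\<^sup>2" for a
    using sum_squares_bound[of "cmod (f a)" "cmod (g a)"]
      mult_nonneg_nonneg[OF norm_ge_zero norm_ge_zero, of "f a" "g a"]
    unfolding norm_mult by linarith
qed

lift_definition cscale :: "complex \<Rightarrow> 'a ell2 \<Rightarrow> 'a ell2" is "\<lambda>z f a. z * f a"
  by (auto simp: norm_mult power_mult_distrib intro: summable_on_cmult_right)

text \<open>The complex inner product, antilinear in the first argument.\<close>

definition cinner :: "'a ell2 \<Rightarrow> 'a ell2 \<Rightarrow> complex" where
  "cinner f g = (\<Sum>\<^sub>\<infinity>a. cnj (coord f a) * coord g a)"

instantiation ell2 :: (type) real_inner
begin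

lift_definition zero_ell2 :: "'a ell2" is "\<lambda>_. 0" by simp

lift_definition plus_ell2 :: "'a ell2 \<Rightarrow> 'a ell2 \<Rightarrow> 'a ell2" is "\<lambda>f g a. f a + g a"
  by (simp add: square_summable_add)

lift_definition uminus_ell2 :: "'a ell2 \<Rightarrow> 'a ell2" is "\<lambda>f a. - f a" by simp

lift_definition minus_ell2 :: "'a ell2 \<Rightarrow> 'a ell2 \<Rightarrow> 'a ell2" is "\<lambda>f g a. f a - g a"
proof -
  fix f g :: "'a \<Rightarrow> complex"
  assume "(\<lambda>a. (cmod (f a))\<^sup>2) summable_on UNIV"
    and "(\<lambda>a. (cmod (g a))\<^sup>2) summable_on UNIV"
  then show "(\<lambda>a. (cmod (f a - g a))\<^sup>2) summable_on UNIV"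
    using square_summable_add[of f UNIV "\<lambda>a. - g a"] by simp
qed

definition scaleR_ell2 :: "real \<Rightarrow> 'a ell2 \<Rightarrow> 'a ell2" where
  "scaleR_ell2 t f = cscale (of_real t) f"

definition inner_ell2 :: "'a ell2 \<Rightarrow> 'a ell2 \<Rightarrow> real" where
  "inner_ell2 f g = Re (cinner f g)"

definition norm_ell2 :: "'a ell2 \<Rightarrow> real" where
  "norm_ell2 f = sqrt (inner f f)"

definition dist_ell2 :: "'a ell2 \<Rightarrow> 'a ell2 \<Rightarrow> real" where
  "dist_ell2 f g = norm (f - g)"

definition sgn_ell2 :: "'a ell2 \<Rightarrow> 'a ell2" where
  "sgn_ell2 f = scaleR (inverse (norm f)) f"

definition uniformity_ell2 :: "('a ell2 \<times> 'a ell2) filter" where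
  "uniformity_ell2 = (INF e\<in>{0<..}. principal {(f, g). dist f g < e})"

definition open_ell2 :: "'a ell2 set \<Rightarrow> bool" where
  "open_ell2 U \<longleftrightarrow> (\<forall>f\<in>U. \<forall>\<^sub>F (f', g) in uniformity. f' = f \<longrightarrow> g \<in> U)"

instance
proof
  fix f g h :: "'a ell2" and s t :: real
  have summ: "(\<lambda>a. cnj (coord u a) * coord v a) summable_on UNIV" for u v :: "'a ell2"
    by (rule Infinite_Sum.abs_summable_summable, rule square_summable_mult) (simp_all add: coord_summable)
  have self: "Re (cinner f f) = (\<Sum>\<^sub>\<infinity>a. (cmod (coord f a))\<^sup>2)"
    unfolding cinner_def infsum_Re[OF summ, symmetric]
    by (rule infsum_cong) (simp add: cmod_power2, simp add: power2_eq_square)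
  show "dist f g = norm (f - g)" by (rule dist_ell2_def)
  show "sgn f = scaleR (inverse (norm f)) f" by (rule sgn_ell2_def)
  show "(uniformity :: ('a ell2 \<times> 'a ell2) filter) = (INF e\<in>{0<..}. principal {(f, g). dist f g < e})"
    by (rule uniformity_ell2_def)
  show "open U \<longleftrightarrow> (\<forall>f\<in>U. \<forall>\<^sub>F (f', g) in uniformity. f' = f \<longrightarrow> g \<in> U)" for U :: "'a ell2 set"
    by (rule open_ell2_def)
  show "f + g + h = f + (g + h)" by transfer (simp add: add.assoc)
  show "f + g = g + f" by transfer (simp add: add.commute)
  show "0 + f = f" by transfer simp
  show "- f + f = 0" by transfer simp
  show "f - g = f + - g" by transfer simp
  show "t *\<^sub>R (f + g) = t *\<^sub>R f + t *\<^sub>R g"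
    unfolding scaleR_ell2_def by transfer (simp add: algebra_simps)
  show "(s + t) *\<^sub>R f = s *\<^sub>R f + t *\<^sub>R f"
    unfolding scaleR_ell2_def by transfer (simp add: algebra_simps)
  show "s *\<^sub>R t *\<^sub>R f = (s * t) *\<^sub>R f"
    unfolding scaleR_ell2_def by transfer (simp add: algebra_simps)
  show "1 *\<^sub>R f = f" unfolding scaleR_ell2_def by transfer simp
  have "cinner g f = cnj (cinner f g)"
    unfolding cinner_def infsum_cnj[symmetric] by (rule infsum_cong) simp
  then show "inner f g = inner g f" by (simp add: inner_ell2_def)
  have "cinner (f + g) h = cinner f h + cinner g h"
    unfolding cinner_def infsum_add[OF summ summ, symmetric]
    by (rule infsum_cong) (simp add: plus_ell2.rep_eq algebra_simps)
  then show "inner (f + g) h = inner f h + inner g h" by (simp add: inner_ell2_def)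
  have "cinner (t *\<^sub>R f) g = of_real t * cinner f g"
    unfolding cinner_def infsum_cmult_right'[symmetric]
    by (rule infsum_cong) (simp add: scaleR_ell2_def cscale.rep_eq)
  then show "inner (t *\<^sub>R f) g = t * inner f g" by (simp add: inner_ell2_def)
  show "0 \<le> inner f f" by (simp add: inner_ell2_def self infsum_nonneg)
  show "inner f f = 0 \<longleftrightarrow> f = 0"
  proof
    assume "inner f f = 0"
    then have "(\<Sum>\<^sub>\<infinity>a. (cmod (coord f a))\<^sup>2) = 0" by (simp add: inner_ell2_def self)
    then have "(cmod (coord f a))\<^sup>2 = 0" for a
      by (intro nonneg_infsum_le_0D[where A = UNIV]) (auto simp: coord_summable)
    then show "f = 0" by (simp add: coord_inject[symmetric] zero_ell2.rep_eq fun_eq_iff)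
  qed (simp add: inner_ell2_def cinner_def zero_ell2.rep_eq)
  show "norm f = sqrt (inner f f)" by (rule norm_ell2_def)
qed

end

lift_definition unit_vec :: "'a \<Rightarrow> 'a ell2" is "\<lambda>a b. if b = a then 1 else 0"
proof -
  fix a :: 'a
  have "(\<lambda>b. (cmod (if b = a then 1 else 0))\<^sup>2) summable_on UNIV
      \<longleftrightarrow> (\<lambda>b. (cmod (if b = a then 1 else 0))\<^sup>2) summable_on {a}"
    by (rule summable_on_cong_neutral) auto
  then show "(\<lambda>b. (cmod (if b = a then 1 else 0))\<^sup>2) summable_on UNIV"
    by simp
qed

lift_definition restrict_to :: "'a set \<Rightarrow> 'a ell2 \<Rightarrow> 'a ell2" is
  "\<lambda>A f a. if a \<in> A then f a else 0"
  by (erule summable_on_comparison_test) auto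


section \<open>Schatten classes\<close>

definition clinear_op :: "('a ell2 \<Rightarrow> 'b ell2) \<Rightarrow> bool" where
  "clinear_op x \<longleftrightarrow> bounded_linear x \<and> (\<forall>z f. x (cscale z f) = cscale z (x f))"

definition compact_op :: "('a ell2 \<Rightarrow> 'b ell2) \<Rightarrow> bool" where
  "compact_op x \<longleftrightarrow> clinear_op x \<and> compact (closure (x ` cball 0 1))"

definition trace_summable :: "('a ell2 \<Rightarrow> 'a ell2) \<Rightarrow> bool" where
  "trace_summable T \<longleftrightarrow> (\<lambda>a. cinner (unit_vec a) (T (unit_vec a))) summable_on UNIV"

definition op_trace :: "('a ell2 \<Rightarrow> 'a ell2) \<Rightarrow> complex" where
  "op_trace T = (\<Sum>\<^sub>\<infinity>a. cinner (unit_vec a) (T (unit_vec a)))"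

text \<open>
  Only even exponents \<open>p\<close> are used, so that \<open>(x\<^sup>*x)\<close> to the power \<open>p/2\<close> is an iterated composition.
  The library's \<^const>\<open>adjoint\<close> refers to the real inner product \<^term>\<open>Re (cinner f g)\<close>; for a
  bounded complex-linear operator this is the usual Hilbert space adjoint.
\<close>

definition abs_power :: "nat \<Rightarrow> ('a ell2 \<Rightarrow> 'b ell2) \<Rightarrow> 'a ell2 \<Rightarrow> 'a ell2" where
  "abs_power p x = (adjoint x \<circ> x) ^^ (p div 2)"

definition schatten_norm :: "nat \<Rightarrow> ('a ell2 \<Rightarrow> 'b ell2) \<Rightarrow> real" where
  "schatten_norm p x = Re (op_trace (abs_power p x)) powr (1 / real p)"

text \<open>
  The space \<open>\<ell>\<^sup>2\<close> over an index set \<open>A\<close> is the range of the coordinate projection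
  \<^term>\<open>restrict_to A\<close>. An operator from \<open>\<ell>\<^sup>2\<close> over \<open>C\<close> to \<open>\<ell>\<^sup>2\<close> over \<open>R\<close> is extended by \<open>0\<close> on
  the orthogonal complement of its domain.
\<close>

definition schatten_class ::
  "nat \<Rightarrow> 'a set \<Rightarrow> 'b set \<Rightarrow> ('a ell2 \<Rightarrow> 'b ell2) set" where
  "schatten_class p C R = {x. compact_op x \<and>
     x \<circ> restrict_to C = x \<and> restrict_to R \<circ> x = x \<and> trace_summable (abs_power p x)}"


section \<open>Matrix coefficients and unconditionality\<close>

text \<open>\<open>elem_op (r, c)\<close> is the elementary matrix at row \<open>r\<close> and column \<open>c\<close>.\<close>

definition elem_op :: "'r \<times> 'c \<Rightarrow> 'c ell2 \<Rightarrow> 'r ell2" where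
  "elem_op q f = cscale (coord f (snd q)) (unit_vec (fst q))"

definition matrix_coeff :: "('c ell2 \<Rightarrow> 'r ell2) \<Rightarrow> 'r \<times> 'c \<Rightarrow> complex" where
  "matrix_coeff x q = op_trace (adjoint (elem_op q) \<circ> x)"

definition matrix_support :: "'r set \<Rightarrow> 'c set \<Rightarrow> ('c ell2 \<Rightarrow> 'r ell2) \<Rightarrow> ('r \<times> 'c) set" where
  "matrix_support R C x = {q \<in> R \<times> C. matrix_coeff x q \<noteq> 0}"

text \<open>
  \<open>E\<close> is the set of admissible signs: \<^term>\<open>sphere (0::complex) 1\<close> in the complex case and
  \<open>{-1, 1}\<close> in the real case.
\<close>

definition unconditional ::
  "complex set \<Rightarrow> nat \<Rightarrow> ('r \<times> 'c) set \<Rightarrow> bool" where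
  "unconditional E p I \<longleftrightarrow>
     (\<forall>a \<epsilon>. finite {q \<in> I. a q \<noteq> 0} \<and> (\<forall>q\<in>I. \<epsilon> q \<in> E) \<longrightarrow>
        schatten_norm p (\<lambda>f. \<Sum>q\<in>{q \<in> I. a q \<noteq> 0}. cscale (\<epsilon> q * a q) (elem_op q f)) =
        schatten_norm p (\<lambda>f. \<Sum>q\<in>{q \<in> I. a q \<noteq> 0}. cscale (a q) (elem_op q f)))"

text \<open>
  The Hilbert space tensor product of \<open>\<ell>\<^sup>2\<close> over \<open>'m\<close> and \<open>\<ell>\<^sup>2\<close> over \<open>'a\<close> is identified with
  \<open>\<ell>\<^sup>2\<close> over \<open>'m \<times> 'a\<close>. The operator \<open>a \<otimes> e\<^sub>r\<^sub>c\<close> applies \<open>a\<close> to the component with second index \<open>c\<close>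
  and puts the result at second index \<open>r\<close>; the lemma \<open>tensor_elem_op_tensor\<close> gives its value on
  elementary tensors.
\<close>

lift_definition tensor :: "'m ell2 \<Rightarrow> 'a ell2 \<Rightarrow> ('m \<times> 'a) ell2" is
  "\<lambda>f g (m, a). f m * g a"
proof -
  fix f :: "'m \<Rightarrow> complex" and g :: "'a \<Rightarrow> complex"
  assume f: "(\<lambda>a. (cmod (f a))\<^sup>2) summable_on UNIV"
    and g: "(\<lambda>a. (cmod (g a))\<^sup>2) summable_on UNIV"
  have "(\<lambda>z. (cmod ((\<lambda>(m, a). f m * g a) z))\<^sup>2) summable_on (UNIV \<times> UNIV)"
  proof (rule summable_on_SigmaI)
    show "((\<lambda>a. (cmod ((\<lambda>(m, a). f m * g a) (m, a)))\<^sup>2)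
        has_sum ((cmod (f m))\<^sup>2 * (\<Sum>\<^sub>\<infinity>a. (cmod (g a))\<^sup>2))) UNIV" for m
      using has_sum_cmult_right[OF has_sum_infsum[OF g], of "(cmod (f m))\<^sup>2"]
      by (simp add: norm_mult power_mult_distrib)
    show "(\<lambda>m. (cmod (f m))\<^sup>2 * (\<Sum>\<^sub>\<infinity>a. (cmod (g a))\<^sup>2)) summable_on UNIV"
      by (intro summable_on_cmult_left f)
  qed auto
  then show "(\<lambda>z. (cmod (case z of (m, a) \<Rightarrow> f m * g a))\<^sup>2) summable_on UNIV" by simp
qed

lift_definition slice :: "'a \<Rightarrow> ('m \<times> 'a) ell2 \<Rightarrow> 'm ell2" is "\<lambda>a f m. f (m, a)"
proof -
  fix a :: 'a and f :: "'m \<times> 'a \<Rightarrow> complex"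
  assume "(\<lambda>a. (cmod (f a))\<^sup>2) summable_on UNIV"
  then have "(\<lambda>z. (cmod (f z))\<^sup>2) summable_on ((\<lambda>m. (m, a)) ` UNIV)"
    by (auto intro: summable_on_subset_banach)
  then show "(\<lambda>m. (cmod (f (m, a)))\<^sup>2) summable_on UNIV"
    by (subst (asm) summable_on_reindex) (auto simp: inj_on_def o_def)
qed

definition tensor_elem_op ::
  "('m ell2 \<Rightarrow> 'n ell2) \<Rightarrow> 'r \<times> 'c \<Rightarrow> ('m \<times> 'c) ell2 \<Rightarrow> ('n \<times> 'r) ell2" where
  "tensor_elem_op a q F = tensor (a (slice (snd q) F)) (unit_vec (fst q))"

lemma tensor_elem_op_tensor:
  assumes "clinear_op a"
  shows "tensor_elem_op a q (tensor f g) = tensor (a f) (elem_op q g)"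
proof -
  have "slice (snd q) (tensor f g) = cscale (coord g (snd q)) f"
    by transfer (simp add: mult.commute)
  moreover have "tensor (cscale z u) v = tensor u (cscale z v)"
    for z and u :: "'n ell2" and v :: "'r ell2"
    by transfer (auto simp: fun_eq_iff)
  ultimately show ?thesis
    using assms by (simp add: tensor_elem_op_def elem_op_def clinear_op_def)
qed

definition completely_unconditional ::
  "complex set \<Rightarrow> nat \<Rightarrow> ('r \<times> 'c) set \<Rightarrow> bool" where
  "completely_unconditional E p I \<longleftrightarrow>
     (\<forall>(a :: 'r \<times> 'c \<Rightarrow> nat ell2 \<Rightarrow> nat ell2) \<epsilon>.
        (\<forall>q\<in>I. a q \<in> schatten_class p UNIV UNIV) \<and>
        finite {q \<in> I. a q \<noteq> (\<lambda>_. 0)} \<and> (\<forall>q\<in>I. \<epsilon> q \<in> E) \<longrightarrow>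
        schatten_norm p
          (\<lambda>F. \<Sum>q\<in>{q \<in> I. a q \<noteq> (\<lambda>_. 0)}. cscale (\<epsilon> q) (tensor_elem_op (a q) q F)) =
        schatten_norm p
          (\<lambda>F. \<Sum>q\<in>{q \<in> I. a q \<noteq> (\<lambda>_. 0)}. tensor_elem_op (a q) q F))"

text \<open>
  For infinite support \<open>S\<close> of \<open>x\<close>, the series of the \<open>\<epsilon>\<^sub>q x\<^sub>q e\<^sub>q\<close> over \<open>q \<in> S\<close> stands for the operator
  \<open>y\<close> with these matrix coefficients. It has to lie in the Schatten class: otherwise its norm would
  be infinite for this \<open>\<epsilon>\<close>, but it is finite for \<open>\<epsilon> = 1\<close>.
\<close>

definition norm_independent_of_signs ::
  "complex set \<Rightarrow> nat \<Rightarrow> 'r set \<Rightarrow> 'c set \<Rightarrow> ('c ell2 \<Rightarrow> 'r ell2) \<Rightarrow> bool" where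
  "norm_independent_of_signs E p R C x \<longleftrightarrow>
     (\<exists>N. \<forall>\<epsilon>. (\<forall>q\<in>matrix_support R C x. \<epsilon> q \<in> E) \<longrightarrow>
        (\<exists>y\<in>schatten_class p C R.
           (\<forall>q\<in>R \<times> C. matrix_coeff y q = (if q \<in> matrix_support R C x then \<epsilon> q * matrix_coeff x q else 0)) \<and>
           schatten_norm p y = N))"


section \<open>Walks, cycles and paths\<close>

text \<open>
  The closed walk \<open>(c\<^sub>1, r\<^sub>1, \<dots>, c\<^sub>s, r\<^sub>s)\<close> of length \<open>2s\<close> is encoded by the list of the \<open>s\<close> pairs
  \<open>(c\<^sub>i, r\<^sub>i)\<close>, where \<open>s \<ge> 1\<close>.
\<close>

definition fwd_edge :: "('v \<times> 'v) list \<Rightarrow> nat \<Rightarrow> 'v \<times> 'v" where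
  "fwd_edge P i = (snd (P ! i), fst (P ! i))"

definition bwd_edge :: "('v \<times> 'v) list \<Rightarrow> nat \<Rightarrow> 'v \<times> 'v" where
  "bwd_edge P i = (snd (P ! i), fst (P ! (Suc i mod length P)))"

definition closed_walk :: "('v \<times> 'v) set \<Rightarrow> ('v \<times> 'v) list \<Rightarrow> bool" where
  "closed_walk I P \<longleftrightarrow> P \<noteq> [] \<and> (\<forall>i<length P. fwd_edge P i \<in> I \<and> bwd_edge P i \<in> I)"

definition fwd_count :: "('v \<times> 'v) list \<Rightarrow> 'v \<times> 'v \<Rightarrow> nat" where
  "fwd_count P q = card {i. i < length P \<and> fwd_edge P i = q}"

definition bwd_count :: "('v \<times> 'v) list \<Rightarrow> 'v \<times> 'v \<Rightarrow> nat" where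
  "bwd_count P q = card {i. i < length P \<and> bwd_edge P i = q}"

definition walk_length :: "('v \<times> 'v) list \<Rightarrow> nat" where
  "walk_length P = 2 * length P"

definition is_cycle :: "('v \<times> 'v) set \<Rightarrow> ('v \<times> 'v) list \<Rightarrow> bool" where
  "is_cycle I P \<longleftrightarrow> closed_walk I P \<and> walk_length P \<ge> 4 \<and> distinct (map fst P @ map snd P)"

definition edges :: "('v \<times> 'v) set \<Rightarrow> 'v set set" where
  "edges I = {{r, c} | r c. (r, c) \<in> I}"

text \<open>A path of length \<open>l\<close> is a list of \<open>l + 1\<close> vertices.\<close>

definition is_path :: "'v set \<Rightarrow> ('v \<times> 'v) set \<Rightarrow> 'v \<Rightarrow> 'v \<Rightarrow> nat \<Rightarrow> 'v list \<Rightarrow> bool" where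
  "is_path V I v w l vs \<longleftrightarrow> length vs = l + 1 \<and> set vs \<subseteq> V \<and> distinct vs \<and>
     vs ! 0 = v \<and> vs ! l = w \<and> (\<forall>i<l. {vs ! i, vs ! Suc i} \<in> edges I)"

end

theory Submission
  imports Defs
begin

text \<open>
  If \<open>I\<close> has no cycle of length at most \<open>2k\<close>, paths of length at most \<open>k\<close> are unique, so on the ball of radius
  \<open>k\<close> around any vertex \<open>c\<close> the signs \<open>\<epsilon>\<close> are the coboundary of a unimodular function \<open>\<phi>\<close>. With the
  Hermitian dilation \<open>H = x + x\<^sup>*\<close> the diagonal entry of \<open>(x\<^sup>*x)\<^sup>k\<close> at \<open>c\<close> is \<open>\<parallel>H\<^sup>k e\<^sub>c\<parallel>\<^sup>2\<close>. As \<open>H\<^sup>k e\<^sub>c\<close> only sees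
  walks of length \<open>k\<close> from \<open>c\<close>, changing the signs multiplies its components by the values of \<open>\<phi>\<close>, and
  every diagonal entry is preserved, also for operator coefficients.

  Conversely, let the norm of \<open>x\<close> not depend on the signs. One may assume that the coefficients of \<open>x\<close> are
  nonnegative and the signs real. The trace of the \<open>2k\<close>-th power of the compression of \<open>H\<close> to a finite set of
  vertices is a polynomial in the signs with nonnegative Walsh coefficients. It increases with the
  finite set and converges to the \<open>p\<close>-th power of the norm, which is constant; by Dini's theorem the
  convergence is uniform on the compact space of signs. Hence all nontrivial Walsh coefficients tend to
  \<open>0\<close>. But a cycle of length at most \<open>2k\<close> in the support keeps one of them away from \<open>0\<close>.
\<close>

section \<open>The Hilbert space of square-summable families\<close>

text \<open>The potential is only local because \<open>I\<close> may contain cycles longer than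
  \<open>2 * k\<close>, and then no single diagonal unitary need remove the signs. Each diagonal
  entry is therefore treated with a potential of its own, centred at its column. Cutting a closed
  walk of length \<open>2 * k\<close> into two halves of length \<open>k\<close> is what makes a
  ball of radius \<open>k\<close> large enough; it is also why the bound on paths is half the bound
  on cycles. The obstacle in the converse is that the operators in (c) and (e) may have infinite
  support, so that the trace is an infinite sum and a Walsh coefficient cannot be read off from a
  polynomial. Finite compressions give polynomials, but their traces may depend on the signs; only
  the limit is constant. Monotonicity of the compressed trace is what upgrades pointwise to uniform
  convergence. It is derived from log-convexity, by inner products alone, instead of from the
  interlacing of eigenvalues.\<close>

lemma ell2_eqI: "(\<And>a. coord f a = coord g a) \<Longrightarrow> f = g"
  by (simp add: coord_inject[symmetric] fun_eq_iff)

lemma coord_scaleR: "coord (t *\<^sub>R f) a = of_real t * coord f a"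
  by (simp add: scaleR_ell2_def cscale.rep_eq)

lemma coord_sum: "coord (\<Sum>i\<in>A. f i) a = (\<Sum>i\<in>A. coord (f i) a)"
  by (induction A rule: infinite_finite_induct) (auto simp: zero_ell2.rep_eq plus_ell2.rep_eq)

lemmas coord_simps = plus_ell2.rep_eq minus_ell2.rep_eq uminus_ell2.rep_eq zero_ell2.rep_eq
  cscale.rep_eq unit_vec.rep_eq restrict_to.rep_eq coord_scaleR coord_sum

lemma cinner_summable: "(\<lambda>a. cnj (coord f a) * coord g a) summable_on UNIV"
  by (rule Infinite_Sum.abs_summable_summable, rule square_summable_mult) (simp_all add: coord_summable)

lemma cinner_commute: "cinner g f = cnj (cinner f g)"
  unfolding cinner_def infsum_cnj[symmetric] by (rule infsum_cong) simp

lemma cinner_add_right: "cinner f (g + h) = cinner f g + cinner f h"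
  unfolding cinner_def infsum_add[OF cinner_summable cinner_summable, symmetric]
  by (rule infsum_cong) (simp add: coord_simps algebra_simps)

lemma cinner_cscale_right: "cinner f (cscale z g) = z * cinner f g"
  unfolding cinner_def infsum_cmult_right'[symmetric]
  by (rule infsum_cong) (simp add: coord_simps)

lemma cinner_add_left: "cinner (f + g) h = cinner f h + cinner g h"
  by (subst (1 2 3) cinner_commute) (simp add: cinner_add_right)

lemma cinner_cscale_left: "cinner (cscale z f) g = cnj z * cinner f g"
  by (subst (1 2) cinner_commute) (simp add: cinner_cscale_right)

lemma cinner_zero [simp]: "cinner f 0 = 0" "cinner 0 f = 0"
  by (simp_all add: cinner_def coord_simps)

lemma cinner_sum_left: "cinner (\<Sum>i\<in>A. f i) g = (\<Sum>i\<in>A. cinner (f i) g)"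
  by (induction A rule: infinite_finite_induct) (auto simp: cinner_add_left)

lemma cinner_unit_vec [simp]: "cinner (unit_vec a) f = coord f a"
proof -
  have "cinner (unit_vec a) f = (\<Sum>\<^sub>\<infinity>b\<in>{a}. cnj (coord (unit_vec a) b) * coord f b)"
    unfolding cinner_def by (rule infsum_cong_neutral) (auto simp: coord_simps)
  then show ?thesis by (simp add: coord_simps)
qed

lemma inner_unit_vec: "inner (unit_vec a) f = Re (coord f a)"
  by (simp add: inner_ell2_def)

lemma norm_power2_ell2: "(norm f)\<^sup>2 = (\<Sum>\<^sub>\<infinity>a. (cmod (coord f a))\<^sup>2)"
proof -
  have "(norm f)\<^sup>2 = Re (cinner f f)"
    by (simp add: power2_norm_eq_inner inner_ell2_def)
  also have "\<dots> = (\<Sum>\<^sub>\<infinity>a. (cmod (coord f a))\<^sup>2)"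
    unfolding cinner_def infsum_Re[OF cinner_summable, symmetric]
    by (rule infsum_cong) (simp add: cmod_power2, simp add: power2_eq_square)
  finally show ?thesis .
qed

lemma norm_coord_le: "cmod (coord f a) \<le> norm f"
proof -
  have "(\<Sum>b\<in>{a}. (cmod (coord f b))\<^sup>2) \<le> (norm f)\<^sup>2"
    unfolding norm_power2_ell2 by (rule finite_sum_le_infsum) (auto simp: coord_summable)
  then show ?thesis by (simp add: power2_le_iff_abs_le)
qed

lemma norm_unit_vec [simp]: "norm (unit_vec a) = 1"
  using power2_norm_eq_inner[of "unit_vec a"] norm_ge_zero[of "unit_vec a"]
  by (simp add: inner_unit_vec coord_simps power2_eq_1_iff)

lemma norm_cscale: "norm (cscale z f) = cmod z * norm f"
proof -
  have "(norm (cscale z f))\<^sup>2 = (cmod z * norm f)\<^sup>2"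
    unfolding norm_power2_ell2 power_mult_distrib infsum_cmult_right'[symmetric]
    by (simp add: coord_simps norm_mult power_mult_distrib)
  then show ?thesis by (simp add: power2_eq_iff_nonneg)
qed

lemma cscale_simps [simp]: "cscale 1 f = f" "cscale 0 f = 0" "cscale z 0 = 0"
  by (auto intro!: ell2_eqI simp: coord_simps)

lemma cscale_add: "cscale z (f + g) = cscale z f + cscale z g"
  by (auto intro!: ell2_eqI simp: coord_simps algebra_simps)

lemma cscale_add_left: "cscale (y + z) f = cscale y f + cscale z f"
  by (auto intro!: ell2_eqI simp: coord_simps algebra_simps)

lemma cscale_cscale: "cscale y (cscale z f) = cscale (y * z) f"
  by (auto intro!: ell2_eqI simp: coord_simps algebra_simps)

lemma cscale_of_real: "cscale (of_real t) f = t *\<^sub>R f"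
  by (simp add: scaleR_ell2_def)

lemma bounded_linear_cscale: "bounded_linear (cscale z)"
proof (rule bounded_linear_intro[where K = "cmod z"])
  show "cscale z (t *\<^sub>R f) = t *\<^sub>R cscale z f" for t and f :: "'a ell2"
    by (rule ell2_eqI) (simp add: coord_simps)
qed (simp_all add: norm_cscale cscale_add)

lemma restrict_to_finite: "finite A \<Longrightarrow> restrict_to A f = (\<Sum>a\<in>A. cscale (coord f a) (unit_vec a))"
  by (rule ell2_eqI) (auto simp: coord_simps sum.delta if_distrib cong: if_cong)

lemma norm_restrict_to_le: "norm (restrict_to A f) \<le> norm f"
proof (rule power2_le_imp_le)
  show "(norm (restrict_to A f))\<^sup>2 \<le> (norm f)\<^sup>2"
    unfolding norm_power2_ell2
    by (rule infsum_mono[OF coord_summable coord_summable]) (simp add: coord_simps)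
qed simp

text \<open>The squared error is the tail of the convergent series for the squared norm.\<close>

lemma restrict_to_tendsto:
  "((\<lambda>A. restrict_to A f) \<longlongrightarrow> f) (finite_subsets_at_top UNIV)"
proof -
  have "((\<lambda>A. \<Sum>a\<in>A. (cmod (coord f a))\<^sup>2) \<longlongrightarrow> (norm f)\<^sup>2) (finite_subsets_at_top UNIV)"
    unfolding norm_power2_ell2 using coord_summable[of f] by (rule infsum_tendsto)
  then have "((\<lambda>A. (norm f)\<^sup>2 - (\<Sum>a\<in>A. (cmod (coord f a))\<^sup>2)) \<longlongrightarrow> (norm f)\<^sup>2 - (norm f)\<^sup>2)
      (finite_subsets_at_top UNIV)"
    by (intro tendsto_intros)
  moreover have "\<forall>\<^sub>F A in finite_subsets_at_top UNIV.
      (norm f)\<^sup>2 - (\<Sum>a\<in>A. (cmod (coord f a))\<^sup>2) = (norm (restrict_to A f - f))\<^sup>2"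
  proof (rule eventually_finite_subsets_at_top_weakI)
    fix A :: "'a set" assume A: "finite A"
    have "(norm (restrict_to A f - f))\<^sup>2 = (\<Sum>\<^sub>\<infinity>a\<in>UNIV - A. (cmod (coord f a))\<^sup>2)"
      unfolding norm_power2_ell2 by (rule infsum_cong_neutral) (auto simp: coord_simps)
    also have "\<dots> = (\<Sum>\<^sub>\<infinity>a. (cmod (coord f a))\<^sup>2) - (\<Sum>\<^sub>\<infinity>a\<in>A. (cmod (coord f a))\<^sup>2)"
      by (rule infsum_Diff) (auto simp: coord_summable A)
    finally show "(norm f)\<^sup>2 - (\<Sum>a\<in>A. (cmod (coord f a))\<^sup>2) = (norm (restrict_to A f - f))\<^sup>2"
      by (simp add: norm_power2_ell2 A)
  qed
  ultimately have "((\<lambda>A. (norm (restrict_to A f - f))\<^sup>2) \<longlongrightarrow> 0) (finite_subsets_at_top UNIV)"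
    by (simp add: filterlim_cong[OF refl refl])
  then have "((\<lambda>A. sqrt ((norm (restrict_to A f - f))\<^sup>2)) \<longlongrightarrow> sqrt 0) (finite_subsets_at_top UNIV)"
    by (rule tendsto_real_sqrt)
  then show ?thesis by (simp add: LIM_zero_iff tendsto_norm_zero_iff)
qed

section \<open>Complex-linear operators and their adjoints\<close>

lemma clinear_opD:
  assumes "clinear_op x"
  shows "bounded_linear x" "x (cscale z f) = cscale z (x f)" "x (f + g) = x f + x g"
    "x 0 = 0" "x (\<Sum>i\<in>A. h i) = (\<Sum>i\<in>A. x (h i))" "x (t *\<^sub>R f) = t *\<^sub>R x f"
proof -
  interpret bounded_linear x using assms by (simp add: clinear_op_def)
  show "bounded_linear x" by (fact bounded_linear_axioms)
  show "x (cscale z f) = cscale z (x f)" "x (f + g) = x f + x g"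
    "x 0 = 0" "x (\<Sum>i\<in>A. h i) = (\<Sum>i\<in>A. x (h i))" "x (t *\<^sub>R f) = t *\<^sub>R x f"
    using assms by (simp_all add: clinear_op_def add zero sum scaleR)
qed

lemma clinear_opI:
  assumes "\<And>f g. x (f + g) = x f + x g" "\<And>z f. x (cscale z f) = cscale z (x f)"
    "\<And>f. norm (x f) \<le> K * norm f"
  shows "clinear_op x"
  unfolding clinear_op_def
proof (intro conjI allI bounded_linear_intro[where K = K])
  show "x (t *\<^sub>R f) = t *\<^sub>R x f" for t f
    unfolding cscale_of_real[symmetric] by (rule assms)
  show "norm (x f) \<le> norm f * K" for f
    using assms(3)[of f] by (simp add: mult.commute)
qed (rule assms)+

lemma clinear_op_zero: "clinear_op (\<lambda>f. 0)"
  by (rule clinear_opI[where K = 0]) auto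

lemma clinear_op_add: "clinear_op x \<Longrightarrow> clinear_op y \<Longrightarrow> clinear_op (\<lambda>f. x f + y f)"
  by (auto simp: clinear_op_def cscale_add intro: bounded_linear_add)

lemma clinear_op_cscale: "clinear_op x \<Longrightarrow> clinear_op (\<lambda>f. cscale z (x f))"
  unfolding clinear_op_def
  by (auto simp: cscale_cscale mult.commute[of z] intro!: bounded_linear_compose[OF bounded_linear_cscale])

lemma clinear_op_sum: "(\<And>i. i \<in> A \<Longrightarrow> clinear_op (x i)) \<Longrightarrow> clinear_op (\<lambda>f. \<Sum>i\<in>A. x i f)"
  by (induction A rule: infinite_finite_induct) (auto intro: clinear_op_zero clinear_op_add)

lemma clinear_op_comp: "clinear_op x \<Longrightarrow> clinear_op y \<Longrightarrow> clinear_op (\<lambda>f. x (y f))"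
  by (auto simp: clinear_op_def intro: bounded_linear_compose)

lemma clinear_op_restrict_to: "clinear_op (restrict_to A)"
  by (rule clinear_opI[where K = 1]) (auto simp: norm_restrict_to_le intro!: ell2_eqI simp: coord_simps)

text \<open>A phase \<open>z\<close> on \<open>f\<close> makes the complex product real and
  nonnegative; it then equals the real one, to which Cauchy-Schwarz applies.\<close>

lemma cinner_norm_le: "cmod (cinner f g) \<le> norm f * norm g"
proof -
  define z where "z = (if cinner f g = 0 then 1 else cinner f g / of_real (cmod (cinner f g)))"
  have z: "cmod z = 1" by (simp add: z_def norm_divide)
  have "cinner (cscale z f) g = of_real (cmod (cinner f g))"
    by (simp add: cinner_cscale_left z_def complex_norm_square[symmetric] power2_eq_square
        divide_simps mult.commute)
  then have "cmod (cinner f g) = inner (cscale z f) g"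
    by (simp add: inner_ell2_def)
  also have "\<dots> \<le> norm (cscale z f) * norm g" by (rule norm_cauchy_schwarz)
  finally show ?thesis by (simp add: norm_cscale z)
qed

text \<open>\<open>adjoint\<close> is defined by choice, so its characteristic property rests on
  this existence. The coordinates of \<open>x' g\<close> are forced; testing with the finite
  truncation \<open>f\<close> of this candidate bounds the square of \<open>norm f\<close> by
  \<open>K * norm f * norm g\<close>, so the partial sums of squares are bounded. The identity
  passes from finitely supported vectors to all vectors by continuity.\<close>

lemma adjoint_exists:
  assumes x: "clinear_op x"
  shows "\<exists>x'. \<forall>f g. inner (x f) g = inner f (x' g)"
proof -
  note lin = clinear_opD[OF x]
  obtain K where K: "\<And>f. norm (x f) \<le> K * norm f"
    using bounded_linear.bounded[OF lin(1)] by (auto simp: mult.commute)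
  define c where "c g a = cinner (x (unit_vec a)) g" for g a
  have le: "(\<Sum>a\<in>A. (cmod (c g a))\<^sup>2) \<le> (K * norm g)\<^sup>2" if "finite A" for A g
  proof -
    define f where "f = (\<Sum>a\<in>A. cscale (c g a) (unit_vec a))"
    have coord_f: "coord f a = (if a \<in> A then c g a else 0)" for a
      using that by (auto simp: f_def coord_simps sum.delta if_distrib cong: if_cong)
    have nf: "(norm f)\<^sup>2 = (\<Sum>a\<in>A. (cmod (c g a))\<^sup>2)"
    proof -
      have "(norm f)\<^sup>2 = (\<Sum>\<^sub>\<infinity>a\<in>A. (cmod (c g a))\<^sup>2)"
        unfolding norm_power2_ell2 by (rule infsum_cong_neutral) (auto simp: coord_f)
      then show ?thesis using that by simp
    qed
    have "cinner (x f) g = of_real (\<Sum>a\<in>A. (cmod (c g a))\<^sup>2)"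
      unfolding f_def lin cinner_sum_left cinner_cscale_left c_def[symmetric]
      by (simp add: complex_norm_square mult.commute del: of_real_power)
    then have "(norm f)\<^sup>2 = cmod (cinner (x f) g)"
      unfolding nf by (simp only: norm_of_real) (simp add: sum_nonneg)
    also have "\<dots> \<le> norm (x f) * norm g" by (rule cinner_norm_le)
    also have "\<dots> \<le> (K * norm f) * norm g" by (intro mult_right_mono K) auto
    finally have *: "norm f * norm f \<le> norm f * (K * norm g)" by (simp add: power2_eq_square mult_ac)
    have "norm f \<le> \<bar>K * norm g\<bar>"
      using * by (cases "norm f = 0") auto
    then show ?thesis unfolding nf[symmetric] by (simp add: abs_le_square_iff[symmetric])
  qed
  have summ: "(\<lambda>a. (cmod (c g a))\<^sup>2) summable_on UNIV" for g
    by (rule nonneg_bdd_above_summable_on) (auto intro!: bdd_aboveI[of _ "(K * norm g)\<^sup>2"] le)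
  define x' where "x' g = Abs_ell2 (c g)" for g
  have coord_x': "coord (x' g) = c g" for g
    unfolding x'_def using summ[of g] by (simp add: Abs_ell2_inverse)
  have fin: "inner (x (restrict_to A f)) g = inner (restrict_to A f) (x' g)" if "finite A" for A f g
    using that by (simp add: inner_ell2_def restrict_to_finite lin cinner_sum_left cinner_cscale_left
        coord_x' c_def)
  have "inner (x f) g = inner f (x' g)" for f g
  proof (rule tendsto_unique)
    show "((\<lambda>A. inner (x (restrict_to A f)) g) \<longlongrightarrow> inner (x f) g) (finite_subsets_at_top UNIV)"
      by (intro tendsto_intros bounded_linear.tendsto[OF lin(1)] restrict_to_tendsto)
    have "((\<lambda>A. inner (restrict_to A f) (x' g)) \<longlongrightarrow> inner f (x' g)) (finite_subsets_at_top UNIV)"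
      by (intro tendsto_intros restrict_to_tendsto)
    then show "((\<lambda>A. inner (x (restrict_to A f)) g) \<longlongrightarrow> inner f (x' g)) (finite_subsets_at_top UNIV)"
      by (rule Lim_transform_eventually) (auto intro!: eventually_finite_subsets_at_top_weakI simp: fin)
  qed simp
  then show ?thesis by blast
qed

lemma adjoint_inner: "clinear_op x \<Longrightarrow> inner (x f) g = inner f (adjoint x g)"
  using someI_ex[OF adjoint_exists] unfolding adjoint_def by blast

lemma adjoint_inner': "clinear_op x \<Longrightarrow> inner f (x g) = inner (adjoint x f) g"
  by (metis adjoint_inner inner_commute)

lemma inner_eqI: "(\<And>f. inner f g = inner f h) \<Longrightarrow> g = (h :: 'a :: real_inner)"
  by (metis eq_iff_diff_eq_0 inner_diff_right inner_eq_zero_iff)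

text \<open>Lets facts on the real product, such as the defining property of \<open>adjoint\<close>,
  pass to the complex one for operators that commute with \<i>.\<close>

lemma cinner_eq_inner: "cinner f g = Complex (inner f g) (inner (cscale \<i> f) g)"
  by (simp add: inner_ell2_def cinner_cscale_left complex_eq_iff)

lemma cinner_adjoint:
  assumes "clinear_op x"
  shows "cinner (x f) g = cinner f (adjoint x g)"
  using adjoint_inner[OF assms] by (simp add: cinner_eq_inner clinear_opD(2)[OF assms, symmetric])

lemma cinner_eqI: "(\<And>f. cinner f g = cinner f h) \<Longrightarrow> g = h"
  by (rule inner_eqI) (simp add: inner_ell2_def)

lemma clinear_op_adjoint:
  assumes x: "clinear_op x"
  shows "clinear_op (adjoint x)"
proof -
  obtain K where K: "\<And>f. norm (x f) \<le> K * norm f"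
    using bounded_linear.bounded[OF clinear_opD(1)[OF x]] by (auto simp: mult.commute)
  show ?thesis
  proof (rule clinear_opI[where K = K])
    show "adjoint x (f + g) = adjoint x f + adjoint x g" for f g
      by (rule inner_eqI) (simp add: adjoint_inner[OF x, symmetric] inner_add_right)
    show "adjoint x (cscale z f) = cscale z (adjoint x f)" for z f
      by (rule cinner_eqI) (simp add: cinner_adjoint[OF x, symmetric] cinner_cscale_right)
    fix f
    have "norm (adjoint x f) * norm (adjoint x f) = inner (x (adjoint x f)) f"
      by (simp add: adjoint_inner[OF x] norm_eq_sqrt_inner)
    also have "\<dots> \<le> norm (x (adjoint x f)) * norm f" by (rule norm_cauchy_schwarz)
    also have "\<dots> \<le> (K * norm (adjoint x f)) * norm f" by (intro mult_right_mono K) auto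
    finally have *: "norm (adjoint x f) * norm (adjoint x f) \<le> norm (adjoint x f) * (K * norm f)"
      by (simp add: mult_ac)
    \<comment> \<open>Needed when \<open>adjoint x f\<close> is 0, where nothing can be
      cancelled.\<close>
    have "0 \<le> K" using order_trans[OF norm_ge_zero K[of "unit_vec undefined"]] by simp
    then show "norm (adjoint x f) \<le> K * norm f"
      using * by (cases "norm (adjoint x f) = 0") auto
  qed
qed

section \<open>Finite matrices, dilations and tensor products\<close>

lemma cinner_sum_right: "cinner f (\<Sum>i\<in>A. g i) = (\<Sum>i\<in>A. cinner f (g i))"
  by (induction A rule: infinite_finite_induct) (auto simp: cinner_add_right)

lemma cinner_self: "cinner f f = of_real ((norm f)\<^sup>2)"
proof -
  have "cnj (cinner f f) = cinner f f" by (rule cinner_commute[symmetric])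
  then show ?thesis
    by (simp add: complex_eq_iff power2_norm_eq_inner inner_ell2_def)
qed

lemma funpow_clinear:
  assumes "clinear_op (x :: 'a ell2 \<Rightarrow> 'a ell2)"
  shows "clinear_op (x ^^ n)"
proof (induction n)
  case 0
  show ?case by (rule clinear_opI[where K = 1]) auto
next
  case (Suc n)
  show ?case using clinear_op_comp[OF assms Suc.IH] by (simp add: o_def)
qed

lemma coord_elem_op: "coord (elem_op q f) a = (if a = fst q then coord f (snd q) else 0)"
  by (simp add: elem_op_def coord_simps)

lemma clinear_op_elem_op: "clinear_op (elem_op q)"
proof (rule clinear_opI[where K = 1])
  show "norm (elem_op q f) \<le> 1 * norm f" for f
    by (simp add: elem_op_def norm_cscale norm_coord_le)
qed (auto simp: coord_elem_op coord_simps intro!: ell2_eqI)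

lemma cinner_unit_vec_right [simp]: "cinner f (unit_vec a) = cnj (coord f a)"
  by (subst cinner_commute) simp

lemma adjoint_elem_op: "adjoint (elem_op (r, c)) = elem_op (c, r)"
  by (rule adjoint_unique)
    (simp add: inner_ell2_def elem_op_def cinner_cscale_left cinner_cscale_right algebra_simps)

lemma matrix_coeff_eq: "matrix_coeff x (r, c) = coord (x (unit_vec c)) r"
proof -
  have "matrix_coeff x (r, c) = (\<Sum>\<^sub>\<infinity>a. if a = c then coord (x (unit_vec a)) r else 0)"
    unfolding matrix_coeff_def op_trace_def
    by (rule infsum_cong) (simp add: adjoint_elem_op coord_elem_op)
  also have "\<dots> = (\<Sum>\<^sub>\<infinity>a\<in>{c}. coord (x (unit_vec a)) r)"
    by (rule infsum_cong_neutral) auto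
  finally show ?thesis by simp
qed

text \<open>Discards from a trace the basis vectors outside the column set. The exponent is positive
  because the zeroth power would be the identity.\<close>

lemma abs_power_zero:
  assumes "clinear_op x" "x f = 0" "p div 2 > 0"
  shows "abs_power p x f = 0"
proof -
  obtain j where j: "p div 2 = Suc j" using assms(3) gr0_conv_Suc by blast
  have "clinear_op (adjoint x \<circ> x)"
    using clinear_op_comp[OF clinear_op_adjoint[OF assms(1)] assms(1)] by (simp add: o_def)
  from clinear_opD(4)[OF funpow_clinear[OF this]] show ?thesis
    by (simp add: abs_power_def j funpow_swap1 assms clinear_opD(4)[OF clinear_op_adjoint[OF assms(1)]]
        del: funpow.simps add: funpow_Suc_right)
qed

lemma clinear_matrix_op: "clinear_op (\<lambda>f. \<Sum>q\<in>F. cscale (z q) (elem_op q f))"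
  by (intro clinear_op_sum clinear_op_cscale clinear_op_elem_op)

lemma bounded_linear_cscale_left: "bounded_linear (\<lambda>z. cscale z f)"
proof (rule bounded_linear_intro[where K = "norm f"])
  show "cscale (t *\<^sub>R z) f = t *\<^sub>R cscale z f" for t z
    by (rule ell2_eqI) (simp add: coord_simps scaleR_conv_of_real)
qed (simp_all add: norm_cscale cscale_add_left)

text \<open>Each term maps the unit ball into the compact image of a disc, and sums of compact sets
  are compact.\<close>

lemma compact_matrix_op:
  assumes "finite F"
  shows "compact_op (\<lambda>f. \<Sum>q\<in>F. cscale (z q) (elem_op q f))"
proof -
  have "\<exists>K. compact K \<and> (\<lambda>f. \<Sum>q\<in>F. cscale (z q) (elem_op q f)) ` cball 0 1 \<subseteq> K"
    using assms
  proof induction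
    case empty
    show ?case by (intro exI[of _ "{0}"]) auto
  next
    case (insert q F)
    then obtain K where K: "compact K" "(\<lambda>f. \<Sum>q\<in>F. cscale (z q) (elem_op q f)) ` cball 0 1 \<subseteq> K"
      by blast
    define L where "L = (\<lambda>w. cscale w (unit_vec (fst q))) ` cball 0 (cmod (z q))"
    have L: "compact L" unfolding L_def
      by (intro compact_continuous_image linear_continuous_on bounded_linear_cscale_left compact_cball)
    have "cscale (z q) (elem_op q f) \<in> L" if "norm f \<le> 1" for f
    proof -
      have "cmod (z q * coord f (snd q)) \<le> cmod (z q)"
        using norm_coord_le[of f "snd q"] that by (simp add: norm_mult mult_left_le)
      then show ?thesis by (auto simp: L_def elem_op_def cscale_cscale)
    qed
    then have "(\<lambda>f. \<Sum>q\<in>insert q F. cscale (z q) (elem_op q f)) ` cball 0 1 \<subseteq> {x + y |x y. x \<in> L \<and> y \<in> K}"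
      using K(2) insert.hyps by (fastforce simp: image_subset_iff)
    with compact_sums[OF L K(1)] show ?case by blast
  qed
  then obtain K where K: "compact K" "(\<lambda>f. \<Sum>q\<in>F. cscale (z q) (elem_op q f)) ` cball 0 1 \<subseteq> K"
    by blast
  define S where "S = closure ((\<lambda>f. \<Sum>q\<in>F. cscale (z q) (elem_op q f)) ` cball 0 1)"
  have "K \<inter> S = S"
    unfolding S_def using K by (intro Int_absorb1 closure_minimal compact_imp_closed)
  moreover have "compact (K \<inter> S)" unfolding S_def by (rule compact_Int_closed[OF K(1) closed_closure])
  ultimately have "compact S" by simp
  then show ?thesis using clinear_matrix_op by (simp add: compact_op_def S_def)
qed

text \<open>For the trace, only the finitely many columns that occur in \<open>F\<close> can give
  nonzero diagonal entries.\<close>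

lemma matrix_op_schatten:
  assumes "finite F" "F \<subseteq> R \<times> C" "p div 2 > 0"
  shows "(\<lambda>f. \<Sum>q\<in>F. cscale (z q) (elem_op q f)) \<in> schatten_class p C R" (is "?x \<in> _")
  unfolding schatten_class_def
proof (intro CollectI conjI)
  show "compact_op ?x" by (rule compact_matrix_op[OF assms(1)])
  show "?x \<circ> restrict_to C = ?x"
    using assms(2) by (intro ext ell2_eqI) (auto simp: coord_simps coord_elem_op intro!: sum.cong)
  show "restrict_to R \<circ> ?x = ?x"
  proof (intro ext ell2_eqI)
    fix f a
    have "coord (?x f) a = 0" if "a \<notin> R"
      using assms(2) that by (auto simp: coord_simps coord_elem_op intro!: sum.neutral)
    then show "coord ((restrict_to R \<circ> ?x) f) a = coord (?x f) a"
      unfolding o_def restrict_to.rep_eq by auto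
  qed
  have "(\<lambda>a. cinner (unit_vec a) (abs_power p ?x (unit_vec a))) summable_on snd ` F"
    using assms(1) by (intro summable_on_finite) auto
  moreover have "cinner (unit_vec a) (abs_power p ?x (unit_vec a)) = 0" if "a \<notin> snd ` F" for a
  proof -
    have "?x (unit_vec a) = 0"
      by (rule ell2_eqI) (use that in \<open>force simp: coord_simps coord_elem_op intro!: sum.neutral\<close>)
    from abs_power_zero[OF clinear_matrix_op this assms(3)] show ?thesis by simp
  qed
  ultimately show "trace_summable (abs_power p ?x)"
    unfolding trace_summable_def
    by (elim summable_on_cong_neutral[THEN iffD1, rotated -1]) auto
qed

lemma matrix_coeff_matrix_op:
  assumes "finite F"
  shows "matrix_coeff (\<lambda>f. \<Sum>q\<in>F. cscale (z q) (elem_op q f)) q = (if q \<in> F then z q else 0)"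
proof -
  obtain r c where q: "q = (r, c)" by force
  have "matrix_coeff (\<lambda>f. \<Sum>q\<in>F. cscale (z q) (elem_op q f)) q = (\<Sum>q'\<in>F. if q' = q then z q' else 0)"
    unfolding q matrix_coeff_eq by (auto simp: coord_simps coord_elem_op intro!: sum.cong)
  then show ?thesis using assms by simp
qed

section \<open>Hermitian operators and the dilation\<close>

definition hermitian_op :: "('a ell2 \<Rightarrow> 'a ell2) \<Rightarrow> bool" where
  "hermitian_op H \<longleftrightarrow> clinear_op H \<and> (\<forall>f g. inner (H f) g = inner f (H g))"

lemma hermitian_funpow:
  assumes "hermitian_op H"
  shows "inner ((H ^^ i) f) ((H ^^ j) g) = inner f ((H ^^ (i + j)) g)"
proof (induction i arbitrary: f)
  case (Suc i)
  have "inner ((H ^^ Suc i) f) ((H ^^ j) g) = inner (H f) ((H ^^ (i + j)) g)"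
    by (simp add: funpow_swap1 Suc)
  then show ?case using assms by (simp add: hermitian_op_def)
qed simp

lemma hermitian_funpow_cinner:
  assumes H: "hermitian_op H"
  shows "cinner f ((H ^^ (2 * k)) f) = of_real ((norm ((H ^^ k) f))\<^sup>2)"
proof -
  have "cinner f ((H ^^ (k + k)) g) = cinner ((H ^^ k) f) ((H ^^ k) g)" for f g
    using hermitian_funpow[OF H, of k _ k]
      clinear_opD(2)[OF funpow_clinear, of H k] H
    by (simp add: cinner_eq_inner hermitian_op_def flip: clinear_opD(2)[OF funpow_clinear])
  then show ?thesis by (simp add: cinner_self mult_2)
qed

text \<open>Rows and columns are vertices of one type, so the block matrix with off-diagonal blocks
  \<open>x\<close> and its adjoint is simply their sum. For \<open>x\<close> supported in
  \<open>I\<close> it is a weighted adjacency matrix of the bipartite graph.\<close>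

definition dilation :: "('a ell2 \<Rightarrow> 'a ell2) \<Rightarrow> 'a ell2 \<Rightarrow> 'a ell2" where
  "dilation x f = x f + adjoint x f"

lemma clinear_op_dilation: "clinear_op x \<Longrightarrow> clinear_op (dilation x)"
  unfolding dilation_def by (intro clinear_op_add clinear_op_adjoint)

lemma hermitian_dilation: "clinear_op x \<Longrightarrow> hermitian_op (dilation x)"
  unfolding hermitian_op_def using clinear_op_dilation[of x]
  by (simp add: dilation_def inner_add_left inner_add_right adjoint_inner adjoint_inner')

text \<open>Since \<open>x\<close>, and hence its adjoint, squares to 0, the two alternate along the
  orbit of a vector killed by the adjoint.\<close>

lemma dilation_funpow:
  assumes x: "clinear_op x" and sq: "\<And>f. x (x f) = 0" and f: "adjoint x f = 0"
  shows "(dilation x ^^ (2 * k)) f = ((adjoint x \<circ> x) ^^ k) f"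
proof -
  have sq': "adjoint x (adjoint x g) = 0" for g
    by (rule inner_eqI) (simp add: adjoint_inner[OF x, symmetric] sq)
  define y where "y = adjoint x \<circ> x"
  \<comment> \<open>The second conjunct keeps the orbit in the kernel of the adjoint at even times,
    so that the next step consists of \<open>x\<close> alone.\<close>
  have "(dilation x ^^ (2 * k)) f = (y ^^ k) f \<and> adjoint x ((y ^^ k) f) = 0"
  proof (induction k)
    case (Suc k)
    let ?g = "(y ^^ k) f"
    have "(dilation x ^^ (2 * Suc k)) f = dilation x (dilation x ?g)" using Suc by simp
    also have "\<dots> = adjoint x (x ?g)" using Suc by (simp add: dilation_def sq)
    also have "\<dots> = y ?g" by (simp add: y_def)
    finally show ?case using sq'[of "x ?g"] y_def[THEN fun_cong, of ?g] by simp
  qed (simp add: f)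
  then show ?thesis by (simp add: y_def)
qed

lemma trace_term:
  assumes "clinear_op x" "\<And>f. x (x f) = 0" "adjoint x f = 0"
  shows "cinner f (abs_power (2 * k) x f) = of_real ((norm ((dilation x ^^ k) f))\<^sup>2)"
  using hermitian_funpow_cinner[OF hermitian_dilation[OF assms(1)], of f k] dilation_funpow[OF assms, of k]
  by (simp add: abs_power_def)

lemma schatten_classD:
  assumes y: "y \<in> schatten_class p C R" and RC: "R \<inter> C = {}"
  shows "clinear_op y" "y (y f) = 0" "c \<notin> C \<Longrightarrow> y (unit_vec c) = 0"
    "r \<notin> R \<Longrightarrow> adjoint y (unit_vec r) = 0" "r \<notin> R \<Longrightarrow> coord (y f) r = 0"
    "c \<notin> C \<Longrightarrow> coord (adjoint y f) c = 0"
proof -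
  show lin: "clinear_op y" using y by (simp add: schatten_class_def compact_op_def)
  have C: "y (restrict_to C f) = y f" and R: "restrict_to R (y f) = y f" for f
    using y by (auto simp: schatten_class_def fun_eq_iff)
  have 0: "restrict_to C (restrict_to R f) = 0" for f
    using RC by (auto intro!: ell2_eqI simp: coord_simps)
  show "y (y f) = 0" using 0[of "y f"] C[of "y f"] R[of f] clinear_opD(4)[OF lin] by simp
  show c: "y (unit_vec c) = 0" if "c \<notin> C" for c
  proof -
    have "restrict_to C (unit_vec c) = 0" using that by (auto intro!: ell2_eqI simp: coord_simps)
    then show ?thesis using C[of "unit_vec c"] clinear_opD(4)[OF lin] by simp
  qed
  show r: "coord (y f) r = 0" if "r \<notin> R" for f r
    using R[of f] that by (metis restrict_to.rep_eq)
  show "adjoint y (unit_vec r) = 0" if "r \<notin> R"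
    by (rule inner_eqI) (simp add: adjoint_inner[OF lin, symmetric] inner_commute[of _ "unit_vec _"]
        inner_unit_vec r[OF that])
  show "coord (adjoint y f) c = 0" if "c \<notin> C"
    using cinner_adjoint[OF lin, of "unit_vec c" f] c[OF that] by simp
qed

text \<open>A basis vector outside \<open>C\<close> is killed by \<open>y\<close>. One in
  \<open>C\<close> is not in \<open>R\<close>, hence is killed by the adjoint, so that
  \<open>trace_term\<close> applies.\<close>

lemma schatten_trace:
  assumes y: "y \<in> schatten_class (2 * k) C R" and RC: "R \<inter> C = {}" and k: "k > 0"
  shows "((\<lambda>c. (norm ((dilation y ^^ k) (unit_vec c)))\<^sup>2) has_sum Re (op_trace (abs_power (2 * k) y))) C"
proof -
  note D = schatten_classD[OF y RC]
  have "((\<lambda>a. cinner (unit_vec a) (abs_power (2 * k) y (unit_vec a))) has_sum op_trace (abs_power (2 * k) y)) UNIV"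
    using y unfolding schatten_class_def trace_summable_def op_trace_def by (auto intro: has_sum_infsum)
  from has_sum_Re[OF this] show ?thesis
  proof (rule has_sum_cong_neutral[THEN iffD1, rotated -1])
    fix a assume "a \<in> UNIV - C"
    then show "Re (cinner (unit_vec a) (abs_power (2 * k) y (unit_vec a))) = 0"
      using abs_power_zero[OF D(1) D(3)] k by simp
  next
    fix a assume "a \<in> UNIV \<inter> C"
    then have "a \<notin> R" using RC by auto
    then show "Re (cinner (unit_vec a) (abs_power (2 * k) y (unit_vec a))) = (norm ((dilation y ^^ k) (unit_vec a)))\<^sup>2"
      by (subst trace_term[OF D(1,2)]) (auto simp: D(4))
  qed auto
qed

section \<open>Tensor products with elementary matrices\<close>

lemma coord_tensor: "coord (tensor f g) (m, a) = coord f m * coord g a"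
  by (simp add: tensor.rep_eq)

lemma coord_slice: "coord (slice a F) m = coord F (m, a)"
  by (simp add: slice.rep_eq)

lemma coord_tensor_elem_op:
  "coord (tensor_elem_op a q F) (m, v) = (if v = fst q then coord (a (slice (snd q) F)) m else 0)"
  by (simp add: tensor_elem_op_def coord_tensor coord_simps)

text \<open>Makes \<open>slice r\<close> the adjoint of tensoring with the basis vector at
  \<open>r\<close>; the norm bound for slices and the adjoint of \<open>tensor_elem_op\<close> both
  come from this.\<close>

lemma cinner_tensor_unit: "cinner (tensor u (unit_vec r)) G = cinner u (slice r G)"
proof -
  have "cinner (tensor u (unit_vec r)) G =
      (\<Sum>\<^sub>\<infinity>z\<in>(\<lambda>m. (m, r)) ` UNIV. cnj (coord (tensor u (unit_vec r)) z) * coord G z)"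
    unfolding cinner_def by (rule infsum_cong_neutral) (auto simp: coord_tensor coord_simps)
  also have "\<dots> = cinner u (slice r G)"
    unfolding cinner_def by (subst infsum_reindex) (auto simp: inj_on_def o_def coord_tensor coord_simps coord_slice)
  finally show ?thesis .
qed

lemma inner_tensor_unit: "inner (tensor u (unit_vec r)) G = inner u (slice r G)"
  by (simp add: inner_ell2_def cinner_tensor_unit)

lemma slice_tensor_unit: "slice c (tensor u (unit_vec r)) = (if c = r then u else 0)"
  by (auto intro!: ell2_eqI simp: coord_slice coord_tensor coord_simps)

lemma norm_tensor_unit: "norm (tensor u (unit_vec r)) = norm u"
  by (simp add: norm_eq_sqrt_inner inner_tensor_unit slice_tensor_unit)

lemma norm_slice_le: "norm (slice r G) \<le> norm G"
proof -
  have "norm (slice r G) * norm (slice r G) = inner (tensor (slice r G) (unit_vec r)) G"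
    by (simp add: inner_tensor_unit norm_eq_sqrt_inner)
  also have "\<dots> \<le> norm (slice r G) * norm G"
    using norm_cauchy_schwarz[of "tensor (slice r G) (unit_vec r)" G] by (simp add: norm_tensor_unit)
  finally show ?thesis by (cases "norm (slice r G) = 0") auto
qed

lemma slice_simps: "slice r (F + G) = slice r F + slice r G" "slice r (cscale z F) = cscale z (slice r F)"
  "slice r 0 = 0"
  by (auto intro!: ell2_eqI simp: coord_slice coord_simps)

lemma clinear_op_tensor_elem_op:
  assumes a: "clinear_op a"
  shows "clinear_op (tensor_elem_op a q)"
proof -
  obtain K where K: "\<And>f. norm (a f) \<le> K * norm f"
    using bounded_linear.bounded[OF clinear_opD(1)[OF a]] by (auto simp: mult.commute)
  show ?thesis
  proof (rule clinear_opI[where K = "\<bar>K\<bar>"])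
    fix f
    have "norm (a (slice (snd q) f)) \<le> \<bar>K\<bar> * norm (slice (snd q) f)"
      by (rule order_trans[OF K]) (simp add: mult_right_mono)
    also have "\<dots> \<le> \<bar>K\<bar> * norm f" by (intro mult_left_mono norm_slice_le) auto
    finally show "norm (tensor_elem_op a q f) \<le> \<bar>K\<bar> * norm f"
      by (simp add: tensor_elem_op_def norm_tensor_unit)
  qed (auto intro!: ell2_eqI simp: coord_tensor_elem_op coord_simps slice_simps clinear_opD[OF a] split_paired_all)
qed

lemma adjoint_tensor_elem_op:
  assumes a: "clinear_op a"
  shows "adjoint (tensor_elem_op a (r, c)) = tensor_elem_op (adjoint a) (c, r)"
proof (rule adjoint_unique, intro allI)
  fix F G
  have "inner (tensor_elem_op a (r, c) F) G = inner (a (slice c F)) (slice r G)"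
    by (simp add: tensor_elem_op_def inner_tensor_unit)
  also have "\<dots> = inner (slice c F) (adjoint a (slice r G))" by (rule adjoint_inner[OF a])
  also have "\<dots> = inner F (tensor_elem_op (adjoint a) (c, r) G)"
    by (subst (2) inner_commute) (simp add: tensor_elem_op_def inner_tensor_unit inner_commute[of "slice c F"])
  finally show "inner (tensor_elem_op a (r, c) F) G = inner F (tensor_elem_op (adjoint a) (c, r) G)" .
qed

lemma adjoint_sum:
  assumes "\<And>i. i \<in> A \<Longrightarrow> clinear_op (x i)"
  shows "adjoint (\<lambda>f. \<Sum>i\<in>A. cscale (z i) (x i f)) g = (\<Sum>i\<in>A. cscale (cnj (z i)) (adjoint (x i) g))"
proof -
  have lin: "clinear_op (\<lambda>f. \<Sum>i\<in>A. cscale (z i) (x i f))"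
    using assms by (intro clinear_op_sum clinear_op_cscale)
  show ?thesis
  proof (rule cinner_eqI)
    fix f
    have "cinner f (adjoint (\<lambda>f. \<Sum>i\<in>A. cscale (z i) (x i f)) g) = (\<Sum>i\<in>A. cnj (z i) * cinner (x i f) g)"
      unfolding cinner_adjoint[OF lin, symmetric] by (simp add: cinner_sum_left cinner_cscale_left)
    also have "\<dots> = (\<Sum>i\<in>A. cnj (z i) * cinner f (adjoint (x i) g))"
      by (intro sum.cong refl) (simp add: cinner_adjoint assms)
    finally show "cinner f (adjoint (\<lambda>f. \<Sum>i\<in>A. cscale (z i) (x i f)) g)
        = cinner f (\<Sum>i\<in>A. cscale (cnj (z i)) (adjoint (x i) g))"
      by (simp add: cinner_sum_right cinner_cscale_right)
  qed
qed

section \<open>Compressions of bipartite Hermitian operators\<close>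

text \<open>Passes from dilations of operators with real coefficients to a class that is stable
  under compression, so that an inequality can be applied to a compression in place of
  \<open>H\<close>.\<close>

definition bipartite_op :: "'a set \<Rightarrow> 'a set \<Rightarrow> ('a ell2 \<Rightarrow> 'a ell2) \<Rightarrow> bool" where
  "bipartite_op C R H \<longleftrightarrow> hermitian_op H \<and> R \<inter> C = {} \<and> (\<forall>a b. coord (H (unit_vec a)) b \<in> \<real>) \<and>
     (\<forall>a b. coord (H (unit_vec a)) b \<noteq> 0 \<longrightarrow> a \<in> C \<and> b \<in> R \<or> a \<in> R \<and> b \<in> C)"

definition compress :: "'a set \<Rightarrow> ('a ell2 \<Rightarrow> 'a ell2) \<Rightarrow> 'a ell2 \<Rightarrow> 'a ell2" where
  "compress A H f = restrict_to A (H (restrict_to A f))"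

definition op_entry :: "('a ell2 \<Rightarrow> 'a ell2) \<Rightarrow> 'a \<Rightarrow> 'a \<Rightarrow> real" where
  "op_entry H a b = Re (coord (H (unit_vec b)) a)"

lemma inner_restrict_to: "inner (restrict_to A f) g = inner f (restrict_to A g)"
  unfolding inner_ell2_def cinner_def
  by (intro arg_cong[where f = Re] infsum_cong) (auto simp: coord_simps)

lemma restrict_to_unit_vec: "restrict_to A (unit_vec a) = (if a \<in> A then unit_vec a else 0)"
  by (auto intro!: ell2_eqI simp: coord_simps)

lemma restrict_to_restrict_to: "restrict_to A (restrict_to B f) = restrict_to (A \<inter> B) f"
  by (auto intro!: ell2_eqI simp: coord_simps)

lemma bipartite_opD:
  assumes "bipartite_op C R H"
  shows "hermitian_op H" "clinear_op H" "inner (H f) g = inner f (H g)"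
  using assms by (auto simp: bipartite_op_def hermitian_op_def)

lemma bipartite_compress:
  assumes "bipartite_op C R H"
  shows "bipartite_op C R (compress A H)"
proof -
  have "clinear_op (compress A H)"
    unfolding compress_def by (intro clinear_op_comp[OF clinear_op_restrict_to]
        clinear_op_comp[OF bipartite_opD(2)[OF assms]] clinear_op_restrict_to)
  moreover have "coord (compress A H (unit_vec a)) b = (if a \<in> A \<and> b \<in> A then coord (H (unit_vec a)) b else 0)" for a b
    using clinear_opD(4)[OF bipartite_opD(2)[OF assms]]
    by (simp add: compress_def restrict_to_unit_vec coord_simps)
  ultimately show ?thesis
    using assms unfolding bipartite_op_def hermitian_op_def
    by (auto simp: compress_def inner_restrict_to split: if_splits)
qed

lemma compress_compress: "A \<subseteq> B \<Longrightarrow> compress A (compress B H) = compress A H"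
  by (auto simp: compress_def restrict_to_restrict_to Int_absorb1 Int_absorb2)

lemma op_entry_sym:
  assumes "bipartite_op C R H"
  shows "op_entry H a b = op_entry H b a"
  using bipartite_opD(3)[OF assms, of "unit_vec a" "unit_vec b"]
  by (simp add: op_entry_def inner_unit_vec inner_commute[of _ "unit_vec _"])

lemma compress_unit_vec:
  assumes H: "bipartite_op C R H" and A: "finite A" "a \<in> A"
  shows "compress A H (unit_vec a) = (\<Sum>b\<in>A. op_entry H b a *\<^sub>R unit_vec b)"
proof -
  have "coord (H (unit_vec a)) b = of_real (op_entry H b a)" for b
    using H by (simp add: bipartite_op_def op_entry_def)
  then show ?thesis
    using A by (simp add: compress_def restrict_to_unit_vec restrict_to_finite cscale_of_real)
qed

text \<open>Where a walk that starts in \<open>C\<close> stands after \<open>i\<close>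
  steps.\<close>

definition side :: "'a set \<Rightarrow> 'a set \<Rightarrow> nat \<Rightarrow> 'a set" where
  "side C R i = (if even i then C else R)"

lemma compress_unit_vec_side:
  assumes H: "bipartite_op C R H" and A: "finite A" "a \<in> A \<inter> side C R i"
  shows "compress A H (unit_vec a) = (\<Sum>b\<in>A \<inter> side C R (Suc i). op_entry H b a *\<^sub>R unit_vec b)"
proof -
  have *: "op_entry H b a = 0" if "b \<notin> side C R (Suc i)" for b
    using H A(2) that unfolding bipartite_op_def op_entry_def side_def
    by (auto split: if_splits) (metis (no_types, opaque_lifting) IntI emptyE zero_complex.sel(1))+
  then show ?thesis
    using A by (subst compress_unit_vec[OF H]) (auto intro!: sum.mono_neutral_right dest: contrapos_np[OF _ *])
qed

text \<open>
  Cyclicity of the trace of \<open>U\<^sup>*WK\<close>, where \<open>K\<close> is the compression of \<open>H\<close>. Moving the factor \<open>K\<close> exchanges the two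
  sides of the bipartition.
\<close>

lemma sum_inner_compress:
  assumes H: "bipartite_op C R H" and A: "finite A" and U: "clinear_op U" and W: "clinear_op W"
  shows "(\<Sum>a\<in>A \<inter> side C R i. inner (U (unit_vec a)) (W (compress A H (unit_vec a)))) =
    (\<Sum>b\<in>A \<inter> side C R (Suc i). inner (U (compress A H (unit_vec b))) (W (unit_vec b)))"
    (is "?L = ?R")
proof -
  let ?f = "\<lambda>a b. op_entry H b a * inner (U (unit_vec a)) (W (unit_vec b))"
  have "?L = (\<Sum>a\<in>A \<inter> side C R i. \<Sum>b\<in>A \<inter> side C R (Suc i). ?f a b)"
    by (intro sum.cong refl)
      (simp add: compress_unit_vec_side[OF H A, where i = i] clinear_opD[OF W] inner_sum_right)
  also have "\<dots> = (\<Sum>b\<in>A \<inter> side C R (Suc i). \<Sum>a\<in>A \<inter> side C R i. ?f a b)"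
    by (rule sum.swap)
  also have "\<dots> = (\<Sum>b\<in>A \<inter> side C R (Suc i). \<Sum>a\<in>A \<inter> side C R (Suc (Suc i)). ?f a b)"
    by (simp add: side_def)
  also have "\<dots> = ?R"
    by (intro sum.cong refl)
      (simp add: compress_unit_vec_side[OF H A, where i = "Suc i"] clinear_opD[OF U] inner_sum_left op_entry_sym[OF H])
  finally show ?thesis .
qed

lemma sum_inner_square_le:
  fixes u v :: "'a \<Rightarrow> 'b :: real_inner"
  shows "(\<Sum>a\<in>A. inner (u a) (v a))\<^sup>2 \<le> (\<Sum>a\<in>A. (norm (u a))\<^sup>2) * (\<Sum>a\<in>A. (norm (v a))\<^sup>2)"
proof -
  have "\<bar>\<Sum>a\<in>A. inner (u a) (v a)\<bar> \<le> (\<Sum>a\<in>A. norm (u a) * norm (v a))"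
    by (rule order_trans[OF sum_abs]) (intro sum_mono Cauchy_Schwarz_ineq2)
  then have "(\<Sum>a\<in>A. inner (u a) (v a))\<^sup>2 \<le> (\<Sum>a\<in>A. norm (u a) * norm (v a))\<^sup>2"
    by (simp add: abs_le_square_iff[symmetric])
  also have "\<dots> \<le> (\<Sum>a\<in>A. (norm (u a))\<^sup>2) * (\<Sum>a\<in>A. (norm (v a))\<^sup>2)"
    by (rule Cauchy_Schwarz_ineq_sum)
  finally show ?thesis .
qed

text \<open>Log-convexity makes the successive quotients of \<open>s\<close> increase, so a last
  quotient of at most 1 forces all of them to be at most 1; the induction runs downwards from
  \<open>k - 1\<close>. It avoids quotients themselves, as terms may vanish.\<close>

lemma decreasing_of_log_convex:
  fixes s :: "nat \<Rightarrow> real"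
  assumes nonneg: "\<And>i. s i \<ge> 0" and convex: "\<And>i. Suc i < k \<Longrightarrow> (s (Suc i))\<^sup>2 \<le> s i * s (Suc (Suc i))"
    and last: "k > 0 \<Longrightarrow> s k \<le> s (k - 1)"
  shows "s k \<le> s 0"
proof (cases "k = 0")
  case False
  have "i \<le> k - 1 \<Longrightarrow> s (Suc i) \<le> s i" for i
  proof (induction i rule: inc_induct)
    case base
    then show ?case using last False by simp
  next
    case (step n)
    have "s (Suc n) * s (Suc n) \<le> s n * s (Suc (Suc n))"
      using convex[of n] step.hyps by (simp add: power2_eq_square)
    also have "\<dots> \<le> s n * s (Suc n)" by (intro mult_left_mono step.IH nonneg)
    finally show ?case
      using nonneg[of "Suc n"] nonneg[of n] by (cases "s (Suc n) = 0") auto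
  qed
  note step = this
  have "i \<le> k \<Longrightarrow> s i \<le> s 0" for i
  proof (induction i)
    case (Suc i)
    moreover have "i \<le> k - 1" using Suc.prems by simp
    ultimately show ?case using step[of i] by simp
  qed simp
  then show ?thesis by simp
qed simp

text \<open>
  The quantities \<open>\<Sum>\<^sub>a \<parallel>H\<^bsup>k-i\<^esup> K\<^sup>i e\<^sub>a\<parallel>\<^sup>2\<close>, summed over alternating sides of the bipartition, interpolate between the
  two sides of the inequality. By cyclicity and the Cauchy-Schwarz inequality they are log-convex in \<open>i\<close>, and the
  last one is at most the one before, since \<open>K\<close> and \<open>H\<close> agree between vectors supported in \<open>A\<close>.
\<close>

lemma trace_compress_le:
  assumes H: "bipartite_op C R H" and A: "finite A"
  shows "(\<Sum>a\<in>A \<inter> C. (norm ((compress A H ^^ k) (unit_vec a)))\<^sup>2)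
    \<le> (\<Sum>a\<in>A \<inter> C. (norm ((H ^^ k) (unit_vec a)))\<^sup>2)"
proof -
  define K where "K = compress A H"
  note Hh = bipartite_opD[OF H]
  have K: "bipartite_op C R K" unfolding K_def by (rule bipartite_compress[OF H])
  note Kh = bipartite_opD[OF K]
  note powH = funpow_clinear[OF Hh(2)] and powK = funpow_clinear[OF Kh(2)]
  define s where "s i = (\<Sum>a\<in>A \<inter> side C R i. (norm ((H ^^ (k - i)) ((K ^^ i) (unit_vec a))))\<^sup>2)" for i
  have shift: "(\<Sum>a\<in>A \<inter> side C R i. inner (U ((K ^^ i) (unit_vec a))) (W ((K ^^ Suc (Suc i)) (unit_vec a)))) =
      (\<Sum>b\<in>A \<inter> side C R (Suc i). inner (U ((K ^^ Suc i) (unit_vec b))) (W ((K ^^ Suc i) (unit_vec b))))"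
    if "clinear_op U" "clinear_op W" for i U W
    using sum_inner_compress[OF H A clinear_op_comp[OF that(1) powK[of i]]
        clinear_op_comp[OF that(2) powK[of "Suc i"]], where i = i]
    by (simp only: K_def[symmetric] funpow_Suc_right o_apply)
  have id: "clinear_op (\<lambda>f. f)" by (rule clinear_opI[where K = 1]) auto
  \<comment> \<open>The traces of an even power of \<open>K\<close> over the two sides agree. This
    brings \<open>s k\<close> back to \<open>C\<close> when \<open>k\<close> is odd, and it serves
    the last inequality.\<close>
  have swap: "(\<Sum>a\<in>A \<inter> side C R i. (norm ((K ^^ Suc i) (unit_vec a)))\<^sup>2) =
      (\<Sum>b\<in>A \<inter> side C R (Suc i). (norm ((K ^^ Suc i) (unit_vec b)))\<^sup>2)" for i
    using shift[OF id id, of i] hermitian_funpow[OF Kh(1), of i _ "Suc (Suc i)"]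
      hermitian_funpow[OF Kh(1), of "Suc i" _ "Suc i"]
    by (simp add: power2_norm_eq_inner del: funpow.simps)
  have "s k \<le> s 0"
  proof (rule decreasing_of_log_convex)
    show "s i \<ge> 0" for i by (simp add: s_def sum_nonneg)
  next
    fix i assume i: "Suc i < k"
    \<comment> \<open>One factor \<open>H\<close> changes sides, so that both exponents become the
      middle one.\<close>
    have H1: "inner ((H ^^ (k - i)) f) ((H ^^ (k - Suc (Suc i))) g) = inner ((H ^^ (k - Suc i)) f) ((H ^^ (k - Suc i)) g)" for f g
      using i hermitian_funpow[OF Hh(1)] by (simp add: hermitian_funpow[OF Hh(1)] add_ac)
    have "s (Suc i) = (\<Sum>a\<in>A \<inter> side C R i.
        inner ((H ^^ (k - i)) ((K ^^ i) (unit_vec a))) ((H ^^ (k - Suc (Suc i))) ((K ^^ Suc (Suc i)) (unit_vec a))))"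
      unfolding H1 s_def power2_norm_eq_inner by (rule shift[OF powH powH, symmetric])
    then have "(s (Suc i))\<^sup>2 \<le> s i * (\<Sum>a\<in>A \<inter> side C R i. (norm ((H ^^ (k - Suc (Suc i))) ((K ^^ Suc (Suc i)) (unit_vec a))))\<^sup>2)"
      unfolding s_def[of i] by (simp only: sum_inner_square_le)
    then show "(s (Suc i))\<^sup>2 \<le> s i * s (Suc (Suc i))"
      by (simp add: s_def[of "Suc (Suc i)"] side_def)
  next
    assume "k > 0"
    then obtain j where j: "k = Suc j" using gr0_conv_Suc by blast
    have resK: "restrict_to A (K f) = K f" for f
      by (simp add: K_def compress_def restrict_to_restrict_to)
    have res: "restrict_to A ((K ^^ i) (unit_vec a)) = (K ^^ i) (unit_vec a)" if "a \<in> A" for a i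
      using that by (cases i) (simp_all add: restrict_to_unit_vec resK)
    have "inner ((K ^^ j) (unit_vec a)) ((K ^^ Suc k) (unit_vec a)) =
        inner (H ((K ^^ j) (unit_vec a))) ((K ^^ k) (unit_vec a))" if "a \<in> A" for a
    proof -
      have "inner ((K ^^ j) (unit_vec a)) ((K ^^ Suc k) (unit_vec a)) =
        inner (restrict_to A ((K ^^ j) (unit_vec a))) (H (restrict_to A ((K ^^ k) (unit_vec a))))"
        by (simp add: inner_restrict_to K_def compress_def)
      then show ?thesis using that by (simp only: res Hh(3))
    qed
    then have "s k = (\<Sum>a\<in>A \<inter> side C R j. inner (H ((K ^^ j) (unit_vec a))) ((K ^^ k) (unit_vec a)))"
      using shift[OF id id, of j] by (simp add: s_def power2_norm_eq_inner j del: funpow.simps)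
    \<comment> \<open>By \<open>swap\<close> the second factor is again \<open>s k\<close>, which
      then cancels.\<close>
    then have "(s k)\<^sup>2 \<le> s j * (\<Sum>a\<in>A \<inter> side C R j. (norm ((K ^^ k) (unit_vec a)))\<^sup>2)"
      using sum_inner_square_le[of "\<lambda>a. H ((K ^^ j) (unit_vec a))" "\<lambda>a. (K ^^ k) (unit_vec a)" "A \<inter> side C R j"]
      by (simp add: s_def[of j] j)
    also have "(\<Sum>a\<in>A \<inter> side C R j. (norm ((K ^^ k) (unit_vec a)))\<^sup>2) = s k"
      using swap[of j] by (simp add: s_def j del: funpow.simps)
    finally have "s k * s k \<le> s j * s k" by (simp add: power2_eq_square)
    moreover have "s k \<ge> 0" "s j \<ge> 0" by (simp_all add: s_def sum_nonneg)
    ultimately show "s k \<le> s (k - 1)" by (cases "s k = 0") (auto simp: j)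
  qed
  moreover have "s k = (\<Sum>a\<in>A \<inter> C. (norm ((K ^^ k) (unit_vec a)))\<^sup>2)"
  proof (cases "even k")
    case True
    then show ?thesis by (simp add: s_def side_def)
  next
    case False
    then obtain j where j: "k = Suc j" "even j" by (cases k) auto
    show ?thesis using swap[of j] j by (simp add: s_def side_def del: funpow.simps)
  qed
  ultimately show ?thesis by (simp add: s_def side_def K_def)
qed

section \<open>Monotone exhaustion of the trace by compressions\<close>

definition compress_trace :: "'a set \<Rightarrow> nat \<Rightarrow> ('a ell2 \<Rightarrow> 'a ell2) \<Rightarrow> 'a set \<Rightarrow> real" where
  "compress_trace C k H A = (\<Sum>a\<in>A \<inter> C. (norm ((compress A H ^^ k) (unit_vec a)))\<^sup>2)"

text \<open>Compression to \<open>A\<close> factors through compression to \<open>B\<close>, so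
  \<open>trace_compress_le\<close> applies to the latter; the columns of \<open>B\<close> outside
  \<open>A\<close> only add squares.\<close>

lemma compress_trace_mono:
  assumes H: "bipartite_op C R H" and AB: "A \<subseteq> B" "finite B"
  shows "compress_trace C k H A \<le> compress_trace C k H B"
proof -
  have "compress_trace C k H A \<le> (\<Sum>a\<in>A \<inter> C. (norm ((compress B H ^^ k) (unit_vec a)))\<^sup>2)"
    using trace_compress_le[OF bipartite_compress[OF H, of B] finite_subset[OF AB], of k]
    by (simp add: compress_trace_def compress_compress[OF AB(1)])
  also have "\<dots> \<le> compress_trace C k H B"
    unfolding compress_trace_def using AB by (intro sum_mono2) auto
  finally show ?thesis .
qed

lemma compress_trace_le:
  assumes "bipartite_op C R H" "finite A"
    and "((\<lambda>c. (norm ((H ^^ k) (unit_vec c)))\<^sup>2) has_sum t) C"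
  shows "compress_trace C k H A \<le> t"
  using trace_compress_le[OF assms(1,2), of k] finite_sum_le_has_sum[OF assms(3), of "A \<inter> C"] assms(2)
  by (simp add: compress_trace_def)

text \<open>Projection and vector vary together. As projections are contractions, the error is at
  most that of \<open>u\<close> plus that of projecting the limit \<open>v\<close>.\<close>

lemma restrict_to_tendsto':
  assumes "(u \<longlongrightarrow> v) (finite_subsets_at_top UNIV)"
  shows "((\<lambda>A. restrict_to A (u A)) \<longlongrightarrow> v) (finite_subsets_at_top UNIV)"
proof (rule LIM_zero_cancel, rule tendsto_norm_zero_cancel, rule tendsto_sandwich[OF _ _ tendsto_const])
  show "\<forall>\<^sub>F A in finite_subsets_at_top UNIV.
      norm (restrict_to A (u A) - v) \<le> norm (u A - v) + norm (restrict_to A v - v)"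
  proof (rule always_eventually, rule allI)
    fix A
    have "restrict_to A (u A) - v = restrict_to A (u A - v) + (restrict_to A v - v)"
      by (rule ell2_eqI) (simp add: coord_simps)
    then show "norm (restrict_to A (u A) - v) \<le> norm (u A - v) + norm (restrict_to A v - v)"
      by (simp only:) (rule order_trans[OF norm_triangle_ineq add_right_mono[OF norm_restrict_to_le]])
  qed
  have "((\<lambda>A. norm (u A - v) + norm (restrict_to A v - v)) \<longlongrightarrow> norm (v - v) + norm (v - v))
      (finite_subsets_at_top UNIV)"
    by (intro tendsto_intros assms restrict_to_tendsto)
  then show "((\<lambda>A. norm (u A - v) + norm (restrict_to A v - v)) \<longlongrightarrow> 0) (finite_subsets_at_top UNIV)"
    by simp
qed auto

lemma compress_funpow_tendsto:
  assumes "clinear_op H"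
  shows "((\<lambda>A. (compress A H ^^ k) f) \<longlongrightarrow> (H ^^ k) f) (finite_subsets_at_top UNIV)"
proof (induction k)
  case (Suc k)
  then show ?case
    by (simp add: compress_def[abs_def])
      (intro restrict_to_tendsto' bounded_linear.tendsto[OF clinear_opD(1)[OF assms]])
qed simp

text \<open>Two limits in succession: finitely many columns \<open>F\<close> give almost all of
  \<open>t\<close>, and then the compressed orbits of these finitely many columns converge
  simultaneously.\<close>

lemma compress_trace_exhausts:
  assumes H: "bipartite_op C R H"
    and sum: "((\<lambda>c. (norm ((H ^^ k) (unit_vec c)))\<^sup>2) has_sum t) C" and e: "e > 0"
  obtains A where "finite A" "t - e < compress_trace C k H A"
proof -
  have "\<forall>\<^sub>F F in finite_subsets_at_top C. t - e < (\<Sum>c\<in>F. (norm ((H ^^ k) (unit_vec c)))\<^sup>2)"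
    using sum e unfolding has_sum_def by (intro order_tendstoD) auto
  then obtain F where F: "finite F" "F \<subseteq> C" "t - e < (\<Sum>c\<in>F. (norm ((H ^^ k) (unit_vec c)))\<^sup>2)"
    unfolding eventually_finite_subsets_at_top by blast
  have "((\<lambda>A. \<Sum>c\<in>F. (norm ((compress A H ^^ k) (unit_vec c)))\<^sup>2) \<longlongrightarrow> (\<Sum>c\<in>F. (norm ((H ^^ k) (unit_vec c)))\<^sup>2))
      (finite_subsets_at_top UNIV)"
    by (intro tendsto_intros compress_funpow_tendsto bipartite_opD(2)[OF H])
  from order_tendstoD(1)[OF this F(3)]
  obtain B where B: "finite B" "\<And>A. finite A \<Longrightarrow> B \<subseteq> A \<Longrightarrow> t - e < (\<Sum>c\<in>F. (norm ((compress A H ^^ k) (unit_vec c)))\<^sup>2)"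
    unfolding eventually_finite_subsets_at_top by (metis subset_UNIV)
  have "t - e < (\<Sum>c\<in>F. (norm ((compress (B \<union> F) H ^^ k) (unit_vec c)))\<^sup>2)"
    using B F by (intro B(2)) auto
  also have "\<dots> \<le> compress_trace C k H (B \<union> F)"
    unfolding compress_trace_def using B F by (intro sum_mono2) auto
  finally show ?thesis by (intro that[of "B \<union> F"]) (simp add: B(1) F(1))
qed

section \<open>Expansion of compressed traces into walks\<close>

primrec walk_sum :: "('a \<Rightarrow> 'a \<Rightarrow> real) \<Rightarrow> 'a set \<Rightarrow> nat \<Rightarrow> 'a \<Rightarrow> 'a \<Rightarrow> real" where
  "walk_sum h A 0 a b = (if a = b then 1 else 0)"
| "walk_sum h A (Suc j) a b = (\<Sum>d\<in>A. h a d * walk_sum h A j d b)"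

lemma compress_entry:
  assumes H: "bipartite_op C R H" and A: "finite A" "a \<in> A"
  shows "inner (unit_vec a) ((compress A H ^^ j) (unit_vec b)) = walk_sum (op_entry H) A j a b"
  using A(2)
proof (induction j arbitrary: a)
  case 0
  then show ?case by (simp add: inner_unit_vec coord_simps)
next
  case (Suc j)
  have "inner (unit_vec a) ((compress A H ^^ Suc j) (unit_vec b)) =
      inner (compress A H (unit_vec a)) ((compress A H ^^ j) (unit_vec b))"
    using bipartite_opD(3)[OF bipartite_compress[OF H]] by simp
  also have "\<dots> = (\<Sum>d\<in>A. op_entry H d a * inner (unit_vec d) ((compress A H ^^ j) (unit_vec b)))"
    by (simp add: compress_unit_vec[OF H A(1) Suc.prems] inner_sum_left)
  also have "\<dots> = (\<Sum>d\<in>A. op_entry H a d * walk_sum (op_entry H) A j d b)"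
    by (intro sum.cong refl) (simp add: Suc.IH op_entry_sym[OF H, of a])
  finally show ?case by simp
qed

lemma compress_trace_eq:
  assumes H: "bipartite_op C R H" and A: "finite A"
  shows "compress_trace C k H A = (\<Sum>a\<in>A \<inter> C. walk_sum (op_entry H) A (2 * k) a a)"
  unfolding compress_trace_def power2_norm_eq_inner
proof (rule sum.cong)
  fix a assume "a \<in> A \<inter> C"
  then show "inner ((compress A H ^^ k) (unit_vec a)) ((compress A H ^^ k) (unit_vec a)) =
      walk_sum (op_entry H) A (2 * k) a a"
    unfolding mult_2 hermitian_funpow[OF bipartite_opD(1)[OF bipartite_compress[OF H]]]
    by (intro compress_entry[OF H A]) simp
qed simp

section \<open>Norms independent of signs exclude cycles\<close>

text \<open>Sign vectors are encoded by the set of places with sign -1, so that averages over signs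
  become sums over power sets.\<close>

definition sign_of :: "'q set \<Rightarrow> 'q \<Rightarrow> real" where
  "sign_of E q = (if q \<in> E then -1 else 1)"

definition walsh :: "'q set \<Rightarrow> 'q set \<Rightarrow> real" where
  "walsh F E = (\<Prod>q\<in>F. sign_of E q)"

text \<open>Finite combinations of Walsh functions with nonnegative coefficients, generated as a
  cone so that the coefficients never have to be named.\<close>

inductive_set walsh_positive :: "('q set \<Rightarrow> real) set" where
  walsh: "c \<ge> 0 \<Longrightarrow> finite F \<Longrightarrow> (\<lambda>E. c * walsh F E) \<in> walsh_positive"
| add: "f \<in> walsh_positive \<Longrightarrow> g \<in> walsh_positive \<Longrightarrow> (\<lambda>E. f E + g E) \<in> walsh_positive"

lemma sign_of_square [simp]: "sign_of E q * sign_of E q = 1"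
  by (simp add: sign_of_def)

text \<open>Signs at common places occur twice and cancel.\<close>

lemma walsh_mult:
  assumes "finite F" "finite G"
  shows "walsh F E * walsh G E = walsh (F - G \<union> (G - F)) E"
proof -
  have "walsh F E = walsh (F - G) E * walsh (F \<inter> G) E"
    unfolding walsh_def using assms by (subst prod.union_disjoint[symmetric]) (auto intro!: prod.cong)
  moreover have "walsh G E = walsh (G - F) E * walsh (F \<inter> G) E"
    unfolding walsh_def using assms by (subst prod.union_disjoint[symmetric]) (auto intro!: prod.cong)
  moreover have "walsh (F \<inter> G) E * walsh (F \<inter> G) E = 1"
    unfolding walsh_def by (simp add: prod.distrib[symmetric])
  moreover have "walsh (F - G \<union> (G - F)) E = walsh (F - G) E * walsh (G - F) E"
    unfolding walsh_def using assms by (intro prod.union_disjoint) auto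
  ultimately show ?thesis by (simp add: mult_ac)
qed

lemma walsh_positive_const: "c \<ge> 0 \<Longrightarrow> (\<lambda>E. c) \<in> walsh_positive"
  using walsh_positive.walsh[of c "{}"] by (simp add: walsh_def)

lemma walsh_positive_mult:
  assumes "f \<in> walsh_positive" "g \<in> walsh_positive"
  shows "(\<lambda>E. f E * g E) \<in> walsh_positive"
  using assms
proof (induction rule: walsh_positive.induct)
  case (walsh c F)
  from walsh(3) show ?case
  proof induction
    case (walsh d G)
    have "(\<lambda>E. c * walsh F E * (d * walsh G E)) = (\<lambda>E. c * d * walsh (F - G \<union> (G - F)) E)"
      unfolding walsh_mult[OF \<open>finite F\<close> \<open>finite G\<close>, symmetric] by (simp only: mult_ac)
    moreover have "(\<lambda>E. c * d * walsh (F - G \<union> (G - F)) E) \<in> walsh_positive"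
      using walsh \<open>finite F\<close> \<open>c \<ge> 0\<close> by (intro walsh_positive.walsh) auto
    ultimately show ?case by (simp only:)
  qed (simp add: distrib_left walsh_positive.add)
qed (simp add: distrib_right walsh_positive.add)

lemma walsh_positive_sum:
  "(\<And>i. i \<in> A \<Longrightarrow> f i \<in> walsh_positive) \<Longrightarrow> (\<lambda>E. \<Sum>i\<in>A. f i E) \<in> walsh_positive"
proof (induction A rule: infinite_finite_induct)
  case (insert i A)
  have "(\<lambda>E. f i E + (\<Sum>i\<in>A. f i E)) \<in> walsh_positive"
    by (intro walsh_positive.add insert) (simp_all add: insert.prems)
  then show ?case using insert.hyps by (simp only: sum.insert not_False_eq_True)
qed (simp_all add: walsh_positive_const)

text \<open>Orthogonality: a place \<open>s\<close> in \<open>F\<close> pairs \<open>E\<close> with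
  \<open>insert s E\<close>, where the value is opposite. For infinite \<open>F\<close> the product
  is 1 by default.\<close>

lemma sum_walsh:
  assumes "finite S"
  shows "(\<Sum>E\<in>Pow S. walsh F E) = (if F \<inter> S = {} \<or> infinite F then 2 ^ card S else 0)"
proof (cases "finite F")
  case True
  show ?thesis using assms
  proof (induction S)
    case empty
    have "walsh F {} = 1" by (simp add: walsh_def sign_of_def)
    then show ?case by simp
  next
    case (insert s S)
    have ins: "walsh F (insert s E) = (if s \<in> F then - walsh F E else walsh F E)" if "E \<subseteq> S" for E
    proof (cases "s \<in> F")
      case True
      have "(\<Prod>q\<in>F - {s}. sign_of (insert s E) q) = (\<Prod>q\<in>F - {s}. sign_of E q)"
        by (intro prod.cong) (auto simp: sign_of_def)
      moreover have "sign_of (insert s E) s = -1" "sign_of E s = 1"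
        using that insert.hyps by (auto simp: sign_of_def)
      ultimately show ?thesis
        using True \<open>finite F\<close> by (simp add: walsh_def prod.remove[of F s])
    next
      case False
      then show ?thesis by (auto simp: walsh_def sign_of_def intro!: prod.cong)
    qed
    have "(\<Sum>E\<in>Pow (insert s S). walsh F E) = (\<Sum>E\<in>Pow S. walsh F E) + (\<Sum>E\<in>insert s ` Pow S. walsh F E)"
      unfolding Pow_insert using insert.hyps by (intro sum.union_disjoint) auto
    also have "(\<Sum>E\<in>insert s ` Pow S. walsh F E) = (\<Sum>E\<in>Pow S. walsh F (insert s E))"
      using insert.hyps by (subst sum.reindex) (auto simp: inj_on_def)
    also have "\<dots> = (\<Sum>E\<in>Pow S. if s \<in> F then - walsh F E else walsh F E)"
      by (intro sum.cong) (auto simp: ins)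
    finally show ?case using insert True by (cases "s \<in> F") (auto simp: sum_negf)
  qed
qed (use assms in \<open>simp add: walsh_def card_Pow\<close>)

text \<open>Multiplying by \<open>walsh F\<close> permutes the Walsh functions of finite sets, and
  each of them has a nonnegative sum over \<open>Pow S\<close>.\<close>

lemma walsh_positive_coefficient:
  assumes "f \<in> walsh_positive" "finite S" "finite F"
  shows "(\<Sum>E\<in>Pow S. walsh F E * f E) \<ge> 0"
  using assms(1)
proof induction
  case (walsh c G)
  have "(\<Sum>E\<in>Pow S. walsh F E * (c * walsh G E)) = c * (\<Sum>E\<in>Pow S. walsh (F - G \<union> (G - F)) E)"
    using assms(3) walsh by (simp add: walsh_mult[symmetric] sum_distrib_left mult_ac)
  then show ?case using assms(2) walsh by (simp add: sum_walsh)
qed (simp add: distrib_left sum.distrib)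

lemma walk_sum_positive:
  assumes "\<And>u v. (\<lambda>E. h E u v) \<in> walsh_positive"
  shows "(\<lambda>E. walk_sum (h E) A j a b) \<in> walsh_positive"
proof (induction j arbitrary: a)
  case 0
  show ?case using walsh_positive_const[of 1] walsh_positive_const[of 0] by (cases "a = b") simp_all
next
  case (Suc j)
  show ?case unfolding walk_sum.simps by (intro walsh_positive_sum walsh_positive_mult assms Suc.IH)
qed

text \<open>Isolates one chosen walk. The other walks form a Walsh-positive remainder, so they
  cannot cancel its contribution.\<close>

lemma walk_sum_single_walk:
  assumes pos: "\<And>u v. (\<lambda>E. h E u v) \<in> walsh_positive" and A: "finite A"
  shows "(\<And>i. i \<le> n \<Longrightarrow> v i \<in> A) \<Longrightarrow>
    \<exists>r\<in>walsh_positive. \<forall>E. walk_sum (h E) A n (v 0) (v n) = (\<Prod>i<n. h E (v i) (v (Suc i))) + r E"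
proof (induction n arbitrary: v)
  case 0
  show ?case by (intro bexI[of _ "\<lambda>_. 0"]) (simp_all add: walsh_positive_const)
next
  case (Suc n)
  obtain r where r: "r \<in> walsh_positive"
    "\<And>E. walk_sum (h E) A n (v 1) (v (Suc n)) = (\<Prod>i<n. h E (v (Suc i)) (v (Suc (Suc i)))) + r E"
    using Suc.IH[of "\<lambda>i. v (Suc i)"] Suc.prems by auto
  have "walk_sum (h E) A (Suc n) (v 0) (v (Suc n)) = (\<Prod>i<Suc n. h E (v i) (v (Suc i))) +
     (h E (v 0) (v 1) * r E + (\<Sum>d\<in>A - {v 1}. h E (v 0) d * walk_sum (h E) A n d (v (Suc n))))" for E
    using A Suc.prems[of 1] by (simp add: sum.remove[of A "v 1"] r(2)[unfolded One_nat_def] distrib_left prod.lessThan_Suc_shift del: prod.lessThan_Suc)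
  moreover have "(\<lambda>E. h E (v 0) (v 1) * r E + (\<Sum>d\<in>A - {v 1}. h E (v 0) d * walk_sum (h E) A n d (v (Suc n)))) \<in> walsh_positive"
    by (intro walsh_positive.add walsh_positive_mult walsh_positive_sum walk_sum_positive pos r)
  ultimately show ?case by (intro bexI) auto
qed

text \<open>For disjoint \<open>R\<close> and \<open>C\<close> at most one summand is nonzero. The
  additive form keeps the entries in \<open>walsh_positive\<close> when nonnegative weights carry
  signs.\<close>

definition bip_matrix :: "'v set \<Rightarrow> 'v set \<Rightarrow> ('v \<times> 'v \<Rightarrow> real) \<Rightarrow> 'v \<Rightarrow> 'v \<Rightarrow> real" where
  "bip_matrix C R w u v = (if (u, v) \<in> R \<times> C then w (u, v) else 0) + (if (v, u) \<in> R \<times> C then w (v, u) else 0)"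

lemma dilation_bipartite:
  assumes y: "y \<in> schatten_class p C R" and RC: "R \<inter> C = {}"
    and coeff: "\<And>q. q \<in> R \<times> C \<Longrightarrow> matrix_coeff y q = of_real (w q)"
  shows "bipartite_op C R (dilation y)" "op_entry (dilation y) = bip_matrix C R w"
proof -
  note D = schatten_classD[OF y RC]
  have yc: "coord (y (unit_vec c)) r = (if (r, c) \<in> R \<times> C then of_real (w (r, c)) else 0)" for r c
    using D(3)[of c] D(5)[of r] coeff[of "(r, c)"] by (auto simp: matrix_coeff_eq zero_ell2.rep_eq)
  have "coord (adjoint y (unit_vec r)) c = cnj (coord (y (unit_vec c)) r)" for r c
    using cinner_adjoint[OF D(1), of "unit_vec c" "unit_vec r"] by simp
  then have coord: "coord (dilation y (unit_vec v)) u = of_real (bip_matrix C R w u v)" for u v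
    by (simp add: dilation_def plus_ell2.rep_eq yc bip_matrix_def)
  then show "op_entry (dilation y) = bip_matrix C R w"
    by (simp add: op_entry_def fun_eq_iff)
  show "bipartite_op C R (dilation y)"
    unfolding bipartite_op_def
    using hermitian_dilation[OF D(1)] RC by (auto simp: coord bip_matrix_def split: if_splits)
qed

lemma bip_matrix_positive:
  assumes "R \<inter> C = {}" "\<And>q. \<xi> q \<ge> 0"
  shows "(\<lambda>E. bip_matrix C R (\<lambda>q. sign_of E q * \<xi> q) u v) \<in> walsh_positive"
proof -
  have "(\<lambda>E. sign_of E q * \<xi> q) \<in> walsh_positive" for q
    using walsh_positive.walsh[OF assms(2)[of q], of "{q}"] by (simp add: walsh_def mult.commute)
  then have "(\<lambda>E. if b then sign_of E q * \<xi> q else 0) \<in> walsh_positive" for q b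
    by (cases b) (simp_all add: walsh_positive_const)
  then show ?thesis unfolding bip_matrix_def by (intro walsh_positive.add)
qed

section \<open>Continuity in the signs, compactness and uniform convergence\<close>

lemma continuous_on_walk_sum:
  assumes "\<And>u v. continuous_on UNIV (\<lambda>\<epsilon>. h \<epsilon> u v)"
  shows "continuous_on UNIV (\<lambda>\<epsilon>. walk_sum (h \<epsilon>) A j a b)"
  by (induction j arbitrary: a) (auto intro!: continuous_intros assms)

lemma continuous_on_bip_matrix:
  "continuous_on UNIV (\<lambda>\<epsilon>. bip_matrix C R (\<lambda>q. \<epsilon> q * \<xi> q) u v)"
proof -
  have "continuous_on UNIV (\<lambda>\<epsilon>::'a \<times> 'a \<Rightarrow> real. if b then \<epsilon> q * \<xi> q else 0)" for b q
    by (cases b) (auto intro!: continuous_intros continuous_on_product_coordinates)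
  then show ?thesis unfolding bip_matrix_def by (intro continuous_on_add)
qed

text \<open>Tychonoff's theorem; there may be infinitely many places.\<close>

lemma compact_signs: "compact {\<epsilon> :: 'q \<Rightarrow> real. \<forall>q. \<epsilon> q \<in> {-1, 1}}"
proof -
  have "compactin (product_topology (\<lambda>_::'q. euclidean) UNIV) (PiE UNIV (\<lambda>_. {-1, 1::real}))"
    by (auto simp: compactin_PiE)
  moreover have "PiE UNIV (\<lambda>_. {-1, 1::real}) = {\<epsilon> :: 'q \<Rightarrow> real. \<forall>q. \<epsilon> q \<in> {-1, 1}}"
    by (auto simp: PiE_def Pi_def)
  ultimately show ?thesis by (simp add: euclidean_product_topology)
qed

text \<open>The open sets where \<open>t < G \<epsilon> A\<close> cover \<open>K\<close>. By
  monotonicity, the union of the sets \<open>A\<close> belonging to a finite subcover serves all of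
  \<open>K\<close>.\<close>

lemma dini_finite_sets:
  fixes G :: "'a::topological_space \<Rightarrow> 'v set \<Rightarrow> real"
  assumes K: "compact K" and cont: "\<And>A. finite A \<Longrightarrow> continuous_on UNIV (\<lambda>\<epsilon>. G \<epsilon> A)"
    and mono: "\<And>\<epsilon> A B. \<epsilon> \<in> K \<Longrightarrow> A \<subseteq> B \<Longrightarrow> finite B \<Longrightarrow> G \<epsilon> A \<le> G \<epsilon> B"
    and ex: "\<And>\<epsilon>. \<epsilon> \<in> K \<Longrightarrow> \<exists>A. finite A \<and> t < G \<epsilon> A"
  obtains A where "finite A" "\<And>\<epsilon>. \<epsilon> \<in> K \<Longrightarrow> t < G \<epsilon> A"
proof -
  have "open {\<epsilon>. t < G \<epsilon> A}" if "finite A" for A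
    using cont[OF that] by (intro open_Collect_less) auto
  moreover have "K \<subseteq> (\<Union>A\<in>Collect finite. {\<epsilon>. t < G \<epsilon> A})" using ex by auto
  ultimately obtain \<A> where \<A>: "\<A> \<subseteq> Collect finite" "finite \<A>" "K \<subseteq> (\<Union>A\<in>\<A>. {\<epsilon>. t < G \<epsilon> A})"
    using compactE_image[OF K, of "Collect finite" "\<lambda>A. {\<epsilon>. t < G \<epsilon> A}"] by auto
  have fin: "finite (\<Union>\<A>)" using \<A> by auto
  have "t < G \<epsilon> (\<Union>\<A>)" if "\<epsilon> \<in> K" for \<epsilon>
  proof -
    obtain A where "A \<in> \<A>" "t < G \<epsilon> A" using subsetD[OF \<A>(3) \<open>\<epsilon> \<in> K\<close>] by blast
    then show ?thesis using mono[OF that _ fin, of A] by (auto intro: less_le_trans)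
  qed
  with fin that show ?thesis by blast
qed

section \<open>Walks around a cycle\<close>

lemma prod_double: "(\<Prod>i<2 * k. f i) = (\<Prod>i<k. f (2 * i) * f (2 * i + 1 :: nat) :: 'a :: comm_monoid_mult)"
  by (induction k) (auto simp: mult_ac)

text \<open>A row vertex determines its position, so a forward and a backward edge could only
  coincide at the same position, which would make two cyclically consecutive column vertices equal.
  Length at least 4 excludes this.\<close>

lemma cycle_edges:
  assumes cyc: "is_cycle I P" and IRC: "I \<subseteq> R \<times> C"
  shows "inj_on (fwd_edge P) {..<length P}" "inj_on (bwd_edge P) {..<length P}"
    "fwd_edge P ` {..<length P} \<inter> bwd_edge P ` {..<length P} = {}"
proof -
  let ?s = "length P"
  have s: "?s \<ge> 2" using cyc by (simp add: is_cycle_def walk_length_def)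
  have dist: "distinct (map fst P)" "distinct (map snd P)" using cyc by (auto simp: is_cycle_def)
  have snd: "i = j" if "snd (P ! i) = snd (P ! j)" "i < ?s" "j < ?s" for i j
    using dist(2) that by (metis length_map nth_eq_iff_index_eq nth_map)
  have fst: "i = j" if "fst (P ! i) = fst (P ! j)" "i < ?s" "j < ?s" for i j
    using dist(1) that by (metis length_map nth_eq_iff_index_eq nth_map)
  show "inj_on (fwd_edge P) {..<?s}" "inj_on (bwd_edge P) {..<?s}"
    by (auto simp: inj_on_def fwd_edge_def bwd_edge_def intro: snd)
  have "bwd_edge P j \<noteq> fwd_edge P i" if "i < ?s" "j < ?s" for i j
  proof
    assume "bwd_edge P j = fwd_edge P i"
    then have eq: "fwd_edge P i = bwd_edge P j" by simp
    from this have "i = j" using snd that by (simp add: fwd_edge_def bwd_edge_def)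
    moreover have "Suc i mod ?s < ?s" using s by (intro mod_less_divisor) linarith
    ultimately have "i = Suc i mod ?s" using eq that fst[of i "Suc i mod ?s"] by (simp add: fwd_edge_def bwd_edge_def)
    then show False using that s by (cases "Suc i = ?s") auto
  qed
  then show "fwd_edge P ` {..<?s} \<inter> bwd_edge P ` {..<?s} = {}" by auto
qed

text \<open>
  The walk runs through the cycle once and then back and forth along its first edge. Among the closed
  walks of length \<open>2k\<close> it contributes a positive multiple of the Walsh function of the cycle.
\<close>

lemma cycle_walk_product:
  assumes cyc: "is_cycle I P" and len: "walk_length P \<le> 2 * k" and IRC: "I \<subseteq> R \<times> C" and RC: "R \<inter> C = {}"
    and \<xi>: "\<And>i. i < length P \<Longrightarrow> \<xi> (fwd_edge P i) > 0" "\<And>i. i < length P \<Longrightarrow> \<xi> (bwd_edge P i) > 0"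
  obtains v m F where "finite F" "F \<noteq> {}" "v 0 \<in> C" "v (2 * k) = v 0" "m > 0"
    "\<And>E. (\<Prod>i<2 * k. bip_matrix C R (\<lambda>q. sign_of E q * \<xi> q) (v i) (v (Suc i))) = m * walsh F E"
proof -
  let ?s = "length P"
  define F where "F = fwd_edge P ` {..<?s} \<union> bwd_edge P ` {..<?s}"
  define v where "v j = (let e = P ! (if j < 2 * ?s then j div 2 else 0) in if even j then fst e else snd e)" for j
  \<comment> \<open>The weights around the cycle, times two passages of the first edge for each of
    the \<open>k - ?s\<close> remaining double steps; the signs of these two passages
    cancel.\<close>
  define m where "m = (\<Prod>i<?s. \<xi> (fwd_edge P i) * \<xi> (bwd_edge P i)) * (\<xi> (fwd_edge P 0))\<^sup>2 ^ (k - ?s)"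
  have P: "P \<noteq> []" "\<And>i. i < ?s \<Longrightarrow> fwd_edge P i \<in> I" "\<And>i. i < ?s \<Longrightarrow> bwd_edge P i \<in> I"
    using cyc by (auto simp: is_cycle_def closed_walk_def)
  have sk: "?s \<le> k" using len by (simp add: walk_length_def)
  have v_even: "v (2 * i) = fst (P ! (if i < ?s then i else 0))" for i by (simp add: v_def)
  have v_odd: "v (Suc (2 * i)) = snd (P ! (if i < ?s then i else 0))" for i
  proof -
    have "Suc (2 * i) < 2 * ?s \<longleftrightarrow> i < ?s" by linarith
    then show ?thesis by (simp add: v_def)
  qed
  have bip: "bip_matrix C R w c r = w (r, c)" "bip_matrix C R w r c = w (r, c)" if "(r, c) \<in> I" for w r c
  proof -
    have "r \<in> R" "c \<in> C" "r \<notin> C" "c \<notin> R" using that IRC RC by auto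
    then show "bip_matrix C R w c r = w (r, c)" "bip_matrix C R w r c = w (r, c)"
      by (simp_all add: bip_matrix_def)
  qed
  have step: "bip_matrix C R w (v (2 * i)) (v (Suc (2 * i))) * bip_matrix C R w (v (Suc (2 * i))) (v (Suc (Suc (2 * i)))) =
      (if i < ?s then w (fwd_edge P i) * w (bwd_edge P i) else (w (fwd_edge P 0))\<^sup>2)" for w i
  proof (cases "i < ?s")
    case True
    have "v (Suc (Suc (2 * i))) = fst (P ! (Suc i mod ?s))"
    proof -
      have "v (2 * Suc i) = fst (P ! (Suc i mod ?s))"
        unfolding v_even using True by (cases "Suc i = ?s") auto
      then show ?thesis by simp
    qed
    then show ?thesis
      using True P(2)[OF True] P(3)[OF True] v_even[of i] v_odd[of i]
      by (simp add: fwd_edge_def bwd_edge_def bip)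
  next
    case False
    then show ?thesis
      using P(2)[of 0] P(1) v_even[of i] v_odd[of i] v_even[of "Suc i"]
      by (simp add: fwd_edge_def bip power2_eq_square)
  qed
  have split: "(\<Prod>i<k. if i < ?s then f i else c) = (\<Prod>i<?s. f i) * c ^ (k - ?s)" for f :: "nat \<Rightarrow> real" and c
  proof -
    have "(\<Prod>i<k. if i < ?s then f i else c) = (\<Prod>i<?s. if i < ?s then f i else c) * (\<Prod>i=?s..<k. if i < ?s then f i else c)"
      using sk unfolding lessThan_atLeast0 by (intro prod.atLeastLessThan_concat[symmetric]) auto
    then show ?thesis by simp
  qed
  have walsh: "walsh F E = (\<Prod>i<?s. sign_of E (fwd_edge P i) * sign_of E (bwd_edge P i))" for E
    unfolding walsh_def F_def using cycle_edges[OF cyc IRC]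
    by (simp add: prod.union_disjoint prod.reindex prod.distrib)
  show ?thesis
  proof (rule that)
    show "finite F" "F \<noteq> {}" using P(1) by (auto simp: F_def)
    show "v 0 \<in> C" using P(1) P(2)[of 0] IRC by (auto simp: v_def fwd_edge_def)
    show "v (2 * k) = v 0" using sk P(1) by (simp add: v_def)
    show "m > 0" unfolding m_def using P(1) by (intro mult_pos_pos prod_pos zero_less_power) (auto intro: \<xi>)
    fix E
    have "(\<Prod>i<2 * k. bip_matrix C R (\<lambda>q. sign_of E q * \<xi> q) (v i) (v (Suc i))) =
      (\<Prod>i<k. if i < ?s then (sign_of E (fwd_edge P i) * \<xi> (fwd_edge P i)) * (sign_of E (bwd_edge P i) * \<xi> (bwd_edge P i))
        else (\<xi> (fwd_edge P 0))\<^sup>2)"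
      unfolding prod_double
    proof (rule prod.cong)
      fix i
      have "(sign_of E q * x)\<^sup>2 = x\<^sup>2" for q x by (simp add: sign_of_def)
      then show "bip_matrix C R (\<lambda>q. sign_of E q * \<xi> q) (v (2 * i)) (v (Suc (2 * i))) *
          bip_matrix C R (\<lambda>q. sign_of E q * \<xi> q) (v (2 * i + 1)) (v (Suc (2 * i + 1))) =
        (if i < ?s then (sign_of E (fwd_edge P i) * \<xi> (fwd_edge P i)) * (sign_of E (bwd_edge P i) * \<xi> (bwd_edge P i))
        else (\<xi> (fwd_edge P 0))\<^sup>2)"
        using step[of "\<lambda>q. sign_of E q * \<xi> q" i] by simp
    qed simp
    also have "\<dots> = m * walsh F E"
      unfolding split walsh m_def by (simp add: prod.distrib mult_ac)
    finally show "(\<Prod>i<2 * k. bip_matrix C R (\<lambda>q. sign_of E q * \<xi> q) (v i) (v (Suc i))) = m * walsh F E" .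
  qed
qed

lemma no_cycle_if_norm_independent:
  assumes RC: "R \<inter> C = {}" and k: "k > 0" and \<xi>0: "\<And>q. \<xi> q \<ge> 0"
    and indep: "\<And>\<epsilon> :: 'v \<times> 'v \<Rightarrow> real. (\<And>q. \<epsilon> q \<in> {-1, 1}) \<Longrightarrow> \<exists>y\<in>schatten_class (2 * k) C R.
      (\<forall>q\<in>R \<times> C. matrix_coeff y q = of_real (\<epsilon> q * \<xi> q)) \<and> schatten_norm (2 * k) y = N"
    and cyc: "is_cycle I P" "walk_length P \<le> 2 * k" and IRC: "I \<subseteq> R \<times> C"
    and \<xi>: "\<And>i. i < length P \<Longrightarrow> \<xi> (fwd_edge P i) > 0" "\<And>i. i < length P \<Longrightarrow> \<xi> (bwd_edge P i) > 0"
  shows False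
proof -
  define h where "h \<epsilon> = bip_matrix C R (\<lambda>q. \<epsilon> q * \<xi> q)" for \<epsilon>
  define G where "G \<epsilon> A = (\<Sum>a\<in>A \<inter> C. walk_sum (h \<epsilon>) A (2 * k) a a)" for \<epsilon> A
  define K where "K = {\<epsilon> :: 'v \<times> 'v \<Rightarrow> real. \<forall>q. \<epsilon> q \<in> {-1, 1}}"
  \<comment> \<open>Undoes the root in \<open>schatten_norm\<close>: \<open>t\<close> is the trace
    itself, the same for all signs.\<close>
  define t where "t = N powr (2 * k)"
  obtain v m F where F: "finite F" "F \<noteq> {}" and v: "v 0 \<in> C" "v (2 * k) = v 0" and m: "m > 0"
    and prod: "\<And>E. (\<Prod>i<2 * k. bip_matrix C R (\<lambda>q. sign_of E q * \<xi> q) (v i) (v (Suc i))) = m * walsh F E"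
    by (rule cycle_walk_product[OF cyc IRC RC \<xi>]) blast+
  have op: "\<exists>H. bipartite_op C R H \<and> (\<forall>A. finite A \<longrightarrow> compress_trace C k H A = G \<epsilon> A) \<and>
      ((\<lambda>c. (norm ((H ^^ k) (unit_vec c)))\<^sup>2) has_sum t) C" if "\<epsilon> \<in> K" for \<epsilon>
  proof -
    obtain y where y: "y \<in> schatten_class (2 * k) C R" "schatten_norm (2 * k) y = N"
      "\<And>q. q \<in> R \<times> C \<Longrightarrow> matrix_coeff y q = of_real (\<epsilon> q * \<xi> q)"
      using indep[of \<epsilon>] \<open>\<epsilon> \<in> K\<close> unfolding K_def by blast
    note bip = dilation_bipartite[OF y(1) RC y(3)]
    note tr = schatten_trace[OF y(1) RC k]
    have "Re (op_trace (abs_power (2 * k) y)) \<ge> 0"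
      by (rule has_sum_nonneg[OF tr]) simp
    then have "Re (op_trace (abs_power (2 * k) y)) = t"
      using y(2) k by (simp add: schatten_norm_def t_def powr_powr flip: y(2))
    then show ?thesis
      using bip tr by (intro exI[of _ "dilation y"]) (simp add: compress_trace_eq[OF bip(1)] G_def h_def)
  qed
  have G_le: "G \<epsilon> A \<le> t" if "\<epsilon> \<in> K" "finite A" for \<epsilon> A
    using op[OF that(1)] compress_trace_le that(2) by metis
  have G_mono: "G \<epsilon> A \<le> G \<epsilon> B" if "\<epsilon> \<in> K" "A \<subseteq> B" "finite B" for \<epsilon> A B
    using op[OF that(1)] compress_trace_mono[OF _ that(2,3)] that(2,3) finite_subset by metis
  \<comment> \<open>The coefficient of \<open>walsh F\<close> in a large compressed trace will be at
    least \<open>m\<close>, which is incompatible with values within \<open>m / 2\<close> of a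
    constant.\<close>
  have "\<exists>A. finite A \<and> t - m / 2 < G \<epsilon> A" if "\<epsilon> \<in> K" for \<epsilon>
  proof -
    obtain H where H: "bipartite_op C R H" "\<And>A. finite A \<Longrightarrow> compress_trace C k H A = G \<epsilon> A"
      "((\<lambda>c. (norm ((H ^^ k) (unit_vec c)))\<^sup>2) has_sum t) C"
      using op[OF \<open>\<epsilon> \<in> K\<close>] by blast
    obtain A where "finite A" "t - m / 2 < compress_trace C k H A"
      using compress_trace_exhausts[OF H(1,3), of "m / 2"] m by auto
    then show ?thesis using H(2) by metis
  qed
  moreover have "continuous_on UNIV (\<lambda>\<epsilon>. G \<epsilon> A)" for A
    unfolding G_def h_def by (intro continuous_on_sum continuous_on_walk_sum continuous_on_bip_matrix)
  moreover have "compact K" unfolding K_def by (rule compact_signs)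
  ultimately obtain A where A: "finite A" "\<And>\<epsilon>. \<epsilon> \<in> K \<Longrightarrow> t - m / 2 < G \<epsilon> A"
    using dini_finite_sets[of K G "t - m / 2"] G_mono by metis
  \<comment> \<open>Adding the vertices of the walk makes the walk count; by monotonicity the lower
    bound persists.\<close>
  define B where "B = A \<union> v ` {..2 * k}"
  have B: "finite B" "A \<subseteq> B" "\<And>i. i \<le> 2 * k \<Longrightarrow> v i \<in> B" using A by (auto simp: B_def)
  have sign: "sign_of E \<in> K" for E by (simp add: K_def sign_of_def)
  have pos: "(\<lambda>E. h (sign_of E) u w) \<in> walsh_positive" for u w
    unfolding h_def by (rule bip_matrix_positive[OF RC \<xi>0])
  obtain r where r: "r \<in> walsh_positive"
    "\<And>E. walk_sum (h (sign_of E)) B (2 * k) (v 0) (v 0) = m * walsh F E + r E"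
    using walk_sum_single_walk[of "\<lambda>E. h (sign_of E)" B "2 * k" v, OF pos B(1) B(3)]
    unfolding v(2) by (auto simp: h_def prod)
  \<comment> \<open>Closed walks from the other base points join the remainder, which stays
    Walsh-positive.\<close>
  define r' where "r' E = r E + (\<Sum>a\<in>B \<inter> C - {v 0}. walk_sum (h (sign_of E)) B (2 * k) a a)" for E
  have "r' \<in> walsh_positive"
    unfolding r'_def[abs_def] by (intro walsh_positive.add r(1) walsh_positive_sum walk_sum_positive pos)
  then have "0 \<le> (\<Sum>E\<in>Pow F. walsh F E * r' E)" using walsh_positive_coefficient F(1) by blast
  moreover have G_eq: "G (sign_of E) B = m * walsh F E + r' E" for E
    using B(1) B(3)[of 0] v(1) by (simp add: G_def r'_def sum.remove[of "B \<inter> C" "v 0"] r(2))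
  moreover have sq: "walsh F E * walsh F E = 1" for E
    unfolding walsh_def by (simp add: prod.distrib[symmetric])
  ultimately have "m * 2 ^ card F \<le> (\<Sum>E\<in>Pow F. walsh F E * G (sign_of E) B)"
  proof -
    have "walsh F E * G (sign_of E) B = m + walsh F E * r' E" for E
      using sq[of E] by (simp add: G_eq distrib_left mult.left_commute)
    then show ?thesis using F(1) \<open>0 \<le> (\<Sum>E\<in>Pow F. walsh F E * r' E)\<close>
      by (simp add: sum.distrib card_Pow mult.commute)
  qed
  \<comment> \<open>As \<open>F\<close> is nonempty, \<open>walsh F\<close> has mean 0 and the
    constant \<open>t\<close> can be subtracted.\<close>
  also have "\<dots> = (\<Sum>E\<in>Pow F. walsh F E * (G (sign_of E) B - t))"
    using sum_walsh[OF F(1), of F] F by (simp add: right_diff_distrib sum_subtractf flip: sum_distrib_right)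
  also have "\<dots> \<le> (\<Sum>E\<in>Pow F. m / 2)"
  proof (rule sum_mono)
    fix E
    have "\<bar>walsh F E\<bar> = 1" using sq[of E] by (metis abs_mult_self_eq abs_1 abs_square_eq_1 power2_eq_square)
    moreover have "\<bar>G (sign_of E) B - t\<bar> \<le> m / 2"
      using A(2)[OF sign, of E] G_mono[OF sign B(2,1), of E] G_le[OF sign B(1), of E] by linarith
    ultimately have "\<bar>walsh F E * (G (sign_of E) B - t)\<bar> \<le> m / 2" by (simp add: abs_mult)
    then show "walsh F E * (G (sign_of E) B - t) \<le> m / 2" by linarith
  qed
  also have "\<dots> = m / 2 * 2 ^ card F" using F(1) by (simp add: card_Pow)
  finally show False using m by simp
qed

section \<open>Paths, cycles and local potentials\<close>

definition adj :: "('v \<times> 'v) set \<Rightarrow> 'v \<Rightarrow> 'v \<Rightarrow> bool" where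
  "adj I u v \<longleftrightarrow> (u, v) \<in> I \<or> (v, u) \<in> I"

lemma adj_sym: "adj I u v \<Longrightarrow> adj I v u"
  by (auto simp: adj_def)

lemma edges_iff_adj: "{u, v} \<in> edges I \<longleftrightarrow> adj I u v"
  by (auto simp: edges_def adj_def doubleton_eq_iff)

definition simple_path :: "('v \<times> 'v) set \<Rightarrow> 'v list \<Rightarrow> bool" where
  "simple_path I vs \<longleftrightarrow> vs \<noteq> [] \<and> distinct vs \<and> successively (adj I) vs"

lemma is_path_iff:
  "is_path V I v w l vs \<longleftrightarrow> simple_path I vs \<and> length vs = l + 1 \<and> set vs \<subseteq> V \<and> hd vs = v \<and> last vs = w"
proof (cases "length vs = l + 1")
  case True
  then have "vs \<noteq> []" by auto
  then show ?thesis using True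
    by (auto simp: is_path_def simple_path_def successively_conv_nth edges_iff_adj hd_conv_nth last_conv_nth)
qed (simp add: is_path_def)

text \<open>The encoding by pairs calls for a list that starts in \<open>C\<close>; one that starts
  in \<open>R\<close> is rotated once. Alternation of the sides around the closed list forces an
  even length, so at least 3 becomes at least 4.\<close>

lemma cycle_of_vertex_list:
  assumes IRC: "I \<subseteq> R \<times> C" and RC: "R \<inter> C = {}"
    and L: "distinct L" "length L \<ge> 3" "\<And>i. i < length L \<Longrightarrow> adj I (L ! i) (L ! (Suc i mod length L))"
  shows "\<exists>P. is_cycle I P \<and> walk_length P = length L"
proof -
  have start: "\<exists>P. is_cycle I P \<and> walk_length P = length L"
    if L0: "L ! 0 \<in> C" and L: "distinct L" "length L \<ge> 3"
      "\<And>i. i < length L \<Longrightarrow> adj I (L ! i) (L ! (Suc i mod length L))" for L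
  proof -
    let ?n = "length L"
    have flip: "v \<in> C \<longleftrightarrow> u \<in> R" "u \<in> R \<or> u \<in> C" if "adj I u v" for u v
      using that IRC RC by (auto simp: adj_def)
    have side: "(even i \<longrightarrow> L ! i \<in> C) \<and> (odd i \<longrightarrow> L ! i \<in> R)" if "i < ?n" for i
      using that
    proof (induction i)
      case (Suc i)
      have "adj I (L ! i) (L ! Suc i)" using L(3)[of i] Suc.prems by simp
      then show ?case using Suc flip[of "L ! i" "L ! Suc i"] flip[of "L ! Suc i" "L ! i"] RC
        by (auto dest: adj_sym)
    qed (simp add: L0)
    have "Suc (?n - 1) = ?n" using L(2) by linarith
    then have "adj I (L ! (?n - 1)) (L ! 0)" using L(3)[of "?n - 1"] by (metis lessI mod_self)
    then have "L ! (?n - 1) \<in> R" using L0 flip by blast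
    then have "odd (?n - 1)" using side[of "?n - 1"] L(2) RC by auto
    then have "even ?n" using L(2) by simp
    then obtain s where s: "?n = 2 * s" by (auto elim: evenE)
    have s2: "s \<ge> 2" using s L(2) by linarith
    define P where "P = map (\<lambda>i. (L ! (2 * i), L ! (2 * i + 1))) [0..<s]"
    have P: "length P = s" "\<And>i. i < s \<Longrightarrow> P ! i = (L ! (2 * i), L ! (2 * i + 1))" by (simp_all add: P_def)
    have edge: "(L ! j, L ! i) \<in> I" if "adj I (L ! i) (L ! j)" "even i" "i < ?n" for i j
      using that side[of i] IRC RC by (auto simp: adj_def)
    have "fwd_edge P i \<in> I \<and> bwd_edge P i \<in> I" if i: "i < s" for i
    proof
      have "adj I (L ! (2 * i)) (L ! (2 * i + 1))" using L(3)[of "2 * i"] i s by simp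
      then show "fwd_edge P i \<in> I" using edge i s by (simp add: fwd_edge_def P)
      have "Suc i mod s < s" using s2 by (intro mod_less_divisor) linarith
      moreover have "Suc (2 * i + 1) mod ?n = 2 * (Suc i mod s)"
        unfolding s by (simp add: mult_mod_right)
      ultimately show "bwd_edge P i \<in> I"
        using L(3)[of "2 * i + 1"] i s edge[of "2 * (Suc i mod s)" "2 * i + 1"]
        by (simp add: bwd_edge_def P adj_sym)
    qed
    moreover have "distinct (map fst P @ map snd P)"
    proof -
      have *: "map fst P = map (\<lambda>i. L ! (2 * i)) [0..<s]" "map snd P = map (\<lambda>i. L ! (2 * i + 1)) [0..<s]"
        by (simp_all add: P_def)
      have "L ! (2 * i) \<noteq> L ! (2 * j + 1)" if "i < s" "j < s" for i j
      proof -
        have "2 * i \<noteq> 2 * j + 1" by presburger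
        then show ?thesis using that s L(1) by (simp add: nth_eq_iff_index_eq)
      qed
      then show ?thesis unfolding * using L(1) s
        by (auto simp: distinct_map inj_on_def nth_eq_iff_index_eq)
    qed
    ultimately have "is_cycle I P"
      unfolding is_cycle_def closed_walk_def walk_length_def using P(1) s2 by auto
    then show ?thesis using P(1) s by (auto simp: walk_length_def)
  qed
  show ?thesis
  proof (cases "L ! 0 \<in> C")
    case False
    have "adj I (L ! 0) (L ! 1)" using L(2) L(3)[of 0] by (cases "L = []") simp_all
    then have "L ! 1 \<in> C" using False IRC by (auto simp: adj_def)
    moreover have "adj I (rotate1 L ! i) (rotate1 L ! (Suc i mod length L))" if "i < length L" for i
    proof -
      have "Suc i mod length L < length L" using L(2) by (intro mod_less_divisor) linarith
      then show ?thesis using that L(3)[of "Suc i mod length L"] by (simp add: nth_rotate1)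
    qed
    moreover have "rotate1 L ! 0 = L ! 1" using L(2) by (subst nth_rotate1) auto
    ultimately show ?thesis using start[of "rotate1 L"] L by simp
  qed (rule start[OF _ L])
qed

text \<open>Common initial vertices are stripped by induction. Once the paths diverge, the first is
  followed to its first vertex \<open>x\<close> on the other, and the second leads back from
  \<open>x\<close> to the point of divergence.\<close>

lemma cycle_of_distinct_paths:
  assumes IRC: "I \<subseteq> R \<times> C" and RC: "R \<inter> C = {}"
  shows "simple_path I vs \<Longrightarrow> simple_path I ws \<Longrightarrow> hd vs = hd ws \<Longrightarrow> last vs = last ws \<Longrightarrow>
    length vs \<le> Suc k \<Longrightarrow> length ws \<le> Suc k \<Longrightarrow> vs \<noteq> ws \<Longrightarrow> \<exists>P. is_cycle I P \<and> walk_length P \<le> 2 * k"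
proof (induction vs arbitrary: ws)
  case (Cons v p)
  then obtain q where ws: "ws = v # q" by (cases ws) (auto simp: simple_path_def)
  have dist: "v \<notin> set p" "distinct p" "v \<notin> set q" "distinct q"
    using Cons.prems by (auto simp: simple_path_def ws)
  have pq: "p \<noteq> []" "q \<noteq> []"
    using Cons.prems(4,7) dist last_in_set[of p] last_in_set[of q] by (auto simp: ws split: if_splits)
  have last: "last p = last q" using Cons.prems(4) pq by (simp add: ws)
  show ?case
  proof (cases "hd p = hd q")
    case True
    have "simple_path I p" "simple_path I q"
      using Cons.prems(1,2) pq by (auto simp: simple_path_def ws successively_Cons)
    then show ?thesis
      using Cons.IH[of q] True last Cons.prems(5-7) by (simp add: ws)
  next
    case False
    have "\<exists>x\<in>set p. x \<in> set q" using last pq by (metis last_in_set)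
    then obtain as x bs where p: "p = as @ x # bs" "x \<in> set q" "\<forall>y\<in>set as. y \<notin> set q"
      using split_list_first_prop[of p "\<lambda>x. x \<in> set q"] by blast
    then obtain cs ds where q: "q = cs @ x # ds" using split_list by metis
    define L where "L = v # as @ x # rev cs"
    have succ: "successively (adj I) (v # as @ [x])" "successively (adj I) (v # cs @ [x])"
      using Cons.prems(1,2) successively_append_iff[of "adj I" "v # as @ [x]" bs]
        successively_append_iff[of "adj I" "v # cs @ [x]" ds]
      by (auto simp: simple_path_def ws p q)
    have sym: "(\<lambda>x y. adj I y x) = adj I" by (auto simp: adj_def fun_eq_iff)
    have "successively (adj I) ((v # as @ [x]) @ rev (v # cs))"
      unfolding successively_append_iff
    proof (intro conjI)
      show "successively (adj I) (rev (v # cs))"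
        using succ(2) successively_append_iff[of "adj I" "v # cs" "[x]"] unfolding successively_rev sym by simp
      have "adj I (last (v # cs)) x"
        using succ(2) successively_append_iff[of "adj I" "v # cs" "[x]"] by simp
      then show "v # as @ [x] = [] \<or> rev (v # cs) = [] \<or> adj I (last (v # as @ [x])) (hd (rev (v # cs)))"
        by (simp add: adj_sym hd_rev del: rev.simps)
    qed (rule succ)
    then have succL: "successively (adj I) (L @ [v])" by (simp add: L_def)
    have "adj I (L ! i) (L ! (Suc i mod length L))" if "i < length L" for i
    proof -
      have "adj I ((L @ [v]) ! i) ((L @ [v]) ! Suc i)"
        using succL that by (auto simp: successively_conv_nth)
      moreover have "L ! 0 = v" by (simp add: L_def)
      ultimately show ?thesis using that
        by (cases "Suc i = length L") (auto simp: nth_append)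
    qed
    moreover have "distinct L"
      using dist p(3) unfolding L_def p(1) q by auto
    \<comment> \<open>The paths differ at their next vertex, so \<open>as\<close> and
      \<open>cs\<close> are not both empty.\<close>
    moreover have "length L \<ge> 3"
      using False by (cases as; cases cs) (auto simp: L_def p q)
    ultimately obtain P where "is_cycle I P" "walk_length P = length L"
      using cycle_of_vertex_list[OF IRC RC] by blast
    \<comment> \<open>Each path has at most \<open>k - 1\<close> vertices strictly between
      \<open>v\<close> and \<open>x\<close>.\<close>
    moreover have "length L \<le> 2 * k"
      using Cons.prems(5,6) by (simp add: L_def ws p q)
    ultimately show ?thesis by auto
  qed
qed (simp add: simple_path_def)

text \<open>The factor that the signs put on the entry of the dilation for the step from
  \<open>u\<close> to \<open>v\<close>: a step to a row uses the operator, a step to a column its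
  adjoint.\<close>

definition step_sign :: "('v \<times> 'v) set \<Rightarrow> ('v \<times> 'v \<Rightarrow> complex) \<Rightarrow> 'v \<Rightarrow> 'v \<Rightarrow> complex" where
  "step_sign I \<epsilon> u v = (if (v, u) \<in> I then \<epsilon> (v, u) else cnj (\<epsilon> (u, v)))"

text \<open>
  \<open>N j\<close> contains the vertices at distance at most \<open>j\<close> from \<open>c\<close>, and on the ball of radius \<open>k\<close> the
  signs \<open>\<epsilon>\<close> are the coboundary of \<open>\<phi>\<close>.
\<close>

definition local_potential ::
  "('v \<times> 'v) set \<Rightarrow> nat \<Rightarrow> ('v \<times> 'v \<Rightarrow> complex) \<Rightarrow> 'v \<Rightarrow> ('v \<Rightarrow> complex) \<Rightarrow> (nat \<Rightarrow> 'v set) \<Rightarrow> bool" where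
  "local_potential I k \<epsilon> c \<phi> N \<longleftrightarrow> c \<in> N 0 \<and> \<phi> c = 1 \<and> (\<forall>v. cmod (\<phi> v) = 1) \<and>
     (\<forall>j<k. \<forall>u\<in>N j. \<forall>v. adj I u v \<longrightarrow> v \<in> N (Suc j) \<and> \<phi> v = \<phi> u * step_sign I \<epsilon> u v)"

text \<open>Paths are listed here from their end to their start.\<close>

fun path_sign :: "('v \<times> 'v) set \<Rightarrow> ('v \<times> 'v \<Rightarrow> complex) \<Rightarrow> 'v list \<Rightarrow> complex" where
  "path_sign I \<epsilon> (v # u # vs) = path_sign I \<epsilon> (u # vs) * step_sign I \<epsilon> u v"
| "path_sign I \<epsilon> vs = 1"

lemma step_sign_inverse:
  assumes IRC: "I \<subseteq> R \<times> C" and RC: "R \<inter> C = {}" and \<epsilon>: "\<And>q. q \<in> I \<Longrightarrow> cmod (\<epsilon> q) = 1" and uv: "adj I u v"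
  shows "step_sign I \<epsilon> u v * step_sign I \<epsilon> v u = 1" "cmod (step_sign I \<epsilon> u v) = 1"
proof -
  have "\<epsilon> q * cnj (\<epsilon> q) = 1" if "q \<in> I" for q
    using \<epsilon>[OF that] by (simp add: complex_norm_square[symmetric])
  moreover have "\<not> ((u, v) \<in> I \<and> (v, u) \<in> I)" using IRC RC by auto
  ultimately show "step_sign I \<epsilon> u v * step_sign I \<epsilon> v u = 1"
    using uv by (auto simp: step_sign_def adj_def mult.commute)
  show "cmod (step_sign I \<epsilon> u v) = 1"
    using uv \<epsilon> by (auto simp: step_sign_def adj_def)
qed

text \<open>Paths within the ball are unique, so the product of signs along the path from
  \<open>c\<close> to \<open>v\<close> depends on \<open>v\<close> alone. A neighbour
  \<open>v\<close> of \<open>u\<close> either prolongs the path to \<open>u\<close> or lies on it.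
  In the second case the shortcut through \<open>v\<close> is also a path to \<open>u\<close>, and
  by uniqueness it gives the value of \<phi> at \<open>u\<close>.\<close>

lemma local_potential_exists:
  assumes IRC: "I \<subseteq> R \<times> C" and RC: "R \<inter> C = {}" and \<epsilon>: "\<And>q. q \<in> I \<Longrightarrow> cmod (\<epsilon> q) = 1"
    and uniq: "\<And>vs ws. simple_path I vs \<Longrightarrow> simple_path I ws \<Longrightarrow> set vs \<subseteq> C \<union> R \<Longrightarrow> set ws \<subseteq> C \<union> R \<Longrightarrow>
      hd vs = hd ws \<Longrightarrow> last vs = last ws \<Longrightarrow> length vs \<le> Suc k \<Longrightarrow> length ws \<le> Suc k \<Longrightarrow> vs = ws"
    and c: "c \<in> C \<union> R"
  shows "\<exists>\<phi> N. local_potential I k \<epsilon> c \<phi> N"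
proof -
  define pth where "pth j v vs \<longleftrightarrow> simple_path I vs \<and> set vs \<subseteq> C \<union> R \<and> hd vs = v \<and> last vs = c \<and> length vs \<le> Suc j" for j v vs
  define N where "N j = {v. \<exists>vs. pth j v vs}" for j
  \<comment> \<open>The value 1 outside the ball keeps \<phi> unimodular everywhere.\<close>
  define \<phi> where "\<phi> v = (if v \<in> N k then path_sign I \<epsilon> (SOME vs. pth k v vs) else 1)" for v
  have \<phi>_eq: "\<phi> v = path_sign I \<epsilon> vs" if "pth k v vs" for v vs
  proof -
    have "pth k v (SOME vs. pth k v vs)" using that by (rule someI)
    then have "(SOME vs. pth k v vs) = vs" using that uniq by (auto simp: pth_def)
    then show ?thesis using that by (auto simp: \<phi>_def N_def)
  qed
  have norm: "cmod (path_sign I \<epsilon> vs) = 1" if "successively (adj I) vs" for vs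
    using that
  proof (induction vs)
    case (Cons v vs)
    then show ?case
      by (cases vs) (auto simp: norm_mult step_sign_inverse(2)[OF IRC RC \<epsilon> adj_sym])
  qed simp
  show ?thesis
    unfolding local_potential_def
  proof (intro exI conjI allI impI ballI)
    have "pth j c [c]" for j using c by (simp add: pth_def simple_path_def)
    then show "c \<in> N 0" "\<phi> c = 1" using \<phi>_eq[of c "[c]"] by (auto simp: N_def)
    show "cmod (\<phi> v) = 1" for v
    proof (cases "v \<in> N k")
      case True
      then obtain vs where vs: "pth k v vs" by (auto simp: N_def)
      from \<phi>_eq[OF vs] show ?thesis using vs norm by (simp add: pth_def simple_path_def)
    qed (simp add: \<phi>_def)
    fix j u v assume j: "j < k" and u: "u \<in> N j" and uv: "adj I u v"
    obtain vs where vs: "pth j u vs" using u by (auto simp: N_def)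
    have vs_k: "pth k u vs" using vs j by (auto simp: pth_def)
    obtain ws where ws: "vs = u # ws" using vs by (cases vs) (auto simp: pth_def simple_path_def)
    have v: "v \<in> C \<union> R" "v \<noteq> u" using uv IRC RC by (auto simp: adj_def)
    have "v \<in> N (Suc j) \<and> \<phi> v = \<phi> u * step_sign I \<epsilon> u v"
    proof (cases "v \<in> set vs")
      case False
      have p: "pth (Suc j) v (v # vs)"
        using vs False v(1) adj_sym[OF uv] by (auto simp: pth_def simple_path_def ws)
      then have "pth k v (v # vs)" using j by (auto simp: pth_def)
      then show ?thesis using p \<phi>_eq[of v "v # vs"] \<phi>_eq[OF vs_k] by (auto simp: N_def ws)
    next
      case True
      then obtain as bs where split: "ws = as @ v # bs"
        using v(2) split_list[of v ws] by (auto simp: ws)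
      have p: "pth (Suc j) v (v # bs)"
        using vs by (auto simp: pth_def simple_path_def ws split successively_append_iff successively_Cons split: if_splits)
      have "pth k u (u # v # bs)"
        using vs_k uv by (auto simp: pth_def simple_path_def ws split successively_append_iff successively_Cons split: if_splits)
      then have "\<phi> u = path_sign I \<epsilon> (v # bs) * step_sign I \<epsilon> v u" using \<phi>_eq by fastforce
      moreover have "\<phi> v = path_sign I \<epsilon> (v # bs)"
        using p j by (intro \<phi>_eq) (auto simp: pth_def)
      ultimately show ?thesis
        using p step_sign_inverse(1)[OF IRC RC \<epsilon> adj_sym[OF uv]] by (auto simp: N_def mult.assoc)
    qed
    then show "v \<in> N (Suc j)" "\<phi> v = \<phi> u * step_sign I \<epsilon> u v" by auto
  qed
qed

text \<open>
  Every edge of a closed walk of length \<open>2s \<le> 2k\<close> is reached within \<open>k\<close> steps from the start, either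
  forwards or backwards, so that the signs along the walk telescope.
\<close>

lemma closed_walk_signs:
  assumes IRC: "I \<subseteq> R \<times> C" and RC: "R \<inter> C = {}" and \<epsilon>: "\<And>q. q \<in> I \<Longrightarrow> cmod (\<epsilon> q) = 1"
    and P: "closed_walk I P" "length P \<le> k" and pot: "local_potential I k \<epsilon> (fst (P ! 0)) \<phi> N"
  shows "(\<Prod>i<length P. \<epsilon> (fwd_edge P i)) = (\<Prod>i<length P. \<epsilon> (bwd_edge P i))"
proof -
  let ?s = "length P"
  define u where "u m = (if even m then fst (P ! ((m div 2) mod ?s)) else snd (P ! (m div 2)))" for m
  have P': "?s > 0" "\<And>i. i < ?s \<Longrightarrow> fwd_edge P i \<in> I" "\<And>i. i < ?s \<Longrightarrow> bwd_edge P i \<in> I"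
    using P(1) by (auto simp: closed_walk_def)
  have ends: "u 0 = fst (P ! 0)" "u (2 * ?s) = fst (P ! 0)" by (simp_all add: u_def)
  have fwd: "(u (Suc (2 * i)), u (2 * i)) = fwd_edge P i" if "i < ?s" for i
    using that by (simp add: u_def fwd_edge_def)
  have bwd: "(u (Suc (2 * i)), u (Suc (Suc (2 * i)))) = bwd_edge P i" for i
    by (simp add: u_def bwd_edge_def)
  have adj: "adj I (u m) (u (Suc m))" if "m < 2 * ?s" for m
  proof (cases "even m")
    case True
    then obtain i where "m = 2 * i" by (auto elim: evenE)
    then show ?thesis using that fwd[of i] P'(2)[of i] by (simp add: adj_def)
  next
    case False
    then obtain i where "m = Suc (2 * i)" by (auto elim: oddE)
    then show ?thesis using that bwd[of i] P'(3)[of i] by (simp add: adj_def)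
  qed
  have step: "v \<in> N (Suc j)" "\<phi> v = \<phi> w * step_sign I \<epsilon> w v" if "j < k" "w \<in> N j" "adj I w v" for j w v
    using pot that by (auto simp: local_potential_def)
  have start: "fst (P ! 0) \<in> N 0" "\<phi> (fst (P ! 0)) = 1" using pot by (auto simp: local_potential_def)
  have forward: "m \<le> k \<Longrightarrow> m \<le> 2 * ?s \<Longrightarrow> u m \<in> N m" for m
    by (induction m) (auto simp: ends start intro: step(1)[OF _ _ adj])
  have backward: "m \<le> k \<Longrightarrow> m \<le> 2 * ?s \<Longrightarrow> u (2 * ?s - m) \<in> N m" for m
  proof (induction m)
    case (Suc m)
    then have "adj I (u (2 * ?s - m)) (u (2 * ?s - Suc m))"
      using adj_sym[OF adj[of "2 * ?s - Suc m"]] by (simp add: Suc_diff_Suc)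
    then show ?case using Suc by (intro step(1)[of m]) auto
  qed (simp add: ends start)
  have "\<phi> (u (Suc m)) = \<phi> (u m) * step_sign I \<epsilon> (u m) (u (Suc m))" if m: "m < 2 * ?s" for m
  proof (cases "m < k")
    case True
    then show ?thesis using m by (intro step(2)[OF _ forward adj]) auto
  next
    case False
    \<comment> \<open>The position of the edge counted from the end of the walk; it is below
      \<open>k\<close> because the walk has length at most \<open>2 * k\<close>.\<close>
    define j where "j = 2 * ?s - Suc m"
    have j: "j < k" "2 * ?s - j = Suc m" "j \<le> 2 * ?s" using False m P(2) by (auto simp: j_def)
    have "\<phi> (u m) = \<phi> (u (Suc m)) * step_sign I \<epsilon> (u (Suc m)) (u m)"
      using backward[of j] j adj_sym[OF adj[OF m]] by (intro step(2)) auto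
    then show ?thesis
      using step_sign_inverse(1)[OF IRC RC \<epsilon> adj_sym[OF adj[OF m]]] by (simp add: mult.assoc)
  qed
  then have "m \<le> 2 * ?s \<Longrightarrow> \<phi> (u m) = (\<Prod>i<m. step_sign I \<epsilon> (u i) (u (Suc i)))" for m
    by (induction m) (auto simp: ends start)
  from this[of "2 * ?s"] have "1 = (\<Prod>i<?s. step_sign I \<epsilon> (u (2 * i)) (u (Suc (2 * i))) *
      step_sign I \<epsilon> (u (Suc (2 * i))) (u (Suc (Suc (2 * i)))))"
    by (simp add: ends start prod_double)
  also have "\<dots> = (\<Prod>i<?s. \<epsilon> (fwd_edge P i) * cnj (\<epsilon> (bwd_edge P i)))"
  proof (rule prod.cong)
    fix i assume "i \<in> {..<?s}"
    then have i: "fwd_edge P i \<in> I" "bwd_edge P i \<in> I" "i < ?s" using P' by auto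
    have "(u (Suc (Suc (2 * i))), u (Suc (2 * i))) \<notin> I"
      using i(2)[folded bwd] IRC RC by auto
    then show "step_sign I \<epsilon> (u (2 * i)) (u (Suc (2 * i))) * step_sign I \<epsilon> (u (Suc (2 * i))) (u (Suc (Suc (2 * i)))) =
      \<epsilon> (fwd_edge P i) * cnj (\<epsilon> (bwd_edge P i))"
      using i fwd[of i] bwd[of i] by (simp add: step_sign_def)
  qed simp
  finally have 1: "1 = (\<Prod>i<?s. \<epsilon> (fwd_edge P i)) * (\<Prod>i<?s. cnj (\<epsilon> (bwd_edge P i)))"
    by (simp add: prod.distrib)
  have "(\<Prod>i<?s. cnj (\<epsilon> (bwd_edge P i))) * (\<Prod>i<?s. \<epsilon> (bwd_edge P i)) = 1"
    unfolding prod.distrib[symmetric]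
    using P' \<epsilon> by (intro prod.neutral) (auto simp: mult.commute complex_norm_square[symmetric])
  then show ?thesis using arg_cong[OF 1, of "\<lambda>x. x * (\<Prod>i<?s. \<epsilon> (bwd_edge P i))"] by (simp add: mult.assoc)
qed

text \<open>The telescoped identity is tested on signs that differ from 1 only at \<open>q\<close>,
  which leaves an equation between two powers of one number \<open>z\<close>.\<close>

lemma edge_counts_eq:
  fixes I :: "('v \<times> 'v) set"
  assumes IRC: "I \<subseteq> R \<times> C" and RC: "R \<inter> C = {}"
    and P: "closed_walk I P" "walk_length P \<le> 2 * k"
    and pot: "\<And>\<epsilon> c. (\<And>q. q \<in> I \<Longrightarrow> cmod (\<epsilon> q) = 1) \<Longrightarrow> c \<in> C \<union> R \<Longrightarrow> \<exists>\<phi> N. local_potential I k \<epsilon> c \<phi> N"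
  shows "fwd_count P = bwd_count P"
proof
  fix q :: "'v \<times> 'v"
  let ?s = "length P"
  \<comment> \<open>Both counts are at most \<open>k\<close>, so the angles of the two powers lie
    between 0 and \<open>pi\<close>, where the cosine is injective.\<close>
  define z where "z = cis (pi / (k + 1))"
  define \<epsilon> where "\<epsilon> q' = (if q' = q then z else 1)" for q'
  have sk: "?s \<le> k" using P(2) by (simp add: walk_length_def)
  have norm: "cmod (\<epsilon> q') = 1" for q' by (simp add: \<epsilon>_def z_def)
  have "fwd_edge P 0 \<in> I" using P(1) by (auto simp: closed_walk_def)
  then have "fst (P ! 0) \<in> C \<union> R" using IRC by (auto simp: fwd_edge_def)
  then obtain \<phi> N where "local_potential I k \<epsilon> (fst (P ! 0)) \<phi> N" using pot[of \<epsilon>] norm by blast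
  from closed_walk_signs[OF IRC RC norm P(1) sk this]
  have "(\<Prod>i<?s. if fwd_edge P i = q then z else 1) = (\<Prod>i<?s. if bwd_edge P i = q then z else 1)"
    by (simp add: \<epsilon>_def)
  moreover have pow: "(\<Prod>i<?s. if f i = q then z else 1) = z ^ card {i. i < ?s \<and> f i = q}" for f :: "nat \<Rightarrow> 'v \<times> 'v"
    by (simp add: prod.If_cases Int_def)
  ultimately have "z ^ fwd_count P q = z ^ bwd_count P q"
    by (simp add: fwd_count_def bwd_count_def)
  then have "cos (fwd_count P q * (pi / (k + 1))) = cos (bwd_count P q * (pi / (k + 1)))"
    unfolding z_def Complex.DeMoivre by (metis cis.sel(1))
  moreover have bound: "0 \<le> n * (pi / (k + 1))" "n * (pi / (k + 1)) \<le> pi" if "n \<le> ?s" for n :: nat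
  proof -
    have "n * pi \<le> (k + 1) * pi" using that sk by (intro mult_right_mono) auto
    then show "0 \<le> n * (pi / (k + 1))" "n * (pi / (k + 1)) \<le> pi" by (simp_all add: field_simps)
  qed
  moreover have "card {i. i < ?s \<and> f i = q} \<le> ?s" for f :: "nat \<Rightarrow> 'v \<times> 'v"
    using card_mono[of "{..<?s}" "{i. i < ?s \<and> f i = q}"] by auto
  then have "fwd_count P q \<le> ?s" "bwd_count P q \<le> ?s"
    by (simp_all only: fwd_count_def bwd_count_def)
  ultimately have "fwd_count P q * (pi / (k + 1)) = bwd_count P q * (pi / (k + 1))"
    using cos_inj_pi by blast
  then show "fwd_count P q = bwd_count P q" by simp
qed

text \<open>The first forward edge of a cycle is never a backward edge.\<close>

lemma cycle_edge_counts:
  assumes "is_cycle I P" "I \<subseteq> R \<times> C"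
  shows "fwd_count P \<noteq> bwd_count P"
proof
  assume eq: "fwd_count P = bwd_count P"
  have P: "P \<noteq> []" using assms(1) by (auto simp: is_cycle_def closed_walk_def)
  have "0 \<in> {i. i < length P \<and> fwd_edge P i = fwd_edge P 0}" using P by simp
  then have "fwd_count P (fwd_edge P 0) > 0" unfolding fwd_count_def by (subst card_gt_0_iff) auto
  then have "{i. i < length P \<and> bwd_edge P i = fwd_edge P 0} \<noteq> {}"
    unfolding eq bwd_count_def by (subst (asm) card_gt_0_iff) auto
  then obtain i where "i < length P" "bwd_edge P i = fwd_edge P 0" by blast
  then have "fwd_edge P 0 \<in> fwd_edge P ` {..<length P} \<inter> bwd_edge P ` {..<length P}"
    using P by (auto intro: image_eqI[OF sym])
  then show False using cycle_edges(3)[OF assms] by simp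
qed

section \<open>Unconditionality\<close>

definition tensor_matrix_op ::
  "('v \<times> 'v \<Rightarrow> 'm ell2 \<Rightarrow> 'm ell2) \<Rightarrow> ('v \<times> 'v) set \<Rightarrow> ('v \<times> 'v \<Rightarrow> complex) \<Rightarrow> ('m \<times> 'v) ell2 \<Rightarrow> ('m \<times> 'v) ell2" where
  "tensor_matrix_op a Q \<epsilon> F = (\<Sum>q\<in>Q. cscale (\<epsilon> q) (tensor_elem_op (a q) q F))"

lemma clinear_op_tensor_matrix_op:
  "\<forall>q\<in>Q. clinear_op (a q) \<Longrightarrow> clinear_op (tensor_matrix_op a Q \<epsilon>)"
  unfolding tensor_matrix_op_def[abs_def]
  by (intro clinear_op_sum clinear_op_cscale clinear_op_tensor_elem_op) blast

lemma adjoint_tensor_matrix_op: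
  assumes "\<forall>q\<in>Q. clinear_op (a q)"
  shows "adjoint (tensor_matrix_op a Q \<epsilon>) F =
    (\<Sum>q\<in>Q. cscale (cnj (\<epsilon> q)) (tensor_elem_op (adjoint (a q)) (snd q, fst q) F))"
proof -
  have "adjoint (tensor_elem_op (a q) q) = tensor_elem_op (adjoint (a q)) (snd q, fst q)" if "q \<in> Q" for q
    using adjoint_tensor_elem_op[OF bspec[OF assms that], of "fst q" "snd q"] by simp
  then show ?thesis
    unfolding tensor_matrix_op_def[abs_def]
    by (subst adjoint_sum) (use assms in \<open>auto intro: clinear_op_tensor_elem_op\<close>)
qed

lemma slice_unit_vec: "slice c (unit_vec (m, v)) = (if v = c then unit_vec m else 0)"
  by (auto intro!: ell2_eqI simp: coord_slice coord_simps)

lemma tensor_elem_op_zero: "clinear_op a \<Longrightarrow> slice (snd q) F = 0 \<Longrightarrow> tensor_elem_op a q F = 0"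
  by (auto intro!: ell2_eqI simp: coord_tensor_elem_op clinear_opD(4) coord_simps split_paired_all)

lemma coord_dilation_tensor_matrix_op:
  assumes "\<forall>q\<in>Q. clinear_op (a q)"
  shows "coord (dilation (tensor_matrix_op a Q \<epsilon>) F) (m, v) =
    (\<Sum>q\<in>Q. \<epsilon> q * (if v = fst q then coord (a q (slice (snd q) F)) m else 0)) +
    (\<Sum>q\<in>Q. cnj (\<epsilon> q) * (if v = snd q then coord (adjoint (a q) (slice (fst q) F)) m else 0))"
proof -
  have "coord (tensor_matrix_op a Q \<epsilon> F) (m, v) =
      (\<Sum>q\<in>Q. \<epsilon> q * (if v = fst q then coord (a q (slice (snd q) F)) m else 0))"
    by (simp add: tensor_matrix_op_def coord_sum cscale.rep_eq coord_tensor_elem_op)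
  moreover have "coord (adjoint (tensor_matrix_op a Q \<epsilon>) F) (m, v) =
      (\<Sum>q\<in>Q. cnj (\<epsilon> q) * (if v = snd q then coord (adjoint (a q) (slice (fst q) F)) m else 0))"
    unfolding adjoint_tensor_matrix_op[OF assms] coord_sum
    by (rule sum.cong[OF refl]) (simp add: cscale.rep_eq coord_tensor_elem_op)
  ultimately show ?thesis by (simp add: dilation_def plus_ell2.rep_eq)
qed

text \<open>
  Up to time \<open>k\<close>, changing the signs of the coefficients multiplies the components of the orbit of
  a vector at \<open>c\<close> by the unimodular values of the potential.
\<close>

lemma dilation_gauge:
  fixes a :: "'v \<times> 'v \<Rightarrow> 'm ell2 \<Rightarrow> 'm ell2"
  assumes IRC: "I \<subseteq> R \<times> C" and RC: "R \<inter> C = {}" and Q: "Q \<subseteq> I"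
    and ball: "\<forall>q\<in>Q. clinear_op (a q)"
    and pot: "local_potential I k \<epsilon> c \<phi> N"
  defines "H \<equiv> dilation (tensor_matrix_op a Q \<epsilon>)" and "H\<^sub>1 \<equiv> dilation (tensor_matrix_op a Q (\<lambda>_. 1))"
  shows "j \<le> k \<Longrightarrow> (\<forall>m v. coord ((H ^^ j) (unit_vec (m0, c))) (m, v) = \<phi> v * coord ((H\<^sub>1 ^^ j) (unit_vec (m0, c))) (m, v)) \<and>
      (\<forall>m v. coord ((H\<^sub>1 ^^ j) (unit_vec (m0, c))) (m, v) \<noteq> 0 \<longrightarrow> v \<in> N j)"
proof (induction j)
  case 0
  then show ?case using pot by (auto simp: coord_simps local_potential_def)
next
  case (Suc j)
  note a = bspec[OF ball]
  define f where "f = (H\<^sub>1 ^^ j) (unit_vec (m0, c))"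
  define f' where "f' = (H ^^ j) (unit_vec (m0, c))"
  have IH: "\<And>m v. coord f' (m, v) = \<phi> v * coord f (m, v)" "\<And>m v. coord f (m, v) \<noteq> 0 \<Longrightarrow> v \<in> N j"
    using Suc by (auto simp: f_def f'_def)
  have slice: "slice v f' = cscale (\<phi> v) (slice v f)" for v
    by (rule ell2_eqI) (simp add: coord_slice cscale.rep_eq IH)
  have slice_0: "v \<in> N j" if "slice v f \<noteq> 0" for v
  proof -
    have "\<exists>m. coord (slice v f) m \<noteq> 0" using that by (metis ell2_eqI zero_ell2.rep_eq)
    then show ?thesis using IH(2) by (auto simp: coord_slice)
  qed
  have step: "v \<in> N (Suc j)" "\<phi> v = \<phi> u * step_sign I \<epsilon> u v" if "u \<in> N j" "adj I u v" for u v
    using pot that Suc_le_lessD[OF Suc.prems] unfolding local_potential_def by blast+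
  have edge: "adj I (fst q) (snd q)" "adj I (snd q) (fst q)" "(snd q, fst q) \<notin> I" "q \<in> I" if "q \<in> Q" for q
  proof -
    have "q \<in> I" using that Q by blast
    moreover have "(snd q, fst q) \<notin> I"
    proof
      assume "(snd q, fst q) \<in> I"
      then have "snd q \<in> R" using IRC by auto
      moreover have "snd q \<in> C" using \<open>q \<in> I\<close> IRC by auto
      ultimately show False using RC by blast
    qed
    ultimately show "adj I (fst q) (snd q)" "adj I (snd q) (fst q)" "(snd q, fst q) \<notin> I" "q \<in> I"
      by (simp_all add: adj_def)
  qed
  \<comment> \<open>If the slice vanishes, both sides are 0. Otherwise its vertex lies in
    \<open>N j\<close>, where the potential relation is available.\<close>
  have 1: "\<epsilon> q * (if v = fst q then coord (a q (slice (snd q) f')) m else 0) =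
      \<phi> v * (1 * (if v = fst q then coord (a q (slice (snd q) f)) m else 0))" if q: "q \<in> Q" for q v m
  proof (cases "slice (snd q) f = 0")
    case False
    from step(2)[OF slice_0[OF this] edge(2)[OF q]] show ?thesis
      using edge[OF q] by (simp add: slice clinear_opD[OF a[OF q]] cscale.rep_eq step_sign_def)
  qed (simp add: slice clinear_opD[OF a[OF q]] zero_ell2.rep_eq)
  have 2: "cnj (\<epsilon> q) * (if v = snd q then coord (adjoint (a q) (slice (fst q) f')) m else 0) =
      \<phi> v * (cnj 1 * (if v = snd q then coord (adjoint (a q) (slice (fst q) f)) m else 0))" if q: "q \<in> Q" for q v m
  proof (cases "slice (fst q) f = 0")
    case False
    from step(2)[OF slice_0[OF this] edge(1)[OF q]] show ?thesis
      using edge[OF q] by (simp add: slice clinear_opD[OF clinear_op_adjoint[OF a[OF q]]] cscale.rep_eq step_sign_def)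
  qed (simp add: slice clinear_opD[OF clinear_op_adjoint[OF a[OF q]]] zero_ell2.rep_eq)
  have "coord (H f') (m, v) = \<phi> v * coord (H\<^sub>1 f) (m, v)" for m v
    unfolding H_def H\<^sub>1_def coord_dilation_tensor_matrix_op[OF ball] distrib_left sum_distrib_left
    by (intro arg_cong2[where f = "(+)"] sum.cong refl 1 2)
  moreover have "v \<in> N (Suc j)" if "coord (H\<^sub>1 f) (m, v) \<noteq> 0" for m v
  proof -
    have "(\<Sum>q\<in>Q. 1 * (if v = fst q then coord (a q (slice (snd q) f)) m else 0)) \<noteq> 0 \<or>
      (\<Sum>q\<in>Q. cnj 1 * (if v = snd q then coord (adjoint (a q) (slice (fst q) f)) m else 0)) \<noteq> 0"
      using that unfolding H\<^sub>1_def coord_dilation_tensor_matrix_op[OF ball] by auto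
    then obtain q where q: "q \<in> Q" "v = fst q \<and> coord (a q (slice (snd q) f)) m \<noteq> 0 \<or>
        v = snd q \<and> coord (adjoint (a q) (slice (fst q) f)) m \<noteq> 0"
      by (auto elim!: sum.not_neutral_contains_not_neutral split: if_splits)
    have "v = fst q \<and> slice (snd q) f \<noteq> 0 \<or> v = snd q \<and> slice (fst q) f \<noteq> 0"
      using q by (auto simp: clinear_opD(4)[OF a] clinear_opD(4)[OF clinear_op_adjoint[OF a]] zero_ell2.rep_eq)
    then show ?thesis using step(1) slice_0 edge[OF q(1)] by blast
  qed
  ultimately show ?case by (simp add: f_def f'_def)
qed

text \<open>The comparison is made one basis vector at a time, since the potential depends on the
  second index \<open>v\<close>. The coefficients act on the first index only, so multiplication by
  \<phi> passes through them.\<close>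

lemma schatten_norm_tensor_signs:
  fixes a :: "'v \<times> 'v \<Rightarrow> 'm ell2 \<Rightarrow> 'm ell2"
  assumes IRC: "I \<subseteq> R \<times> C" and RC: "R \<inter> C = {}" and Q: "Q \<subseteq> I" and k: "k > 0"
    and ball: "\<forall>q\<in>Q. clinear_op (a q)"
    and pot: "\<And>c. c \<in> C \<Longrightarrow> \<exists>\<phi> N. local_potential I k \<epsilon> c \<phi> N"
  shows "schatten_norm (2 * k) (tensor_matrix_op a Q \<epsilon>) = schatten_norm (2 * k) (tensor_matrix_op a Q (\<lambda>_. 1))"
proof -
  let ?X = "tensor_matrix_op a Q"
  note a = bspec[OF ball]
  have RC_edge: "fst q \<in> R" "snd q \<in> C" if "q \<in> Q" for q using that Q IRC by auto
  have lin: "clinear_op (?X \<delta>)" for \<delta> by (rule clinear_op_tensor_matrix_op[OF ball])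
  have sq: "?X \<delta> (?X \<delta> F) = 0" for \<delta> F
  proof -
    have "slice (snd q) (?X \<delta> F) = 0" if "q \<in> Q" for q
    proof -
      have "snd q \<noteq> fst q'" if "q' \<in> Q" for q' using RC_edge(2)[OF \<open>q \<in> Q\<close>] RC_edge(1)[OF that] RC by auto
      then show ?thesis
        by (intro ell2_eqI) (simp add: coord_slice tensor_matrix_op_def coord_simps coord_tensor_elem_op)
    qed
    then show ?thesis
      unfolding tensor_matrix_op_def[of a Q \<delta> "?X \<delta> F"]
      by (intro sum.neutral) (simp add: tensor_elem_op_zero a)
  qed
  have "cinner (unit_vec mv) (abs_power (2 * k) (?X \<epsilon>) (unit_vec mv)) =
      cinner (unit_vec mv) (abs_power (2 * k) (?X (\<lambda>_. 1)) (unit_vec mv))" for mv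
  proof -
    obtain m v where mv: "mv = (m, v)" by force
    show ?thesis
    proof (cases "v \<in> C")
      case True
      then have "fst q \<noteq> v" if "q \<in> Q" for q using RC_edge(1)[OF that] RC by auto
      then have adj0: "adjoint (?X \<delta>) (unit_vec (m, v)) = 0" for \<delta>
      proof -
        have "tensor_elem_op (adjoint (a q)) (snd q, fst q) (unit_vec (m, v)) = 0" if "q \<in> Q" for q
          using \<open>\<And>q. q \<in> Q \<Longrightarrow> fst q \<noteq> v\<close>[OF that]
          by (intro tensor_elem_op_zero) (auto simp: clinear_op_adjoint a that slice_unit_vec)
        then show ?thesis unfolding adjoint_tensor_matrix_op[OF ball] by simp
      qed
      obtain \<phi> N where pot': "local_potential I k \<epsilon> v \<phi> N" using pot[OF True] by blast
      have "coord ((dilation (?X \<epsilon>) ^^ k) (unit_vec (m, v))) (m', v') =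
          \<phi> v' * coord ((dilation (?X (\<lambda>_. 1)) ^^ k) (unit_vec (m, v))) (m', v')" for m' v'
        using dilation_gauge[OF IRC RC Q ball pot', of k m] by simp
      moreover have "cmod (\<phi> v') = 1" for v' using pot' by (simp add: local_potential_def)
      ultimately have "(norm ((dilation (?X \<epsilon>) ^^ k) (unit_vec (m, v))))\<^sup>2 =
          (norm ((dilation (?X (\<lambda>_. 1)) ^^ k) (unit_vec (m, v))))\<^sup>2"
        unfolding norm_power2_ell2 by (intro infsum_cong) (auto simp: norm_mult split_paired_all)
      then show ?thesis unfolding mv by (simp only: trace_term[OF lin sq adj0])
    next
      case False
      have "tensor_elem_op (a q) q (unit_vec (m, v)) = 0" if "q \<in> Q" for q
        using False RC_edge(2)[OF that] by (intro tensor_elem_op_zero a that) (auto simp: slice_unit_vec)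
      then have "?X \<delta> (unit_vec (m, v)) = 0" for \<delta> by (simp add: tensor_matrix_op_def)
      from abs_power_zero[OF lin this] show ?thesis using k by (simp add: mv)
    qed
  qed
  then show ?thesis by (simp add: schatten_norm_def op_trace_def)
qed

section \<open>From potentials to complete and scalar unconditionality\<close>

lemma completely_unconditional_of_potential:
  fixes I :: "('v \<times> 'v) set"
  assumes IRC: "I \<subseteq> R \<times> C" and RC: "R \<inter> C = {}" and k: "k > 0"
    and pot: "\<And>\<epsilon> c. (\<And>q. q \<in> I \<Longrightarrow> cmod (\<epsilon> q) = 1) \<Longrightarrow> c \<in> C \<union> R \<Longrightarrow> \<exists>\<phi> N. local_potential I k \<epsilon> c \<phi> N"
  shows "completely_unconditional (sphere 0 1) (2 * k) I"
  unfolding completely_unconditional_def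
proof (intro allI impI, elim conjE)
  fix a :: "'v \<times> 'v \<Rightarrow> nat ell2 \<Rightarrow> nat ell2" and \<epsilon> :: "'v \<times> 'v \<Rightarrow> complex"
  assume a: "\<forall>q\<in>I. a q \<in> schatten_class (2 * k) UNIV UNIV" and \<epsilon>: "\<forall>q\<in>I. \<epsilon> q \<in> sphere 0 1"
  have "\<forall>q\<in>I. clinear_op (a q)"
    using a by (auto simp: schatten_class_def compact_op_def)
  then have "schatten_norm (2 * k) (tensor_matrix_op a {q \<in> I. a q \<noteq> (\<lambda>_. 0)} \<epsilon>) =
      schatten_norm (2 * k) (tensor_matrix_op a {q \<in> I. a q \<noteq> (\<lambda>_. 0)} (\<lambda>_. 1))"
    using pot \<epsilon> by (intro schatten_norm_tensor_signs[OF IRC RC _ k]) auto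
  then show "schatten_norm (2 * k) (\<lambda>F. \<Sum>q\<in>{q \<in> I. a q \<noteq> (\<lambda>_. 0)}. cscale (\<epsilon> q) (tensor_elem_op (a q) q F)) =
      schatten_norm (2 * k) (\<lambda>F. \<Sum>q\<in>{q \<in> I. a q \<noteq> (\<lambda>_. 0)}. tensor_elem_op (a q) q F)"
    by (simp add: tensor_matrix_op_def[abs_def])
qed

lemma tensor_cscale: "tensor u (cscale z f) = cscale z (tensor u f)"
  by (auto intro!: ell2_eqI simp: coord_tensor coord_simps algebra_simps split_paired_all)

lemma tensor_sum: "tensor u (\<Sum>i\<in>A. f i) = (\<Sum>i\<in>A. tensor u (f i))"
  by (auto intro!: ell2_eqI simp: coord_tensor coord_simps sum_distrib_left split_paired_all)

text \<open>Tensoring with the basis vector at \<open>m0\<close> intertwines the two operators as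
  well as their adjoints; basis vectors with another first index are annihilated and add nothing to
  the trace.\<close>

lemma schatten_norm_tensor_matrix_unit:
  fixes Q :: "('v \<times> 'v) set"
  assumes k: "k > 0"
  shows "schatten_norm (2 * k) (tensor_matrix_op (\<lambda>_. elem_op (m0, m0)) Q \<beta>) =
    schatten_norm (2 * k) (\<lambda>f. \<Sum>q\<in>Q. cscale (\<beta> q) (elem_op q f))"
proof -
  let ?X = "tensor_matrix_op (\<lambda>_. elem_op (m0, m0)) Q \<beta>"
  let ?x = "\<lambda>f. \<Sum>q\<in>Q. cscale (\<beta> q) (elem_op q f)"
  let ?T = "tensor (unit_vec m0)"
  have elem: "tensor_elem_op (elem_op (m0, m0)) q (?T g) = ?T (elem_op q g)" for q g
    by (simp add: tensor_elem_op_tensor[OF clinear_op_elem_op]) (simp add: elem_op_def coord_simps)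
  have X: "?X (?T g) = ?T (?x g)" for g
    by (simp add: tensor_matrix_op_def elem tensor_sum tensor_cscale)
  have adj: "adjoint (elem_op q) = elem_op (snd q, fst q)" for q :: "'v \<times> 'v"
    by (cases q) (simp add: adjoint_elem_op)
  note lin = ballI[OF clinear_op_elem_op]
  have "adjoint ?x g = (\<Sum>q\<in>Q. cscale (cnj (\<beta> q)) (elem_op (snd q, fst q) g))" for g
    by (subst adjoint_sum) (simp_all add: clinear_op_elem_op adj)
  then have X': "adjoint ?X (?T g) = ?T (adjoint ?x g)" for g
    by (simp add: adjoint_tensor_matrix_op[OF lin] adjoint_elem_op elem tensor_sum tensor_cscale)
  have pow: "((adjoint ?X \<circ> ?X) ^^ j) (?T g) = ?T (((adjoint ?x \<circ> ?x) ^^ j) g)" for j g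
    by (induction j) (simp_all add: X X')
  have diag: "cinner (unit_vec (m, v)) (abs_power (2 * k) ?X (unit_vec (m, v))) =
      (if m = m0 then cinner (unit_vec v) (abs_power (2 * k) ?x (unit_vec v)) else 0)" for m v
  proof (cases "m = m0")
    case True
    have "unit_vec (m0, v) = ?T (unit_vec v)"
      by (auto intro!: ell2_eqI simp: coord_tensor coord_simps split_paired_all)
    then have "abs_power (2 * k) ?X (unit_vec (m0, v)) = ?T (abs_power (2 * k) ?x (unit_vec v))"
      by (simp only: abs_power_def pow)
    then show ?thesis using True by (simp add: coord_tensor coord_simps)
  next
    case False
    then have "tensor_elem_op (elem_op (m0, m0)) q (unit_vec (m, v)) = 0" for q :: "'v \<times> 'v"
      by (intro ell2_eqI)
        (simp add: split_paired_all coord_tensor_elem_op coord_elem_op coord_slice coord_simps)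
    then have "?X (unit_vec (m, v)) = 0" by (simp add: tensor_matrix_op_def)
    from abs_power_zero[OF clinear_op_tensor_matrix_op[OF lin] this] show ?thesis
      using False k by simp
  qed
  have "op_trace (abs_power (2 * k) ?X) =
      (\<Sum>\<^sub>\<infinity>mv\<in>Pair m0 ` UNIV. cinner (unit_vec mv) (abs_power (2 * k) ?X (unit_vec mv)))"
    unfolding op_trace_def by (intro infsum_cong_neutral) (auto simp: diag simp del: cinner_unit_vec)
  also have "\<dots> = op_trace (abs_power (2 * k) ?x)"
    unfolding op_trace_def
    by (subst infsum_reindex) (auto simp: inj_on_def o_def diag simp del: cinner_unit_vec)
  finally show ?thesis by (simp add: schatten_norm_def)
qed

text \<open>Scalars are embedded as multiples of a fixed rank-one projection.\<close>

lemma unconditional_of_completely_unconditional: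
  fixes I :: "('a \<times> 'a) set"
  assumes k: "k > 0" and I: "completely_unconditional E (2 * k) I"
  shows "unconditional E (2 * k) I"
  unfolding unconditional_def
proof (intro allI impI, elim conjE)
  fix \<alpha> \<epsilon> :: "'a \<times> 'a \<Rightarrow> complex"
  assume fin: "finite {q \<in> I. \<alpha> q \<noteq> 0}" and \<epsilon>: "\<forall>q\<in>I. \<epsilon> q \<in> E"
  define e where "e = (elem_op (0, 0) :: nat ell2 \<Rightarrow> nat ell2)"
  define a where "a q f = cscale (\<alpha> q) (e f)" for q f
  let ?Q = "{q \<in> I. \<alpha> q \<noteq> 0}"
  have "a q = (\<lambda>_. 0) \<longleftrightarrow> \<alpha> q = 0" for q
  proof
    assume "a q = (\<lambda>_. 0)"
    then have "coord (a q (unit_vec 0)) 0 = 0" by (simp add: zero_ell2.rep_eq)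
    then show "\<alpha> q = 0" by (simp add: a_def e_def coord_simps coord_elem_op)
  qed (auto simp: a_def)
  then have Q: "{q \<in> I. a q \<noteq> (\<lambda>_. 0)} = ?Q" by auto
  have "a q \<in> schatten_class (2 * k) UNIV UNIV" for q
    using matrix_op_schatten[of "{(0 :: nat, 0 :: nat)}" UNIV UNIV "2 * k" "\<lambda>_. \<alpha> q"] k
    by (simp add: a_def[abs_def] e_def)
  with I fin \<epsilon> have "schatten_norm (2 * k) (\<lambda>F. \<Sum>q\<in>?Q. cscale (\<epsilon> q) (tensor_elem_op (a q) q F)) =
      schatten_norm (2 * k) (\<lambda>F. \<Sum>q\<in>?Q. tensor_elem_op (a q) q F)"
    unfolding completely_unconditional_def Q[symmetric] by blast
  moreover have tens: "tensor_elem_op (a q) q F = cscale (\<alpha> q) (tensor_elem_op e q F)" for q F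
    by (auto intro!: ell2_eqI simp: coord_tensor_elem_op a_def coord_simps split_paired_all)
  have "(\<lambda>F. \<Sum>q\<in>?Q. tensor_elem_op (a q) q F) = tensor_matrix_op (\<lambda>_. e) ?Q \<alpha>"
    "(\<lambda>F. \<Sum>q\<in>?Q. cscale (\<epsilon> q) (tensor_elem_op (a q) q F)) = tensor_matrix_op (\<lambda>_. e) ?Q (\<lambda>q. \<epsilon> q * \<alpha> q)"
    by (simp_all add: tensor_matrix_op_def[abs_def] tens cscale_cscale)
  ultimately show "schatten_norm (2 * k) (\<lambda>f. \<Sum>q\<in>?Q. cscale (\<epsilon> q * \<alpha> q) (elem_op q f)) =
      schatten_norm (2 * k) (\<lambda>f. \<Sum>q\<in>?Q. cscale (\<alpha> q) (elem_op q f))"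
    by (simp only: e_def schatten_norm_tensor_matrix_unit[OF k])
qed

lemma unconditional_mono:
  fixes I :: "('r \<times> 'c) set"
  assumes "unconditional E p I" "E' \<subseteq> E"
  shows "unconditional E' p I"
  unfolding unconditional_def
proof (intro allI impI)
  fix a \<epsilon> :: "'r \<times> 'c \<Rightarrow> complex"
  assume "finite {q \<in> I. a q \<noteq> 0} \<and> (\<forall>q\<in>I. \<epsilon> q \<in> E')"
  then have "finite {q \<in> I. a q \<noteq> 0} \<and> (\<forall>q\<in>I. \<epsilon> q \<in> E)" using assms(2) by blast
  from assms(1)[unfolded unconditional_def, THEN spec[of _ a], THEN spec[of _ \<epsilon>], THEN mp, OF this]
  show "schatten_norm p (\<lambda>f. \<Sum>q\<in>{q \<in> I. a q \<noteq> 0}. cscale (\<epsilon> q * a q) (elem_op q f)) =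
      schatten_norm p (\<lambda>f. \<Sum>q\<in>{q \<in> I. a q \<noteq> 0}. cscale (a q) (elem_op q f))" .
qed

text \<open>The witness has entry 1 at the places of \<open>F\<close> and 0 elsewhere, so its
  support is exactly \<open>F\<close>.\<close>

lemma norm_independent_operator:
  assumes I: "unconditional E (2 * k) I" and E: "1 \<in> E" and k: "k > 0" and F: "finite F" "F \<subseteq> I" and IRC: "I \<subseteq> R \<times> C"
  shows "\<exists>x\<in>schatten_class (2 * k) C R. (\<forall>q\<in>R \<times> C. matrix_coeff x q \<in> \<real>) \<and> F \<subseteq> matrix_support R C x \<and>
    norm_independent_of_signs E (2 * k) R C x"
proof
  let ?x = "\<lambda>\<epsilon> f. \<Sum>q\<in>F. cscale (\<epsilon> q) (elem_op q f)"
  have mem: "?x \<epsilon> \<in> schatten_class (2 * k) C R" for \<epsilon>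
    using F IRC k by (intro matrix_op_schatten) auto
  note coeff = matrix_coeff_matrix_op[OF F(1)]
  have supp: "matrix_support R C (?x (\<lambda>_. 1)) = F"
    unfolding matrix_support_def coeff using F IRC by auto
  have norm: "schatten_norm (2 * k) (?x \<epsilon>) = schatten_norm (2 * k) (?x (\<lambda>_. 1))" if \<epsilon>: "\<forall>q\<in>F. \<epsilon> q \<in> E" for \<epsilon>
  proof -
    \<comment> \<open>\<open>unconditional\<close> asks for signs on all of \<open>I\<close>; those
      outside \<open>F\<close>, where the coefficients vanish, are set to 1.\<close>
    let ?a = "\<lambda>q. if q \<in> F then 1 else 0 :: complex" and ?\<epsilon> = "\<lambda>q. if q \<in> F then \<epsilon> q else 1"
    have F': "{q \<in> I. ?a q \<noteq> 0} = F" using F by auto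
    have "finite {q \<in> I. ?a q \<noteq> 0} \<and> (\<forall>q\<in>I. ?\<epsilon> q \<in> E)" unfolding F' using F \<epsilon> E by auto
    from I[unfolded unconditional_def, THEN spec[of _ ?a], THEN spec[of _ ?\<epsilon>], THEN mp, OF this] have "schatten_norm (2 * k) (\<lambda>f. \<Sum>q\<in>{q \<in> I. ?a q \<noteq> 0}. cscale (?\<epsilon> q * ?a q) (elem_op q f)) =
        schatten_norm (2 * k) (\<lambda>f. \<Sum>q\<in>{q \<in> I. ?a q \<noteq> 0}. cscale (?a q) (elem_op q f))"
      .
    then show ?thesis unfolding F' by (simp cong: sum.cong)
  qed
  show "?x (\<lambda>_. 1) \<in> schatten_class (2 * k) C R" by (rule mem)
  show "(\<forall>q\<in>R \<times> C. matrix_coeff (?x (\<lambda>_. 1)) q \<in> \<real>) \<and> F \<subseteq> matrix_support R C (?x (\<lambda>_. 1)) \<and>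
      norm_independent_of_signs E (2 * k) R C (?x (\<lambda>_. 1))"
    unfolding norm_independent_of_signs_def supp
  proof (intro conjI exI allI impI)
    fix \<epsilon> :: "'a \<times> 'b \<Rightarrow> complex" assume \<epsilon>: "\<forall>q\<in>F. \<epsilon> q \<in> E"
    show "\<exists>y\<in>schatten_class (2 * k) C R.
        (\<forall>q\<in>R \<times> C. matrix_coeff y q = (if q \<in> F then \<epsilon> q * matrix_coeff (?x (\<lambda>_. 1)) q else 0)) \<and>
        schatten_norm (2 * k) y = schatten_norm (2 * k) (?x (\<lambda>_. 1))"
      using mem[of \<epsilon>] norm[OF \<epsilon>] by (intro bexI[of _ "?x \<epsilon>"]) (simp_all add: coeff del: cscale_simps)
  qed (simp_all add: coeff del: cscale_simps)
qed

text \<open>The last condition in \<open>ex\<close> joins the real and the complex case: admissible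
  signs can replace the coefficients by their moduli with arbitrary real signs. For \<open>E\<close>
  equal to \<open>{-1, 1}\<close> it holds when the coefficients are real.\<close>

lemma no_cycle_of_norm_independent_operators:
  assumes IRC: "I \<subseteq> R \<times> C" and RC: "R \<inter> C = {}" and k: "k > 0"
    and ex: "\<And>F. finite F \<Longrightarrow> F \<subseteq> I \<Longrightarrow> \<exists>x. F \<subseteq> matrix_support R C x \<and> norm_independent_of_signs E (2 * k) R C x \<and>
      (\<forall>\<delta>\<in>{-1, 1}. \<forall>q\<in>matrix_support R C x. \<exists>z\<in>E. z * matrix_coeff x q = of_real (\<delta> * cmod (matrix_coeff x q)))"
  shows "\<nexists>P. is_cycle I P \<and> walk_length P \<le> 2 * k"
proof (rule notI, elim exE conjE)
  fix P assume P: "is_cycle I P" "walk_length P \<le> 2 * k"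
  define F where "F = fwd_edge P ` {..<length P} \<union> bwd_edge P ` {..<length P}"
  have "finite F" "F \<subseteq> I" using P(1) by (auto simp: F_def is_cycle_def closed_walk_def)
  then obtain x where x: "F \<subseteq> matrix_support R C x" "norm_independent_of_signs E (2 * k) R C x"
    "\<And>\<delta> q. \<delta> \<in> {-1, 1} \<Longrightarrow> q \<in> matrix_support R C x \<Longrightarrow> \<exists>z\<in>E. z * matrix_coeff x q = of_real (\<delta> * cmod (matrix_coeff x q))"
    using ex[of F] by blast
  obtain N where N: "\<And>\<epsilon>. (\<forall>q\<in>matrix_support R C x. \<epsilon> q \<in> E) \<Longrightarrow> \<exists>y\<in>schatten_class (2 * k) C R.
      (\<forall>q\<in>R \<times> C. matrix_coeff y q = (if q \<in> matrix_support R C x then \<epsilon> q * matrix_coeff x q else 0)) \<and>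
      schatten_norm (2 * k) y = N"
    using x(2) unfolding norm_independent_of_signs_def by blast
  have "\<exists>y\<in>schatten_class (2 * k) C R. (\<forall>q\<in>R \<times> C. matrix_coeff y q = of_real (\<delta> q * cmod (matrix_coeff x q))) \<and>
      schatten_norm (2 * k) y = N" if \<delta>: "\<And>q. \<delta> q \<in> {-1, 1}" for \<delta> :: "'a \<times> 'a \<Rightarrow> real"
  proof -
    define \<epsilon> where "\<epsilon> q = (SOME z. z \<in> E \<and> z * matrix_coeff x q = of_real (\<delta> q * cmod (matrix_coeff x q)))" for q
    have \<epsilon>: "\<epsilon> q \<in> E \<and> \<epsilon> q * matrix_coeff x q = of_real (\<delta> q * cmod (matrix_coeff x q))" if "q \<in> matrix_support R C x" for q
      unfolding \<epsilon>_def by (rule someI_ex) (use x(3)[OF \<delta> that] in \<open>simp only: Bex_def\<close>)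
    then obtain y where y: "y \<in> schatten_class (2 * k) C R" "schatten_norm (2 * k) y = N"
      "\<And>q. q \<in> R \<times> C \<Longrightarrow> matrix_coeff y q = (if q \<in> matrix_support R C x then \<epsilon> q * matrix_coeff x q else 0)"
      using N[of \<epsilon>] by blast
    have "matrix_coeff y q = of_real (\<delta> q * cmod (matrix_coeff x q))" if "q \<in> R \<times> C" for q
      using y(3)[OF that] \<epsilon>[of q] that by (auto simp: matrix_support_def)
    then show ?thesis using y by blast
  qed
  moreover have "cmod (matrix_coeff x q) > 0" if "q \<in> F" for q
    using x(1) that by (auto simp: matrix_support_def)
  then have "i < length P \<Longrightarrow> cmod (matrix_coeff x (fwd_edge P i)) > 0"
    "i < length P \<Longrightarrow> cmod (matrix_coeff x (bwd_edge P i)) > 0" for i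
    by (auto simp: F_def)
  ultimately show False
    by (rule no_cycle_if_norm_independent[OF RC k norm_ge_zero _ P IRC])
qed

section \<open>The equivalences\<close>

theorem theorem9p1:
  fixes R C V :: "'v set" and I :: "('v \<times> 'v) set" and p k :: nat
  assumes "countable R" and "countable C" and "R \<inter> C = {}" and "V = C \<union> R"
    and "I \<subseteq> R \<times> C" and "p = 2 * k" and "p > 0"
  defines "a \<equiv> completely_unconditional (sphere 0 1) p I"
    and "b \<equiv> unconditional (sphere 0 1) p I"
    and "c \<equiv> (\<forall>F. finite F \<and> F \<subseteq> I \<longrightarrow>
           (\<exists>x\<in>schatten_class p C R. F \<subseteq> matrix_support R C x \<and>
              norm_independent_of_signs (sphere 0 1) p R C x))"
    and "d \<equiv> unconditional {-1, 1} p I"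
    and "e \<equiv> (\<forall>F. finite F \<and> F \<subseteq> I \<longrightarrow>
           (\<exists>x\<in>schatten_class p C R. (\<forall>q\<in>R \<times> C. matrix_coeff x q \<in> \<real>) \<and> F \<subseteq> matrix_support R C x \<and>
              norm_independent_of_signs {-1, 1} p R C x))"
    and "f \<equiv> (\<forall>P. closed_walk I P \<and> walk_length P \<le> 2 * k \<longrightarrow> fwd_count P = bwd_count P)"
    and "g \<equiv> (\<nexists>P. is_cycle I P \<and> walk_length P \<le> 2 * k)"
    and "h \<equiv> (\<forall>v\<in>V. \<forall>w\<in>V. \<forall>l l' P Q. l \<le> k \<and> l' \<le> k \<and>
           is_path V I v w l P \<and> is_path V I v w l' Q \<longrightarrow> P = Q)"
  shows "(a \<longleftrightarrow> b) \<and> (b \<longleftrightarrow> c) \<and> (c \<longleftrightarrow> d) \<and> (d \<longleftrightarrow> e) \<and> (e \<longleftrightarrow> f) \<and> (f \<longleftrightarrow> g) \<and> (g \<longleftrightarrow> h)"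
proof -
  note RC = \<open>R \<inter> C = {}\<close> and V = \<open>V = C \<union> R\<close> and IRC = \<open>I \<subseteq> R \<times> C\<close> and p = \<open>p = 2 * k\<close>
  have k: "k > 0" using \<open>p > 0\<close> p by simp
  \<comment> \<open>Potentials are the hub: \<open>g\<close> implies \<open>h\<close>,
    \<open>h\<close> implies \<open>pot\<close>, and \<open>pot\<close> implies both
    \<open>f\<close> and \<open>a\<close>. From \<open>a\<close> one descends to \<open>b\<close>,
    then to \<open>c\<close> and through \<open>d\<close> to \<open>e\<close>; each of
    \<open>f\<close>, \<open>c\<close> and \<open>e\<close> leads back to \<open>g\<close>.\<close>
  define pot where "pot \<longleftrightarrow> (\<forall>\<epsilon> c. (\<forall>q\<in>I. cmod (\<epsilon> q) = 1) \<longrightarrow> c \<in> C \<union> R \<longrightarrow> (\<exists>\<phi> N. local_potential I k \<epsilon> c \<phi> N))"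
  have "g \<Longrightarrow> h"
    unfolding h_def is_path_iff
  proof (intro ballI allI impI, elim conjE)
    fix v w l l' vs ws
    assume g and paths: "simple_path I vs" "simple_path I ws" "hd vs = v" "last vs = w" "hd ws = v" "last ws = w"
      and len: "length vs = l + 1" "length ws = l' + 1" "l \<le> k" "l' \<le> k"
    show "vs = ws"
      using cycle_of_distinct_paths[OF IRC RC paths(1,2), of k] paths(3-) len \<open>g\<close> unfolding g_def by auto
  qed
  moreover have "h \<Longrightarrow> pot"
    unfolding pot_def
  proof (intro allI impI local_potential_exists[OF IRC RC])
    fix vs ws
    assume h and vs: "simple_path I vs" "set vs \<subseteq> C \<union> R" "length vs \<le> Suc k"
      and ws: "simple_path I ws" "set ws \<subseteq> C \<union> R" "length ws \<le> Suc k"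
      and eq: "hd vs = hd ws" "last vs = last ws"
    have ne: "vs \<noteq> []" "ws \<noteq> []" using vs ws by (auto simp: simple_path_def)
    have "is_path V I (hd vs) (last vs) (length vs - 1) vs" "is_path V I (hd vs) (last vs) (length ws - 1) ws"
      using vs ws eq ne by (auto simp: is_path_iff V Suc_le_eq)
    moreover have "hd vs \<in> V" "last vs \<in> V" using hd_in_set[OF ne(1)] last_in_set[OF ne(1)] vs(2) V by blast+
    moreover have "length vs - 1 \<le> k" "length ws - 1 \<le> k" using vs(3) ws(3) by auto
    ultimately show "vs = ws" using \<open>h\<close> unfolding h_def by blast
  qed auto
  moreover have "pot \<Longrightarrow> f"
    unfolding f_def pot_def using edge_counts_eq[OF IRC RC] by blast
  moreover have "f \<Longrightarrow> g"
    unfolding f_def g_def using cycle_edge_counts[OF _ IRC] by (auto simp: is_cycle_def)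
  moreover have "pot \<Longrightarrow> a"
    unfolding a_def pot_def p by (rule completely_unconditional_of_potential[OF IRC RC k]) blast
  moreover have "a \<Longrightarrow> b"
    unfolding a_def b_def p by (rule unconditional_of_completely_unconditional[OF k])
  moreover have "b \<Longrightarrow> c"
    unfolding b_def c_def p using norm_independent_operator[OF _ _ k _ _ IRC, of "sphere 0 1"] by fastforce
  moreover have "b \<Longrightarrow> d"
    unfolding b_def d_def by (rule unconditional_mono) auto
  moreover have "d \<Longrightarrow> e"
    unfolding d_def e_def p using norm_independent_operator[OF _ _ k _ _ IRC, of "{-1, 1}"] by fastforce
  moreover have "c \<Longrightarrow> g"
    unfolding g_def
  proof (rule no_cycle_of_norm_independent_operators[OF IRC RC k])
    fix F assume c "finite F" "F \<subseteq> I"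
    then obtain x where x: "F \<subseteq> matrix_support R C x" "norm_independent_of_signs (sphere 0 1) (2 * k) R C x"
      unfolding c_def p by blast
    have "\<exists>z\<in>sphere 0 1. z * matrix_coeff x q = of_real (\<delta> * cmod (matrix_coeff x q))"
      if "\<delta> \<in> {-1, 1}" "q \<in> matrix_support R C x" for \<delta> q
    proof -
      have nz: "matrix_coeff x q \<noteq> 0" using that(2) by (simp add: matrix_support_def)
      \<comment> \<open>The conjugate phase turns the coefficient into its modulus, and \<delta>
        then supplies the sign.\<close>
      define z where "z = of_real \<delta> * cnj (sgn (matrix_coeff x q))"
      have "cmod z = 1" using that(1) nz by (auto simp: z_def norm_mult norm_sgn)
      moreover have "z * matrix_coeff x q = of_real (\<delta> * cmod (matrix_coeff x q))"
      proof -
        have "cnj (matrix_coeff x q) * matrix_coeff x q = of_real (cmod (matrix_coeff x q)) * of_real (cmod (matrix_coeff x q))"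
          using complex_norm_square[of "matrix_coeff x q"] by (simp only: power2_eq_square mult.commute of_real_mult)
        then show ?thesis using nz by (simp add: z_def sgn_eq mult.assoc)
      qed
      ultimately show ?thesis by auto
    qed
    with x show "\<exists>x. F \<subseteq> matrix_support R C x \<and> norm_independent_of_signs (sphere 0 1) (2 * k) R C x \<and>
      (\<forall>\<delta>\<in>{-1, 1}. \<forall>q\<in>matrix_support R C x. \<exists>z\<in>sphere 0 1. z * matrix_coeff x q = of_real (\<delta> * cmod (matrix_coeff x q)))"
      by blast
  qed
  moreover have "e \<Longrightarrow> g"
    unfolding g_def
  proof (rule no_cycle_of_norm_independent_operators[OF IRC RC k])
    fix F assume e: e and F: "finite F" "F \<subseteq> I"
    obtain x where x: "F \<subseteq> matrix_support R C x" "norm_independent_of_signs {-1, 1} (2 * k) R C x"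
      "\<forall>q\<in>R \<times> C. matrix_coeff x q \<in> \<real>"
      using e[unfolded e_def p, THEN spec[of _ F], THEN mp, OF conjI[OF F]] by (elim bexE conjE) (rule that)
    have "\<exists>z\<in>{-1, 1}. z * matrix_coeff x q = of_real (\<delta> * cmod (matrix_coeff x q))"
      if "\<delta> \<in> {-1, 1}" "q \<in> matrix_support R C x" for \<delta> q
    proof -
      have "matrix_coeff x q \<in> \<real>" using x(3) that(2) by (auto simp: matrix_support_def)
      then obtain y where y: "matrix_coeff x q = of_real y" by (rule Reals_cases)
      have "\<delta> * \<bar>y\<bar> = y \<or> \<delta> * \<bar>y\<bar> = - y" using that(1) by (auto simp: abs_if)
      then have "(of_real (\<delta> * \<bar>y\<bar>) :: complex) = 1 * of_real y \<or> (of_real (\<delta> * \<bar>y\<bar>) :: complex) = -1 * of_real y"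
        by (elim disjE) (simp_all only: of_real_minus mult_minus1 mult_1_left simp_thms)
      then show ?thesis unfolding y norm_of_real by (simp only: bex_simps) metis
    qed
    with x(1,2) show "\<exists>x. F \<subseteq> matrix_support R C x \<and> norm_independent_of_signs {-1, 1} (2 * k) R C x \<and>
      (\<forall>\<delta>\<in>{-1, 1}. \<forall>q\<in>matrix_support R C x. \<exists>z\<in>{-1, 1}. z * matrix_coeff x q = of_real (\<delta> * cmod (matrix_coeff x q)))"
      by blast
  qed
  ultimately show ?thesis by blast
qed

end
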